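(* Let $\nu$ be a finite Borel measure on $(0,1)$ and let $g:[0,1]\to[a,b]$ be a bi-Lipschitz mapping. Then, uniformly for $i\in\mathbb N$, $$\lambda^i_{\nu,[0,1]}\asymp\lambda^i_{\nu\circ g^{-1},[a,b]},$$ i.e. there is a constant $c\ge1$ such that $c^{-1}\lambda^i_{\nu,[0,1]}\le\lambda^i_{\nu\circ g^{-1},[a,b]}\le c\,\lambda^i_{\nu,[0,1]}$ for all $i\in\mathbb N$.
   Context: $\Lambda$ is Lebesgue measure. A mapping $g:[0,1]\to[a,b]$ is bi-Lipschitz if there are constants $c_1,c_2>0$ with $c_1|x-y|\le|g(x)-g(y)|\le c_2|x-y|$ for all $x,y\in[0,1]$. $\nu\circ g^{-1}$ is the image measure of $\nu$ under $g$. For a finite Borel measure $\mu$ on $(a,b)$ (regarded as a measure on $[a,b]$): $H^1_0(a,b)$ is the space of functions $f:[a,b]\to\mathbb R$ with $f(x)=\int_{[a,x]}h\,d\Lambda$ for some $h\in L^2_\Lambda([a,b])$ and $f(a)=f(b)=0$; $\nabla_\Lambda f:=h$. $C_\mu([a,b])$ is the set of continuous real functions on $[a,b]$ that are affine linear on every connected component of $[a,b]\setminus\operatorname{supp}\mu$. $\operatorname{dom}(\mathcal E_{\mu,[a,b]}):=H^1_0(a,b)\cap C_\mu([a,b])$ and $\mathcal E_{\mu,[a,b]}(f,h):=\int_{(a,b)}\nabla_\Lambda f\,\nabla_\Lambda h\,d\Lambda$. A number $\lambda$ is an eigenvalue of $\mathcal E_{\mu,[a,b]}$ if there is $f\in\operatorname{dom}(\mathcal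 E_{\mu,[a,b]})\setminus\{0\}$ with $\mathcal E_{\mu,[a,b]}(f,h)=\lambda\int fh\,d\mu$ for all $h\in\operatorname{dom}(\mathcal E_{\mu,[a,b]})$. $\lambda^i_{\mu,[a,b]}$ is the $i$-th eigenvalue of $\mathcal E_{\mu,[a,b]}$ in increasing order counted with multiplicity ($:=+\infty$ if there are fewer than $i$ eigenvalues). The same definitions apply with $[0,1]$ in place of $[a,b]$.
   Formalization: The bi-Lipschitz mapping g is assumed to map [0,1] onto [a,b]; for any g that is not onto, the claim fails for some ν (e.g. the inclusion of [0,1] into [-1,1] with rapidly decaying point masses at 2^{-k²}). *)

theory Defs
  imports "HOL-Analysis.Analysis" "HOL-Library.Function_Algebras"
begin

definition bi_lipschitz_on :: "real set \<Rightarrow> (real \<Rightarrow> real) \<Rightarrow> bool" where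
  "bi_lipschitz_on S g \<longleftrightarrow>
     (\<exists>c\<^sub>1>0. \<exists>c\<^sub>2>0. \<forall>x\<in>S. \<forall>y\<in>S.
        c\<^sub>1 * \<bar>x - y\<bar> \<le> \<bar>g x - g y\<bar> \<and> \<bar>g x - g y\<bar> \<le> c\<^sub>2 * \<bar>x - y\<bar>)"

text \<open>A Borel measure on the open interval \<open>(a, b)\<close> has the trace sigma-algebra and the
  underlying set \<open>(a, b)\<close> itself.\<close>

definition finite_borel_measure_on :: "real \<Rightarrow> real \<Rightarrow> real measure \<Rightarrow> bool" where
  "finite_borel_measure_on a b \<mu> \<longleftrightarrow>
     finite_measure \<mu> \<and> sets \<mu> = sets (restrict_space borel {a<..<b})"

definition image_measure ::
    "real \<Rightarrow> real \<Rightarrow> (real \<Rightarrow> real) \<Rightarrow> real measure \<Rightarrow> real measure" where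
  "image_measure a b g \<nu> = distr \<nu> (restrict_space borel {a<..<b}) g"

text \<open>Here \<open>\<mu>\<close> is regarded as a measure on \<open>[a, b]\<close>, so the end points can belong to the
  support although they carry no mass.\<close>

definition meas_support :: "real \<Rightarrow> real \<Rightarrow> real measure \<Rightarrow> real set" where
  "meas_support a b \<mu> =
     {x \<in> {a..b}. \<forall>U. open U \<and> x \<in> U \<longrightarrow> 0 < emeasure \<mu> (U \<inter> {a<..<b})}"

definition is_weak_gradient ::
    "real \<Rightarrow> real \<Rightarrow> (real \<Rightarrow> real) \<Rightarrow> (real \<Rightarrow> real) \<Rightarrow> bool" where
  "is_weak_gradient a b f h \<longleftrightarrow>
     set_borel_measurable lborel {a..b} h \<and>
     set_integrable lborel {a..b} (\<lambda>x. (h x)\<^sup>2) \<and>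
     (\<forall>x\<in>{a..b}. f x = (LINT t:{a..x}|lborel. h t))"

text \<open>A weak gradient is unique almost everywhere on \<open>[a, b]\<close>, so the choice of a
  representative does not affect the energy form.\<close>

definition weak_gradient :: "real \<Rightarrow> real \<Rightarrow> (real \<Rightarrow> real) \<Rightarrow> real \<Rightarrow> real" where
  "weak_gradient a b f = (SOME h. is_weak_gradient a b f h)"

text \<open>Functions on \<open>[a, b]\<close> are represented by functions on the real line that vanish outside
  \<open>[a, b]\<close>. This makes the representation unique, so that \<open>f \<noteq> 0\<close> and the dimension of
  spaces of such functions have their intended meaning.\<close>

definition H10 :: "real \<Rightarrow> real \<Rightarrow> (real \<Rightarrow> real) set" where
  "H10 a b = {f. (\<exists>h. is_weak_gradient a b f h) \<and> f a = 0 \<and> f b = 0 \<and>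
                 (\<forall>x. x \<notin> {a..b} \<longrightarrow> f x = 0)}"

definition C_meas :: "real \<Rightarrow> real \<Rightarrow> real measure \<Rightarrow> (real \<Rightarrow> real) set" where
  "C_meas a b \<mu> = {f. continuous_on {a..b} f \<and>
     (\<forall>x. x \<notin> {a..b} \<longrightarrow> f x = 0) \<and>
     (\<forall>C \<in> components ({a..b} - meas_support a b \<mu>). \<exists>p q. \<forall>x\<in>C. f x = p * x + q)}"

definition energy_dom :: "real \<Rightarrow> real \<Rightarrow> real measure \<Rightarrow> (real \<Rightarrow> real) set" where
  "energy_dom a b \<mu> = H10 a b \<inter> C_meas a b \<mu>"

definition energy :: "real \<Rightarrow> real \<Rightarrow> (real \<Rightarrow> real) \<Rightarrow> (real \<Rightarrow> real) \<Rightarrow> real" where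
  "energy a b f h = (LINT x:{a<..<b}|lborel. weak_gradient a b f x * weak_gradient a b h x)"

definition eigenspace :: "real \<Rightarrow> real \<Rightarrow> real measure \<Rightarrow> real \<Rightarrow> (real \<Rightarrow> real) set" where
  "eigenspace a b \<mu> l =
     {f \<in> energy_dom a b \<mu>.
        \<forall>h \<in> energy_dom a b \<mu>. energy a b f h = l * (LINT x|\<mu>. f x * h x)}"

definition is_eigenvalue :: "real \<Rightarrow> real \<Rightarrow> real measure \<Rightarrow> real \<Rightarrow> bool" where
  "is_eigenvalue a b \<mu> l \<longleftrightarrow> (\<exists>f \<in> eigenspace a b \<mu> l. f \<noteq> (\<lambda>x. 0))"

definition fun_scale :: "real \<Rightarrow> (real \<Rightarrow> real) \<Rightarrow> real \<Rightarrow> real" where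
  "fun_scale c f = (\<lambda>x. c * f x)"

lemma vector_space_fun_scale: "vector_space fun_scale"
  by unfold_locales (auto simp: fun_scale_def fun_eq_iff algebra_simps)

definition multiplicity_of :: "real \<Rightarrow> real \<Rightarrow> real measure \<Rightarrow> real \<Rightarrow> nat" where
  "multiplicity_of a b \<mu> l = vector_space.dim fun_scale (eigenspace a b \<mu> l)"

text \<open>At least \<open>i\<close> eigenvalues, counted with multiplicity, are \<open>\<le> l\<close>. Ranging over finite
  sets \<open>F\<close> avoids the convention that sums over infinite sets are zero.\<close>

definition at_least_eigenvalues_upto ::
    "real \<Rightarrow> real \<Rightarrow> real measure \<Rightarrow> nat \<Rightarrow> real \<Rightarrow> bool" where
  "at_least_eigenvalues_upto a b \<mu> i l \<longleftrightarrow>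
     (\<exists>F. finite F \<and> F \<subseteq> {k. is_eigenvalue a b \<mu> k \<and> k \<le> l} \<and>
          i \<le> (\<Sum>k\<in>F. multiplicity_of a b \<mu> k))"

text \<open>The \<open>i\<close>-th eigenvalue for \<open>i \<ge> 1\<close>; the infimum of the empty set is \<open>\<infinity>\<close>.\<close>

definition ith_eigenvalue :: "real \<Rightarrow> real \<Rightarrow> real measure \<Rightarrow> nat \<Rightarrow> ereal" where
  "ith_eigenvalue a b \<mu> i =
     Inf {ereal l | l. is_eigenvalue a b \<mu> l \<and> at_least_eigenvalues_upto a b \<mu> i l}"

end

theory Submission
  imports Defs
begin

text \<open>Counting eigenvalues below \<open>l\<close> is variational: there are at least \<open>i\<close> of them iff some
  \<open>i\<close>-dimensional subspace \<open>V\<close> of \<open>H\<^sup>1\<^sub>0\<close> satisfies \<open>\<E>(f, f) \<le> l \<integral> f\<^sup>2 d\<mu>\<close> on \<open>V\<close>. One can work in all of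
  \<open>H\<^sup>1\<^sub>0\<close>, because the functions that are affine off the support are exactly the energy-orthogonal
  complement of the null space of \<open>f \<mapsto> \<integral> f\<^sup>2 d\<mu>\<close>. Composition with a bi-Lipschitz map preserves
  \<open>\<integral> f\<^sup>2 d\<mu>\<close> and changes the energy by a bounded factor only, hence moves such subspaces between
  the two intervals with \<open>l\<close> multiplied by a constant.\<close>

section \<open>Spectral counting for a compact form relative to a closed form\<close>

text \<open>The domains themselves cannot be compared: composition with a bi-Lipschitz map destroys
  affinity on the gaps of the support, so \<open>energy_dom\<close> of one interval is not carried
  to that of the other. \<open>H10\<close> is carried over whatever the measure is. The criterion is
  an inequality E <= l * m and not a bound on a Rayleigh quotient, because the mass form can vanish
  on nonzero functions; since the energy is definite, the inequality itself forces m > 0 on the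
  nonzero vectors of a trial space. The mass is preserved exactly, as one measure is the image of
  the other. The energy grows by the first power of the Lipschitz constant only: of the two factors
  in the squared derivative, one is consumed by the change of variables. Hence the final constant is
  the larger of the Lipschitz constants of the map and of its inverse, or 1.\<close>

lemma homogeneous_system_nontrivial_solution:
  fixes A :: "nat \<Rightarrow> 's \<Rightarrow> real"
  assumes "finite S" "n < card S"
  shows "\<exists>c. (\<exists>s\<in>S. c s \<noteq> 0) \<and> (\<forall>j<n. (\<Sum>s\<in>S. A j s * c s) = 0)"
  using assms
proof (induction n arbitrary: S A)
  case 0
  then have "S \<noteq> {}" by auto
  then show ?case by (intro exI[of _ "\<lambda>_. 1"]) auto
next
  case (Suc n)
  show ?case
  proof (cases "\<forall>s\<in>S. A n s = 0")
    case True
    obtain c where "\<exists>s\<in>S. c s \<noteq> 0" "\<forall>j<n. (\<Sum>s\<in>S. A j s * c s) = 0"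
      using Suc.IH[of S A] Suc.prems by auto
    then show ?thesis using True by (intro exI[of _ c]) (auto simp: less_Suc_eq)
  next
    case False
    then obtain s0 where s0: "s0 \<in> S" "A n s0 \<noteq> 0" by auto
    \<comment> \<open>Gaussian elimination: equation n is solved for the unknown s0, and
      \<open>?A\<close> is what remains of the other equations after substitution. The value of that
      unknown is \<open>t\<close> below.\<close>
    let ?S = "S - {s0}" and ?A = "\<lambda>j s. A j s - A n s / A n s0 * A j s0"
    have "n < card ?S" using Suc.prems s0 by simp
    then obtain c where c: "\<exists>s\<in>?S. c s \<noteq> 0" "\<forall>j<n. (\<Sum>s\<in>?S. ?A j s * c s) = 0"
      using Suc.IH[of ?S ?A] Suc.prems by auto
    define t where "t = - (\<Sum>s\<in>?S. A n s * c s) / A n s0"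
    have sum: "(\<Sum>s\<in>S. A j s * (c(s0 := t)) s) = A j s0 * t + (\<Sum>s\<in>?S. A j s * c s)" for j
      using Suc.prems s0 by (subst sum.remove[of S s0]) auto
    have "(\<Sum>s\<in>S. A j s * (c(s0 := t)) s) = (\<Sum>s\<in>?S. ?A j s * c s)" for j
    proof -
      have "(\<Sum>s\<in>?S. A n s / A n s0 * A j s0 * c s) = - A j s0 * t"
        by (simp add: t_def sum_distrib_left sum_divide_distrib sum_negf mult_ac)
      then show ?thesis
        unfolding sum by (simp add: left_diff_distrib sum_subtractf)
    qed
    moreover have "(\<Sum>s\<in>S. A n s * (c(s0 := t)) s) = 0"
      unfolding sum using s0 by (simp add: t_def)
    ultimately show ?thesis using c
      by (intro exI[of _ "c(s0 := t)"]) (auto simp: less_Suc_eq)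
  qed
qed

lemma common_convergent_subsequence:
  fixes f :: "nat \<Rightarrow> nat \<Rightarrow> real"
  assumes "\<And>j. j < p \<Longrightarrow> bounded (range (f j))"
  shows "\<exists>r. strict_mono r \<and> (\<forall>j<p. convergent (\<lambda>n. f j (r n)))"
  using assms
proof (induction p)
  case 0
  show ?case by (intro exI[of _ id]) (auto simp: strict_mono_def)
next
  case (Suc p)
  then obtain r where r: "strict_mono r" "\<forall>j<p. convergent (\<lambda>n. f j (r n))" by auto
  have "bounded (range (\<lambda>n. f p (r n)))"
    by (rule bounded_subset[OF Suc.prems[of p]]) auto
  then obtain s l where s: "strict_mono s" "((\<lambda>n. f p (r n)) \<circ> s) \<longlonglongrightarrow> l"
    using bounded_imp_convergent_subsequence by blast
  have "convergent (\<lambda>n. f j (r (s n)))" if "j < p" for j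
    using r(2) that convergent_subseq_convergent[OF _ s(1), of "\<lambda>n. f j (r n)"] by (auto simp: o_def)
  moreover have "convergent (\<lambda>n. f p (r (s n)))" using s(2) by (auto simp: o_def convergent_def)
  ultimately show ?case using r(1) s(1)
    by (intro exI[of _ "r \<circ> s"]) (auto simp: less_Suc_eq strict_mono_def)
qed

text \<open>The laws are required on \<open>H\<close> only: the energy of a function without a
  gradient rests on an arbitrary choice. Semidefiniteness is all that is asked for, so that the same
  facts serve the energy, the mass form, and the shifted form E - L * m in
  \<open>minimizer\<close>.\<close>

locale psd_form = vector_space scale
  for scale :: "real \<Rightarrow> 'a::ab_group_add \<Rightarrow> 'a" (infixr "*s" 75) +
  fixes H :: "'a set" and E :: "'a \<Rightarrow> 'a \<Rightarrow> real"
  assumes H: "subspace H"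
    and add_left: "\<And>x y z. x \<in> H \<Longrightarrow> y \<in> H \<Longrightarrow> z \<in> H \<Longrightarrow> E (x + y) z = E x z + E y z"
    and scale_left: "\<And>c x y. x \<in> H \<Longrightarrow> y \<in> H \<Longrightarrow> E (c *s x) y = c * E x y"
    and sym: "\<And>x y. x \<in> H \<Longrightarrow> y \<in> H \<Longrightarrow> E x y = E y x"
    and nonneg: "\<And>x. x \<in> H \<Longrightarrow> 0 \<le> E x x"
begin

lemma add_right: "x \<in> H \<Longrightarrow> y \<in> H \<Longrightarrow> z \<in> H \<Longrightarrow> E x (y + z) = E x y + E x z"
  using add_left[of y z x] sym[of x] H by (simp add: subspace_add)

lemma scale_right: "x \<in> H \<Longrightarrow> y \<in> H \<Longrightarrow> E x (c *s y) = c * E x y"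
  using scale_left[of y x c] sym[of x] H by (simp add: subspace_scale)

lemma diff_left: "x \<in> H \<Longrightarrow> y \<in> H \<Longrightarrow> z \<in> H \<Longrightarrow> E (x - y) z = E x z - E y z"
  using add_left[of "x - y" y z] H by (simp add: subspace_diff)

lemma diff_right: "x \<in> H \<Longrightarrow> y \<in> H \<Longrightarrow> z \<in> H \<Longrightarrow> E x (y - z) = E x y - E x z"
  using add_right[of x "y - z" z] H by (simp add: subspace_diff)

lemma zero_left: "y \<in> H \<Longrightarrow> E 0 y = 0"
  using diff_left[of y y y] by simp

lemma sum_left:
  assumes "\<And>i. i \<in> I \<Longrightarrow> x i \<in> H" "y \<in> H"
  shows "E (\<Sum>i\<in>I. c i *s x i) y = (\<Sum>i\<in>I. c i * E (x i) y)"
  using assms(1)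
proof (induction I rule: infinite_finite_induct)
  case (insert i I)
  have "(\<Sum>i\<in>I. c i *s x i) \<in> H"
    using insert H by (intro subspace_sum subspace_scale) auto
  then show ?case using insert assms(2) H
    by (simp add: add_left scale_left subspace_scale)
qed (use assms(2) zero_left in auto)

lemma quad_add: "x \<in> H \<Longrightarrow> y \<in> H \<Longrightarrow> E (x + y) (x + y) = E x x + 2 * E x y + E y y"
  using H sym[of x y] by (simp add: add_left add_right subspace_add)

lemma quad_diff: "x \<in> H \<Longrightarrow> y \<in> H \<Longrightarrow> E (x - y) (x - y) = E x x - 2 * E x y + E y y"
  using H sym[of x y] by (simp add: diff_left diff_right subspace_diff)

lemma quad_scale: "x \<in> H \<Longrightarrow> E (c *s x) (c *s x) = c\<^sup>2 * E x x"
  using H by (simp add: scale_left scale_right subspace_scale power2_eq_square)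

lemma quad_diff_commute: "x \<in> H \<Longrightarrow> y \<in> H \<Longrightarrow> E (x - y) (x - y) = E (y - x) (y - x)"
  using sym[of x y] by (simp add: quad_diff)

lemma quad_diff_le: "x \<in> H \<Longrightarrow> y \<in> H \<Longrightarrow> E (x - y) (x - y) \<le> 2 * E x x + 2 * E y y"
  using nonneg[of "x + y"] H by (simp add: quad_diff quad_add subspace_add)

lemma Cauchy_Schwarz:
  assumes "x \<in> H" "y \<in> H"
  shows "(E x y)\<^sup>2 \<le> E x x * E y y"
proof -
  have *: "0 \<le> E x x + 2 * t * E x y + t\<^sup>2 * E y y" for t
  proof -
    have "t *s y \<in> H" using assms H by (simp add: subspace_scale)
    then show ?thesis using nonneg[of "x + t *s y"] assms H quad_scale[of y t]
      by (simp add: quad_add scale_right subspace_add mult.assoc)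
  qed
  show ?thesis
  proof (cases "E y y = 0")
    case True
    have "E x y = 0"
    proof (rule ccontr)
      assume "E x y \<noteq> 0"
      \<comment> \<open>With E y y = 0 the lower bound is affine in t, and this t gives it the value
        -1.\<close>
      then show False using *[of "- (E x x + 1) / (2 * E x y)"] True by (simp add: field_simps)
    qed
    then show ?thesis using True by simp
  next
    case False
    then have "0 < E y y" using nonneg[OF assms(2)] by simp
    then show ?thesis using *[of "- E x y / E y y"]
      by (simp add: field_simps power2_eq_square)
  qed
qed

lemma null_orthogonal: "x \<in> H \<Longrightarrow> y \<in> H \<Longrightarrow> E y y = 0 \<Longrightarrow> E x y = 0"
  using Cauchy_Schwarz[of x y] by simp

lemma tendsto_left:
  assumes "\<And>n. X n \<in> H" "x \<in> H" "y \<in> H" "(\<lambda>n. E (X n - x) (X n - x)) \<longlonglongrightarrow> 0"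
  shows "(\<lambda>n. E (X n) y) \<longlonglongrightarrow> E x y"
proof -
  have "(\<lambda>n. E (X n - x) (X n - x) * E y y) \<longlonglongrightarrow> 0"
    using tendsto_mult_right[OF assms(4)] by simp
  then have "(\<lambda>n. (E (X n - x) y)\<^sup>2) \<longlonglongrightarrow> 0"
    by (rule tendsto_0_le[where K=1])
       (use assms H Cauchy_Schwarz nonneg in \<open>auto intro!: always_eventually simp: subspace_diff abs_mult\<close>)
  then have "(\<lambda>n. E (X n - x) y) \<longlonglongrightarrow> 0"
    using tendsto_real_sqrt by fastforce
  then show ?thesis using assms by (simp add: diff_left LIM_zero_iff)
qed

lemma tendsto_quad:
  assumes "\<And>n. X n \<in> H" "x \<in> H" "(\<lambda>n. E (X n - x) (X n - x)) \<longlonglongrightarrow> 0"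
  shows "(\<lambda>n. E (X n) (X n)) \<longlonglongrightarrow> E x x"
proof -
  have "(\<lambda>n. E (X n - x) (X n - x) + 2 * E (X n) x - E x x) \<longlonglongrightarrow> 0 + 2 * E x x - E x x"
    by (intro tendsto_intros assms tendsto_left)
  then show ?thesis using assms by (simp add: quad_diff)
qed

end

text \<open>Compactness of \<open>m\<close> relative to \<open>E\<close> is expressed by finitely many bounded functionals \<open>\<phi> j\<close>; for the
  Sobolev space these are multiples of point evaluations. Bolzano--Weierstrass for the values
  \<open>\<phi> j (X n)\<close> then replaces Arzela--Ascoli.\<close>

locale form_pair = E: psd_form scale H E + m: psd_form scale H m
  for scale :: "real \<Rightarrow> 'a::ab_group_add \<Rightarrow> 'a" (infixr "*s" 75) and H E m +
  assumes definite: "\<And>x. x \<in> H \<Longrightarrow> E x x = 0 \<Longrightarrow> x = 0"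
    and complete: "\<And>X. (\<And>n. X n \<in> H) \<Longrightarrow>
      (\<And>e. e > 0 \<Longrightarrow> \<exists>N. \<forall>n\<ge>N. \<forall>k\<ge>N. E (X n - X k) (X n - X k) < e) \<Longrightarrow>
      \<exists>x\<in>H. (\<lambda>n. E (X n - x) (X n - x)) \<longlonglongrightarrow> 0"
    and compact: "\<And>e. e > 0 \<Longrightarrow> \<exists>p (\<phi> :: nat \<Rightarrow> 'a \<Rightarrow> real) B.
      (\<forall>j<p. \<forall>x\<in>H. \<forall>y\<in>H. \<phi> j (x + y) = \<phi> j x + \<phi> j y) \<and>
      (\<forall>j<p. \<forall>x\<in>H. \<forall>c. \<phi> j (c *s x) = c * \<phi> j x) \<and>
      (\<forall>j<p. \<forall>x\<in>H. (\<phi> j x)\<^sup>2 \<le> B * E x x) \<and>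
      (\<forall>x\<in>H. m x x \<le> e * E x x + (\<Sum>j<p. (\<phi> j x)\<^sup>2))"
begin

lemma compactE:
  assumes "e > 0"
  obtains p and \<phi> :: "nat \<Rightarrow> 'a \<Rightarrow> real" and B where
    "\<And>j x y. j < p \<Longrightarrow> x \<in> H \<Longrightarrow> y \<in> H \<Longrightarrow> \<phi> j (x + y) = \<phi> j x + \<phi> j y"
    "\<And>j x c. j < p \<Longrightarrow> x \<in> H \<Longrightarrow> \<phi> j (c *s x) = c * \<phi> j x"
    "\<And>j x. j < p \<Longrightarrow> x \<in> H \<Longrightarrow> (\<phi> j x)\<^sup>2 \<le> B * E x x"
    "\<And>x. x \<in> H \<Longrightarrow> m x x \<le> e * E x x + (\<Sum>j<p. (\<phi> j x)\<^sup>2)"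
proof -
  obtain p and \<phi> :: "nat \<Rightarrow> 'a \<Rightarrow> real" and B where
    "(\<forall>j<p. \<forall>x\<in>H. \<forall>y\<in>H. \<phi> j (x + y) = \<phi> j x + \<phi> j y) \<and>
      (\<forall>j<p. \<forall>x\<in>H. \<forall>c. \<phi> j (c *s x) = c * \<phi> j x) \<and>
      (\<forall>j<p. \<forall>x\<in>H. (\<phi> j x)\<^sup>2 \<le> B * E x x) \<and>
      (\<forall>x\<in>H. m x x \<le> e * E x x + (\<Sum>j<p. (\<phi> j x)\<^sup>2))"
    using compact[OF assms] by (elim exE) (rule that)
  then show thesis by (intro that[of p \<phi> B]) auto
qed

lemma m_le_E: "\<exists>C\<ge>0. \<forall>x\<in>H. m x x \<le> C * E x x"
proof -
  obtain p and \<phi> :: "nat \<Rightarrow> 'a \<Rightarrow> real" and B where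
    B: "\<And>j x. j < p \<Longrightarrow> x \<in> H \<Longrightarrow> (\<phi> j x)\<^sup>2 \<le> B * E x x"
    and le: "\<And>x. x \<in> H \<Longrightarrow> m x x \<le> 1 * E x x + (\<Sum>j<p. (\<phi> j x)\<^sup>2)"
    by (rule compactE[OF zero_less_one]) (rule that)
  have "m x x \<le> (1 + real p * \<bar>B\<bar>) * E x x" if x: "x \<in> H" for x
  proof -
    have "(\<Sum>j<p. (\<phi> j x)\<^sup>2) \<le> (\<Sum>j<p. \<bar>B\<bar> * E x x)"
    proof (intro sum_mono)
      fix j assume "j \<in> {..<p}"
      then show "(\<phi> j x)\<^sup>2 \<le> \<bar>B\<bar> * E x x"
        using B[of j x] x mult_right_mono[of B "\<bar>B\<bar>" "E x x"] E.nonneg by force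
    qed
    then show ?thesis using le[OF x] by (simp add: algebra_simps)
  qed
  then show ?thesis by (intro exI[of _ "1 + real p * \<bar>B\<bar>"]) auto
qed

lemma m_tendsto_0:
  assumes "\<And>n. X n \<in> H" "x \<in> H" "(\<lambda>n. E (X n - x) (X n - x)) \<longlonglongrightarrow> 0"
  shows "(\<lambda>n. m (X n - x) (X n - x)) \<longlonglongrightarrow> 0"
proof -
  obtain C where C: "C \<ge> 0" "\<forall>x\<in>H. m x x \<le> C * E x x" using m_le_E by auto
  show ?thesis
    by (rule tendsto_0_le[OF assms(3), of _ C])
       (use C assms m.nonneg E.nonneg E.H in \<open>auto intro!: always_eventually simp: E.subspace_diff mult.commute\<close>)
qed

text \<open>Minimizing sequences will be Cauchy for E - l * m only. Compactness makes up for the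
  term l * m: it is at most half of E plus l times finitely many squares, and these become small
  along a subsequence on which all the values \<phi> j converge. The half of E is then
  absorbed.\<close>

lemma convergent_subsequence:
  fixes X :: "nat \<Rightarrow> 'a"
  assumes X: "\<And>n. X n \<in> H" "\<And>n. E (X n) (X n) \<le> M" and l: "0 \<le> l"
    and q: "\<And>e. e > 0 \<Longrightarrow> \<exists>N. \<forall>n\<ge>N. \<forall>k\<ge>N.
          E (X n - X k) (X n - X k) - l * m (X n - X k) (X n - X k) < e"
  shows "\<exists>r x. strict_mono r \<and> x \<in> H \<and> (\<lambda>n. E (X (r n) - x) (X (r n) - x)) \<longlonglongrightarrow> 0"
proof -
  \<comment> \<open>Chosen so that l * \<epsilon> <= 1/2, which allows the absorption.\<close>
  define \<epsilon> where "\<epsilon> = 1 / (2 * (l + 1))"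
  have \<epsilon>: "\<epsilon> > 0" "l * \<epsilon> \<le> 1 / 2" using l by (auto simp: \<epsilon>_def field_simps)
  obtain p and \<phi> :: "nat \<Rightarrow> 'a \<Rightarrow> real" and B where
    add: "\<And>j x y. j < p \<Longrightarrow> x \<in> H \<Longrightarrow> y \<in> H \<Longrightarrow> \<phi> j (x + y) = \<phi> j x + \<phi> j y"
    and B: "\<And>j x. j < p \<Longrightarrow> x \<in> H \<Longrightarrow> (\<phi> j x)\<^sup>2 \<le> B * E x x"
    and le: "\<And>x. x \<in> H \<Longrightarrow> m x x \<le> \<epsilon> * E x x + (\<Sum>j<p. (\<phi> j x)\<^sup>2)"
    by (rule compactE[OF \<epsilon>(1)]) (rule that)
  have diff: "\<phi> j (x - y) = \<phi> j x - \<phi> j y" if "j < p" "x \<in> H" "y \<in> H" for j x y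
    using add[of j "x - y" y] that E.H by (simp add: E.subspace_diff)
  have "bounded (range (\<lambda>n. \<phi> j (X n)))" if j: "j < p" for j
  proof -
    have "norm (\<phi> j (X n)) \<le> sqrt (\<bar>B\<bar> * M)" for n
    proof -
      have "(\<phi> j (X n))\<^sup>2 \<le> B * E (X n) (X n)" using B j X by auto
      also have "\<dots> \<le> \<bar>B\<bar> * E (X n) (X n)" using E.nonneg X by (intro mult_right_mono) auto
      also have "\<dots> \<le> \<bar>B\<bar> * M" using X by (intro mult_left_mono) auto
      finally show ?thesis using real_le_rsqrt real_sqrt_abs[of "\<phi> j (X n)"]
        by (metis real_norm_def real_sqrt_le_mono)
    qed
    then show ?thesis by (auto simp: bounded_iff)
  qed
  then obtain r where r: "strict_mono r" "\<And>j. j < p \<Longrightarrow> convergent (\<lambda>n. \<phi> j (X (r n)))"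
    using common_convergent_subsequence[of p "\<lambda>j n. \<phi> j (X n)"] by auto
  define D where "D n k = X (r n) - X (r k)" for n k
  have D: "D n k \<in> H" for n k using X E.H by (auto simp: D_def E.subspace_diff)
  have small: "\<exists>N. \<forall>n\<ge>N. \<forall>k\<ge>N. E (D n k) (D n k) < e" if e: "e > 0" for e
  proof -
    obtain N1 where N1: "\<And>n k. n \<ge> N1 \<Longrightarrow> k \<ge> N1 \<Longrightarrow> E (X n - X k) (X n - X k) - l * m (X n - X k) (X n - X k) < e / 4"
      using q[of "e / 4"] e by auto
    \<comment> \<open>With this d the p squares, multiplied by l, contribute at most e/4. The form E
      - l * m contributes another e/4, and absorbing half of E doubles the sum. The 1 keeps the
      denominator positive.\<close>
    define d where "d = sqrt (e / (4 * (l * real p + 1)))"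
    have d: "d > 0" using e l by (auto simp: d_def intro!: divide_pos_pos add_nonneg_pos)
    have "\<forall>j\<in>{..<p}. \<exists>N. \<forall>n\<ge>N. \<forall>k\<ge>N. \<bar>\<phi> j (X (r n)) - \<phi> j (X (r k))\<bar> < d"
    proof
      fix j assume "j \<in> {..<p}"
      then have "Cauchy (\<lambda>n. \<phi> j (X (r n)))" using r by (auto simp: Cauchy_convergent_iff)
      from CauchyD[OF this d] show "\<exists>N. \<forall>n\<ge>N. \<forall>k\<ge>N. \<bar>\<phi> j (X (r n)) - \<phi> j (X (r k))\<bar> < d" by auto
    qed
    then obtain N2 where N2: "\<And>j n k. j < p \<Longrightarrow> n \<ge> N2 j \<Longrightarrow> k \<ge> N2 j \<Longrightarrow> \<bar>\<phi> j (X (r n)) - \<phi> j (X (r k))\<bar> < d"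
      by (metis lessThan_iff)
    define N where "N = Max (insert N1 (N2 ` {..<p}))"
    have N: "N1 \<le> N" "\<And>j. j < p \<Longrightarrow> N2 j \<le> N" by (auto simp: N_def)
    have "E (D n k) (D n k) < e" if nk: "n \<ge> N" "k \<ge> N" for n k
    proof -
      have "(\<Sum>j<p. (\<phi> j (D n k))\<^sup>2) \<le> (\<Sum>j<p. d\<^sup>2)"
      proof (intro sum_mono)
        fix j assume j: "j \<in> {..<p}"
        have "\<bar>\<phi> j (D n k)\<bar> \<le> \<bar>d\<bar>" using N2[of j n k] N(2)[of j] j nk X diff[of j] d
          by (auto simp: D_def)
        then show "(\<phi> j (D n k))\<^sup>2 \<le> d\<^sup>2" by (simp only: abs_le_square_iff)
      qed
      then have "l * (\<Sum>j<p. (\<phi> j (D n k))\<^sup>2) \<le> (l * real p) * d\<^sup>2"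
        using l mult_left_mono by (fastforce simp: mult.assoc)
      also have "\<dots> \<le> (l * real p + 1) * d\<^sup>2" by (intro mult_right_mono) auto
      also have "\<dots> = e / 4"
      proof -
        have pos: "0 < l * real p + 1" using l by (intro add_nonneg_pos) auto
        then have "d\<^sup>2 = e / (4 * (l * real p + 1))" using e by (simp add: d_def)
        then show ?thesis using pos by (simp only:) (simp add: divide_simps)
      qed
      finally have 1: "l * (\<Sum>j<p. (\<phi> j (D n k))\<^sup>2) \<le> e / 4" .
      have "r n \<ge> N1" "r k \<ge> N1" using N(1) nk seq_suble[OF r(1)] le_trans by blast+
      then have 2: "E (D n k) (D n k) - l * m (D n k) (D n k) < e / 4" unfolding D_def using N1 by blast
      have "l * m (D n k) (D n k) \<le> l * (\<epsilon> * E (D n k) (D n k) + (\<Sum>j<p. (\<phi> j (D n k))\<^sup>2))"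
        using le[OF D] l by (intro mult_left_mono) auto
      moreover have "(l * \<epsilon>) * E (D n k) (D n k) \<le> 1 / 2 * E (D n k) (D n k)"
        using \<epsilon> E.nonneg[OF D] by (intro mult_right_mono) auto
      ultimately show ?thesis using 1 2 by (simp add: algebra_simps)
    qed
    then show ?thesis by blast
  qed
  obtain x where "x \<in> H" "(\<lambda>n. E (X (r n) - x) (X (r n) - x)) \<longlonglongrightarrow> 0"
    using complete[of "\<lambda>n. X (r n)"] X small unfolding D_def by auto
  then show ?thesis using r by blast
qed

section \<open>Eigenspaces: finite multiplicity and orthogonality\<close>

definition eigen :: "real \<Rightarrow> 'a set" where
  "eigen l = {f \<in> H. \<forall>h\<in>H. E f h = l * m f h}"

lemma subspace_eigen: "E.subspace (eigen l)"
  using E.H unfolding E.subspace_def eigen_def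
  by (auto simp: E.add_left m.add_left E.scale_left m.scale_left E.zero_left m.zero_left distrib_left)

text \<open>More independent vectors than functionals leave a nonzero x in the span on which every
  \<phi> j vanishes. There m x x <= \<epsilon> * E x x, hence E x x <= E x x / 2, which contradicts
  definiteness. Applied to eigenvectors, this bounds the multiplicities.\<close>

lemma card_bounded_of_span_bound:
  "\<exists>n. \<forall>S\<subseteq>H. finite S \<longrightarrow> E.independent S \<longrightarrow> (\<forall>x\<in>E.span S. E x x \<le> l * m x x) \<longrightarrow> card S \<le> n"
proof -
  define \<epsilon> where "\<epsilon> = 1 / (2 * (\<bar>l\<bar> + 1))"
  have \<epsilon>: "\<epsilon> > 0" "\<bar>l\<bar> * \<epsilon> \<le> 1 / 2" by (auto simp: \<epsilon>_def field_simps)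
  obtain p and \<phi> :: "nat \<Rightarrow> 'a \<Rightarrow> real" where
    add: "\<And>j x y. j < p \<Longrightarrow> x \<in> H \<Longrightarrow> y \<in> H \<Longrightarrow> \<phi> j (x + y) = \<phi> j x + \<phi> j y"
    and sc: "\<And>j x c. j < p \<Longrightarrow> x \<in> H \<Longrightarrow> \<phi> j (c *s x) = c * \<phi> j x"
    and le: "\<And>x. x \<in> H \<Longrightarrow> m x x \<le> \<epsilon> * E x x + (\<Sum>j<p. (\<phi> j x)\<^sup>2)"
    by (rule compactE[OF \<epsilon>(1)]) (rule that)
  have "card S \<le> p" if S: "S \<subseteq> H" "finite S" "E.independent S" "\<And>x. x\<in>E.span S \<Longrightarrow> E x x \<le> l * m x x" for S
  proof (rule ccontr)
    assume "\<not> card S \<le> p"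
    then obtain c where c: "\<exists>s\<in>S. c s \<noteq> 0" "\<forall>j<p. (\<Sum>s\<in>S. \<phi> j s * c s) = 0"
      using homogeneous_system_nontrivial_solution[of S p \<phi>] S by auto
    define x where "x = (\<Sum>s\<in>S. c s *s s)"
    have x0: "x \<noteq> 0"
      using c(1) E.independentD[OF S(3,2) subset_refl] by (auto simp: x_def)
    have xs: "x \<in> E.span S" unfolding x_def by (intro E.span_sum E.span_scale E.span_base)
    then have xH: "x \<in> H" using S E.H E.span_minimal by blast
    have "\<phi> j (\<Sum>s\<in>T. c s *s s) = (\<Sum>s\<in>T. \<phi> j s * c s)" if j: "j < p" and "T \<subseteq> S" for j T
      using finite_subset[OF that(2) S(2)] that(2)
    proof (induction T)
      case empty
      show ?case using sc[OF j, of 0 0] E.subspace_0[OF E.H] by simp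
    next
      case (insert s T)
      have "(\<Sum>s\<in>T. c s *s s) \<in> H"
        using insert.prems S(1) E.H by (intro E.subspace_sum E.subspace_scale) auto
      then show ?case using insert S(1) E.H j by (auto simp: add sc E.subspace_scale)
    qed
    then have "\<phi> j x = 0" if "j < p" for j using c(2) that by (auto simp: x_def)
    then have "m x x \<le> \<epsilon> * E x x" using le[OF xH] by simp
    then have "\<bar>l\<bar> * m x x \<le> \<bar>l\<bar> * (\<epsilon> * E x x)" by (intro mult_left_mono) auto
    moreover have "l * m x x \<le> \<bar>l\<bar> * m x x" using m.nonneg[OF xH] by (intro mult_right_mono) auto
    moreover have "(\<bar>l\<bar> * \<epsilon>) * E x x \<le> 1 / 2 * E x x" using \<epsilon> E.nonneg[OF xH] by (intro mult_right_mono) auto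
    ultimately have "E x x \<le> 1 / 2 * E x x" using S(4)[OF xs] by (simp add: mult.assoc)
    then have "E x x = 0" using E.nonneg[OF xH] by simp
    then show False using definite[OF xH] x0 by simp
  qed
  then show ?thesis by blast
qed

text \<open>\<open>dim\<close> is the cardinality of a basis, which is 0 for an infinite one;
  finiteness makes the multiplicity a true dimension.\<close>

lemma eigen_basis:
  "\<exists>B\<subseteq>eigen l. finite B \<and> E.independent B \<and> eigen l = E.span B \<and> card B = E.dim (eigen l)"
proof -
  obtain B where B: "B \<subseteq> eigen l" "E.independent B" "eigen l \<subseteq> E.span B" "card B = E.dim (eigen l)"
    using E.basis_exists[of "eigen l"] by metis
  obtain n where n: "\<And>S. S\<subseteq>H \<Longrightarrow> finite S \<Longrightarrow> E.independent S \<Longrightarrow> (\<And>x. x\<in>E.span S \<Longrightarrow> E x x \<le> l * m x x) \<Longrightarrow> card S \<le> n"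
    using card_bounded_of_span_bound[of l] by metis
  have "finite B"
  proof (rule ccontr)
    assume "infinite B"
    then obtain S where S: "S \<subseteq> B" "finite S" "card S = Suc n"
      using infinite_arbitrarily_large by blast
    have "x \<in> eigen l" if "x \<in> E.span S" for x
      using that S(1) B(1) E.span_minimal[OF _ subspace_eigen] by blast
    then have "card S \<le> n" using S B by (intro n) (auto simp: eigen_def E.independent_mono)
    then show False using S by simp
  qed
  moreover have "eigen l = E.span B" using B E.span_minimal[OF B(1) subspace_eigen] by auto
  ultimately show ?thesis using B by auto
qed

lemma eigen_orthogonal:
  assumes "f \<in> eigen k" "h \<in> eigen l" "k \<noteq> l"
  shows "m f h = 0"
proof -
  have "k * m f h = l * m f h"
    using assms E.sym[of f h] m.sym[of f h] by (auto simp: eigen_def)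
  then show ?thesis using assms(3) by simp
qed

text \<open>Bases of the eigenspaces are put together. Eigenspaces of different eigenvalues are
  orthogonal for m and hence for E, so both forms split on a sum, and each piece satisfies E = k * m
  <= l * m.\<close>

lemma span_bound_of_eigenvalues:
  assumes "finite F" "\<And>k. k \<in> F \<Longrightarrow> k \<le> l"
  shows "\<exists>S\<subseteq>H. finite S \<and> E.independent S \<and> card S = (\<Sum>k\<in>F. E.dim (eigen k)) \<and>
    (\<forall>x\<in>E.span S. E x x \<le> l * m x x)"
proof -
  \<comment> \<open>The induction also carries that the span is orthogonal to every eigenspace still
    to be added; independence and the vanishing of the cross terms both rest on this.\<close>
  have "\<exists>S\<subseteq>H. finite S \<and> E.independent S \<and> card S = (\<Sum>k\<in>F. E.dim (eigen k)) \<and>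
    (\<forall>x\<in>E.span S. E x x \<le> l * m x x) \<and> (\<forall>k. k \<notin> F \<longrightarrow> (\<forall>x\<in>E.span S. \<forall>y\<in>eigen k. m x y = 0))"
    using assms
  proof (induction F)
    case empty
    show ?case using E.independent_empty
      by (intro exI[of _ "{}"]) (auto simp: E.zero_left m.zero_left E.subspace_0[OF E.H] eigen_def)
  next
    case (insert k F)
    then obtain S where S: "S \<subseteq> H" "finite S" "E.independent S" "card S = (\<Sum>k\<in>F. E.dim (eigen k))"
      "\<And>x. x\<in>E.span S \<Longrightarrow> E x x \<le> l * m x x"
      "\<And>k x y. k \<notin> F \<Longrightarrow> x\<in>E.span S \<Longrightarrow> y\<in>eigen k \<Longrightarrow> m x y = 0" by auto
    obtain B where B: "B \<subseteq> eigen k" "finite B" "E.independent B" "eigen k = E.span B" "card B = E.dim (eigen k)"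
      using eigen_basis by metis
    have SH: "E.span S \<subseteq> H" using S E.span_minimal E.H by blast
    have eH: "eigen k \<subseteq> H" by (auto simp: eigen_def)
    have ek: "E x h = k * m x h" if "x \<in> eigen k" "h \<in> H" for x h using that by (auto simp: eigen_def)
    have int: "x = 0" if x: "x \<in> E.span S" "x \<in> E.span B" for x
    proof -
      \<comment> \<open>A common vector is orthogonal to itself, and for an eigenvector m x x = 0
        entails E x x = 0.\<close>
      have "m x x = 0" using S(6)[of k x x] x B insert by auto
      then have "E x x = 0" using ek[of x x] x B SH by auto
      then show ?thesis using definite x SH by blast
    qed
    have ind: "E.independent (S \<union> B)"
    proof -
      have "c v = 0" if sum: "(\<Sum>v\<in>S \<union> B. c v *s v) = 0" and v: "v \<in> S \<union> B" for c v
      proof -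
        have dis: "S \<inter> B = {}"
          using int E.span_base E.dependent_zero[of S] S(3) by blast
        define s b where "s = (\<Sum>v\<in>S. c v *s v)" and "b = (\<Sum>v\<in>B. c v *s v)"
        have sb: "s + b = 0" using sum dis S(2) B(2) by (simp add: sum.union_disjoint s_def b_def)
        have "s \<in> E.span S" "b \<in> E.span B"
          unfolding s_def b_def by (rule E.span_sum, rule E.span_scale, rule E.span_base, assumption)+
        moreover have "s = - b" using sb by (simp add: eq_neg_iff_add_eq_0)
        ultimately have "s = 0" using int E.span_neg by blast
        then show ?thesis
          using sb v E.independentD[OF S(3,2) subset_refl, of c] E.independentD[OF B(3,2) subset_refl, of c]
          by (auto simp: s_def b_def)
      qed
      then show ?thesis using S(2) B(2) by (auto simp: E.dependent_finite)
    qed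
    have dis: "S \<inter> B = {}"
      using int E.span_base E.dependent_zero[of S] S(3) by blast
    have dec: "\<exists>s b. x = s + b \<and> s \<in> E.span S \<and> b \<in> eigen k" if "x \<in> E.span (S \<union> B)" for x
      using that B(4) unfolding E.span_Un by auto
    have le: "E x x \<le> l * m x x" if x: "x \<in> E.span (S \<union> B)" for x
    proof -
      obtain s b where sb: "x = s + b" "s \<in> E.span S" "b \<in> eigen k" using dec[OF x] by auto
      have H': "s \<in> H" "b \<in> H" using sb SH eH by auto
      have 0: "m s b = 0" using S(6) sb insert by auto
      have "E s b = 0" using ek[OF sb(3) H'(1)] 0 E.sym m.sym H' by force
      then have "E x x = E s s + k * m b b"
        using ek[OF sb(3) H'(2)] H' by (simp add: sb E.quad_add)
      also have "\<dots> \<le> l * m s s + l * m b b"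
        using S(5)[OF sb(2)] insert.prems[of k] m.nonneg[OF H'(2)] by (intro add_mono mult_right_mono) auto
      also have "\<dots> = l * m x x" using 0 m.quad_add[OF H'] by (simp add: sb distrib_left)
      finally show ?thesis .
    qed
    have orth: "m x y = 0" if jxy: "j \<notin> insert k F" "x \<in> E.span (S \<union> B)" "y \<in> eigen j" for j x y
    proof -
      obtain s b where sb: "x = s + b" "s \<in> E.span S" "b \<in> eigen k" using dec[OF jxy(2)] by auto
      have "m s y = 0" "m b y = 0" using S(6) sb jxy eigen_orthogonal by auto
      then show ?thesis using sb SH eH jxy by (subst sb) (subst m.add_left, auto simp: eigen_def)
    qed
    show ?case
      using S B ind le orth dis insert.hyps eH
      by (intro exI[of _ "S \<union> B"]) (auto simp: card_Un_disjoint)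
  qed
  then show ?thesis by auto
qed

text \<open>Minimizes the Rayleigh quotient on the m-orthogonal complement \<open>W\<close> of the
  eigenvectors found so far; \<open>f0\<close> is the competitor that makes the problem nonempty and
  its infimum at most l. The eigenvalue equation comes without differentiation: the minimizer is a
  null vector of the semidefinite form q = E - L * m, and by Cauchy-Schwarz a null vector is
  orthogonal to all of \<open>W\<close>.\<close>

lemma minimizer:
  fixes e :: "nat \<Rightarrow> 'a" and \<Lambda> :: "nat \<Rightarrow> real"
  assumes e: "\<And>j. j < k \<Longrightarrow> e j \<in> eigen (\<Lambda> j)"
    and on: "\<And>i j. i < k \<Longrightarrow> j < k \<Longrightarrow> m (e i) (e j) = (if i = j then 1 else 0)"
    and f0: "f0 \<in> H" "f0 \<noteq> 0" "\<And>j. j < k \<Longrightarrow> m f0 (e j) = 0" "E f0 f0 \<le> l * m f0 f0"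
  shows "\<exists>f L. L \<le> l \<and> f \<in> eigen L \<and> m f f = 1 \<and> (\<forall>j<k. m f (e j) = 0)"
proof -
  have eH: "e j \<in> H" if "j < k" for j using e[OF that] by (auto simp: eigen_def)
  define W where "W = {f \<in> H. \<forall>j<k. m f (e j) = 0}"
  have WH: "W \<subseteq> H" by (auto simp: W_def)
  have W: "E.subspace W" unfolding E.subspace_def using E.H eH
    by (auto simp: W_def m.zero_left m.add_left m.scale_left E.subspace_def)
  define R where "R = {E f f | f. f \<in> W \<and> m f f = 1}"
  have norm: "E x x / m x x \<in> R" if "x \<in> W" "m x x \<noteq> 0" for x
  proof -
    have mx: "m x x > 0" using that WH m.nonneg[of x] by force
    define y where "y = (1 / sqrt (m x x)) *s x"
    have "y \<in> W" using W that by (auto simp: y_def E.subspace_scale)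
    moreover have "m y y = 1" "E y y = E x x / m x x"
      using that WH mx by (auto simp: y_def m.quad_scale E.quad_scale power_divide)
    ultimately show ?thesis unfolding R_def by force
  qed
  have Ef0: "E f0 f0 > 0" using f0 definite E.nonneg[of f0] by force
  then have mf0: "m f0 f0 \<noteq> 0" using f0(4) by auto
  then have mf0': "m f0 f0 > 0" using m.nonneg[OF f0(1)] by simp
  have f0W: "f0 \<in> W" using f0 by (auto simp: W_def)
  have R0: "E f0 f0 / m f0 f0 \<in> R" using norm[OF f0W mf0] .
  have bdd: "bdd_below R" using E.nonneg WH by (intro bdd_belowI[of _ 0]) (auto simp: R_def)
  define L where "L = Inf R"
  have "L \<le> E f0 f0 / m f0 f0" unfolding L_def by (rule cInf_lower[OF R0 bdd])
  also have "\<dots> \<le> l" using f0(4) mf0' by (simp add: divide_simps)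
  finally have Ll: "L \<le> l" .
  have L0: "0 \<le> L" unfolding L_def using R0 E.nonneg WH by (intro cInf_greatest) (auto simp: R_def)
  define q where "q x y = E x y - L * m x y" for x y
  have q0: "0 \<le> q x x" if "x \<in> W" for x
  proof (cases "m x x = 0")
    case True
    then show ?thesis using that WH E.nonneg by (auto simp: q_def)
  next
    case False
    then have "m x x > 0" using m.nonneg that WH by force
    moreover have "L \<le> E x x / m x x" unfolding L_def using cInf_lower[OF norm[OF that False] bdd] .
    ultimately show ?thesis by (simp add: q_def field_simps)
  qed
  interpret q: psd_form scale W q
    using W WH q0
    by unfold_locales (auto simp: q_def subset_iff E.add_left m.add_left E.scale_left m.scale_left E.sym m.sym algebra_simps)
  have "\<exists>x. x \<in> W \<and> m x x = 1 \<and> E x x < L + 1 / real (Suc n)" for n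
  proof -
    have "\<exists>r\<in>R. r < L + 1 / real (Suc n)"
      unfolding L_def using R0 by (intro cInf_lessD) auto
    then show ?thesis by (auto simp: R_def)
  qed
  then obtain X where X: "\<And>n. X n \<in> W" "\<And>n. m (X n) (X n) = 1" "\<And>n. E (X n) (X n) < L + 1 / real (Suc n)"
    by metis
  have qX: "q (X n) (X n) < 1 / real (Suc n)" for n using X(2)[of n] X(3)[of n] by (simp add: q_def)
  have "\<exists>N. \<forall>n\<ge>N. \<forall>k\<ge>N. E (X n - X k) (X n - X k) - L * m (X n - X k) (X n - X k) < d" if d: "d > 0" for d
  proof -
    \<comment> \<open>The factor 4 accounts for \<open>quad_diff_le\<close>, which bounds q of a
      difference by twice the sum of the two values.\<close>
    obtain N where N: "1 / real (Suc N) < d / 4" using d nat_approx_posE[of "d/4"] by auto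
    have "q (X n - X k) (X n - X k) < d" if "n \<ge> N" "k \<ge> N" for n k
    proof -
      have "1 / real (Suc n) \<le> 1 / real (Suc N)" "1 / real (Suc k) \<le> 1 / real (Suc N)"
        using that by (auto simp: frac_le)
      then show ?thesis using q.quad_diff_le[OF X(1) X(1), of n k] qX[of n] qX[of k] N by linarith
    qed
    then show ?thesis unfolding q_def by blast
  qed
  moreover have "E (X n) (X n) \<le> L + 1" for n
  proof -
    have "1 / real (Suc n) \<le> 1" by simp
    then show ?thesis using X(3)[of n] by linarith
  qed
  ultimately obtain r x where r: "strict_mono r" and x: "x \<in> H" "(\<lambda>n. E (X (r n) - x) (X (r n) - x)) \<longlonglongrightarrow> 0"
    using convergent_subsequence[of X "L + 1" L] X WH L0 by blast
  have XH: "X n \<in> H" for n using X WH by auto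
  have mlim: "(\<lambda>n. m (X (r n) - x) (X (r n) - x)) \<longlonglongrightarrow> 0"
    using m_tendsto_0[of "\<lambda>n. X (r n)"] XH x by auto
  have "m x (e j) = 0" if "j < k" for j
  proof -
    have "(\<lambda>n. m (X (r n)) (e j)) \<longlonglongrightarrow> m x (e j)"
      using m.tendsto_left[of "\<lambda>n. X (r n)"] XH x mlim eH that by auto
    moreover have "m (X n) (e j) = 0" for n using X(1)[of n] that by (auto simp: W_def)
    ultimately show ?thesis using LIMSEQ_const_iff[of 0 "m x (e j)"] by simp
  qed
  then have xW: "x \<in> W" using x by (auto simp: W_def)
  have mx: "m x x = 1"
    using m.tendsto_quad[of "\<lambda>n. X (r n)"] XH x mlim X(2) LIMSEQ_const_iff[of 1 "m x x"] by simp
  have "E x x \<le> L"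
  proof (rule LIMSEQ_le)
    show "(\<lambda>n. E (X (r n)) (X (r n))) \<longlonglongrightarrow> E x x"
      using E.tendsto_quad[of "\<lambda>n. X (r n)"] XH x by auto
    have "(\<lambda>n. L + 1 / real (Suc n)) \<longlonglongrightarrow> L + 0"
      using LIMSEQ_inverse_real_of_nat by (intro tendsto_intros) (simp add: inverse_eq_divide)
    then show "(\<lambda>n. L + 1 / real (Suc (r n))) \<longlonglongrightarrow> L"
      using LIMSEQ_subseq_LIMSEQ[OF _ r] by (fastforce simp: o_def)
  qed (use X(3) less_imp_le in blast)
  then have qx: "q x x = 0" using q0[OF xW] mx by (auto simp: q_def)
  have "E x h = L * m x h" if h: "h \<in> H" for h
  proof -
    define c where "c j = m h (e j)" for j
    \<comment> \<open>z is the m-projection of h onto the span of the e j. The equation holds for h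
      - z in \<open>W\<close> because x is a null vector of q, and for z because both sides
      vanish.\<close>
    define z where "z = (\<Sum>j<k. c j *s e j)"
    have zH: "z \<in> H" unfolding z_def using eH E.H by (intro E.subspace_sum E.subspace_scale) auto
    have "m z (e i) = c i" if "i < k" for i
      unfolding z_def using that eH on by (subst m.sum_left) (auto simp: if_distrib[of "\<lambda>x. _ * x"] sum.delta cong: if_cong)
    then have hz: "h - z \<in> W" using h zH eH E.H by (auto simp: W_def m.diff_left c_def E.subspace_diff)
    have "q (h - z) x = 0" using q.null_orthogonal[OF hz xW qx] .
    moreover have "E z x = L * m z x"
    proof -
      have "E (e j) x = 0 \<and> m (e j) x = 0" if "j < k" for j
        using e[OF that] xW x that m.sym[OF x(1) eH[OF that]] by (auto simp: eigen_def W_def)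
      then show ?thesis unfolding z_def
        using eH x(1) E.sum_left[of "{..<k}" e x c] m.sum_left[of "{..<k}" e x c] by auto
    qed
    ultimately show ?thesis using h zH x E.sym[of x h] m.sym[of x h]
      by (simp add: q_def E.diff_left m.diff_left algebra_simps)
  qed
  then have "x \<in> eigen L" using x by (auto simp: eigen_def)
  then show ?thesis using Ll mx xW unfolding W_def by blast
qed

text \<open>An m-orthonormal system of eigenvectors is grown to length card S. While its length k is
  smaller, k linear conditions leave a nonzero vector of the span of S orthogonal to the system, and
  \<open>minimizer\<close> turns it into a further eigenvector. Grouping by eigenvalue gives the
  dimension count.\<close>

lemma eigenvalues_of_span_bound:
  assumes S: "S \<subseteq> H" "finite S" "E.independent S" "\<And>x. x \<in> E.span S \<Longrightarrow> E x x \<le> l * m x x"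
  shows "\<exists>F. finite F \<and> (\<forall>k\<in>F. k \<le> l \<and> eigen k \<noteq> {0}) \<and> card S \<le> (\<Sum>k\<in>F. E.dim (eigen k))"
proof -
  have "\<exists>e \<Lambda>. (\<forall>j<k. e j \<in> eigen (\<Lambda> j) \<and> \<Lambda> j \<le> l) \<and>
      (\<forall>i<k. \<forall>j<k. m (e i) (e j) = (if i = j then 1 else 0))" if "k \<le> card S" for k
    using that
  proof (induction k)
    case (Suc k)
    then obtain e \<Lambda> where e': "\<forall>j<k. e j \<in> eigen (\<Lambda> j) \<and> \<Lambda> j \<le> l"
      and on': "\<forall>i<k. \<forall>j<k. m (e i) (e j) = (if i = j then 1 else 0)" by auto
    have e: "\<And>j. j < k \<Longrightarrow> e j \<in> eigen (\<Lambda> j)" "\<And>j. j < k \<Longrightarrow> \<Lambda> j \<le> l"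
      and on: "\<And>i j. i < k \<Longrightarrow> j < k \<Longrightarrow> m (e i) (e j) = (if i = j then 1 else 0)"
      using e' on' by auto
    have eH: "e j \<in> H" if "j < k" for j using e(1)[OF that] by (auto simp: eigen_def)
    obtain c where c: "\<exists>s\<in>S. c s \<noteq> 0" "\<forall>j<k. (\<Sum>s\<in>S. m s (e j) * c s) = 0"
      using homogeneous_system_nontrivial_solution[of S k "\<lambda>j s. m s (e j)"] S Suc.prems by auto
    define x where "x = (\<Sum>s\<in>S. c s *s s)"
    have x0: "x \<noteq> 0"
      using c(1) E.independentD[OF S(3,2) subset_refl] by (auto simp: x_def)
    have xs: "x \<in> E.span S" unfolding x_def by (intro E.span_sum E.span_scale E.span_base)
    then have xH: "x \<in> H" using S E.H E.span_minimal by blast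
    have "m x (e j) = 0" if "j < k" for j
      unfolding x_def using c(2) that S(1) eH by (subst m.sum_left) (auto simp: mult.commute)
    then obtain f L where f: "L \<le> l" "f \<in> eigen L" "m f f = 1" "\<And>j. j < k \<Longrightarrow> m f (e j) = 0"
      using minimizer[OF e(1) on xH x0] S(4)[OF xs] by blast
    have "m (e j) f = 0" if "j < k" for j
      using f m.sym[of "e j" f] eH that by (auto simp: eigen_def)
    then show ?case using f e on
      by (intro exI[of _ "e(k := f)"] exI[of _ "\<Lambda>(k := L)"]) (auto simp: less_Suc_eq)
  qed auto
  from this[of "card S"] obtain e \<Lambda> where
    e': "\<forall>j<card S. e j \<in> eigen (\<Lambda> j) \<and> \<Lambda> j \<le> l"
    and on': "\<forall>i<card S. \<forall>j<card S. m (e i) (e j) = (if i = j then 1 else 0)" by auto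
  define n where "n = card S"
  have e: "\<And>j. j < n \<Longrightarrow> e j \<in> eigen (\<Lambda> j)" "\<And>j. j < n \<Longrightarrow> \<Lambda> j \<le> l"
    and on: "\<And>i j. i < n \<Longrightarrow> j < n \<Longrightarrow> m (e i) (e j) = (if i = j then 1 else 0)"
    using e' on' by (auto simp: n_def)
  define F where "F = \<Lambda> ` {..<n}"
  have eH: "e j \<in> H" if "j < n" for j using e(1)[OF that] by (auto simp: eigen_def)
  have ne: "eigen k \<noteq> {0}" if "k \<in> F" for k
  proof -
    obtain j where j: "j < n" "k = \<Lambda> j" using \<open>k \<in> F\<close> by (auto simp: F_def)
    have "e j \<noteq> 0" using on[OF j(1) j(1)] m.zero_left[OF E.subspace_0[OF E.H]] by auto
    then show ?thesis using e(1)[OF j(1)] j by auto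
  qed
  \<comment> \<open>The \<Lambda> j may repeat; the e j sharing the eigenvalue k are independent in
    one eigenspace, so its dimension accounts for them.\<close>
  have "card {j. j < n \<and> \<Lambda> j = k} \<le> E.dim (eigen k)" for k
  proof -
    let ?J = "{j. j < n \<and> \<Lambda> j = k}"
    have inj: "inj_on e ?J" using on by (intro inj_onI) (smt (verit) mem_Collect_eq)
    have "E.independent (e ` ?J)"
    proof -
      have "c v = 0" if sum: "(\<Sum>v\<in>e ` ?J. c v *s v) = 0" and v: "v \<in> e ` ?J" for c v
      proof -
        obtain i where i: "i \<in> ?J" "v = e i" using v by auto
        have "(\<Sum>j\<in>?J. c (e j) *s e j) = 0" using sum by (simp add: sum.reindex[OF inj])
        then have "m (\<Sum>j\<in>?J. c (e j) *s e j) (e i) = 0" using m.zero_left eH i by auto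
        then have "(\<Sum>j\<in>?J. c (e j) * m (e j) (e i)) = 0" using eH i by (subst (asm) m.sum_left) auto
        also have "(\<Sum>j\<in>?J. c (e j) * m (e j) (e i)) = (\<Sum>j\<in>?J. if j = i then c (e i) else 0)"
          using i on by (intro sum.cong) auto
        finally show ?thesis using i by (simp add: sum.delta)
      qed
      then show ?thesis by (auto simp: E.dependent_finite)
    qed
    moreover obtain B where B: "finite B" "eigen k = E.span B" "card B = E.dim (eigen k)"
      using eigen_basis[of k] by metis
    moreover have "e ` ?J \<subseteq> E.span B" using e B(2) by auto
    ultimately have "card (e ` ?J) \<le> card B" using E.independent_span_bound by blast
    then show ?thesis using B(3) card_image[OF inj] by simp
  qed
  then have "(\<Sum>k\<in>F. card {j. j < n \<and> \<Lambda> j = k}) \<le> (\<Sum>k\<in>F. E.dim (eigen k))" by (intro sum_mono)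
  moreover have "(\<Sum>k\<in>F. card {j. j < n \<and> \<Lambda> j = k}) = n"
  proof -
    have "(\<Sum>k\<in>F. card {j. j < n \<and> \<Lambda> j = k}) = card (\<Union>k\<in>F. {j. j < n \<and> \<Lambda> j = k})"
      by (intro card_UN_disjoint[symmetric]) (auto simp: F_def)
    also have "(\<Union>k\<in>F. {j. j < n \<and> \<Lambda> j = k}) = {..<n}" by (auto simp: F_def)
    finally show ?thesis by simp
  qed
  ultimately show ?thesis using e(2) ne
    by (intro exI[of _ F]) (auto simp: F_def n_def)
qed

text \<open>The projection theorem for the null space of m, which is closed because m is bounded by
  a multiple of E. A sequence minimizing the distance is Cauchy by the parallelogram law, and the
  first variation at the limit is the orthogonality.\<close>

lemma null_projection:
  assumes f: "f \<in> H"
  shows "\<exists>n\<in>H. m n n = 0 \<and> (\<forall>k\<in>H. m k k = 0 \<longrightarrow> E (f - n) k = 0)"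
proof -
  define N where "N = {n \<in> H. m n n = 0}"
  have NH: "N \<subseteq> H" by (auto simp: N_def)
  have N: "E.subspace N" unfolding E.subspace_def using E.H
    by (auto simp: N_def m.zero_left m.quad_add m.null_orthogonal m.quad_scale E.subspace_def)
  define R where "R = {E (f - n) (f - n) | n. n \<in> N}"
  have "0 \<in> N" using N by (rule E.subspace_0)
  then have R0: "R \<noteq> {}" by (auto simp: R_def)
  have fn: "f - n \<in> H" if "n \<in> N" for n using that NH f E.H by (auto simp: E.subspace_diff)
  have bdd: "bdd_below R" using E.nonneg fn by (intro bdd_belowI[of _ 0]) (auto simp: R_def)
  define d where "d = Inf R"
  have d: "d \<le> E (f - n) (f - n)" if "n \<in> N" for n
    unfolding d_def using that by (intro cInf_lower bdd) (auto simp: R_def)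
  have "\<exists>n. n \<in> N \<and> E (f - n) (f - n) < d + 1 / real (Suc i)" for i
  proof -
    have "\<exists>r\<in>R. r < d + 1 / real (Suc i)" unfolding d_def using R0 by (intro cInf_lessD) auto
    then show ?thesis by (auto simp: R_def)
  qed
  then obtain X where X: "\<And>n. X n \<in> N" "\<And>n. E (f - X n) (f - X n) < d + 1 / real (Suc n)" by metis
  have XH: "X n \<in> H" for n using X NH by auto
  have cau: "\<exists>M. \<forall>n\<ge>M. \<forall>k\<ge>M. E (X n - X k) (X n - X k) < \<epsilon>" if \<epsilon>: "\<epsilon> > 0" for \<epsilon>
  proof -
    obtain M where M: "1 / real (Suc M) < \<epsilon> / 4" using \<epsilon> nat_approx_posE[of "\<epsilon>/4"] by auto
    have "E (X n - X k) (X n - X k) < \<epsilon>" if "n \<ge> M" "k \<ge> M" for n k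
    proof -
      have le: "1 / real (Suc n) \<le> 1 / real (Suc M)" "1 / real (Suc k) \<le> 1 / real (Suc M)"
        using that by (auto simp: frac_le)
      \<comment> \<open>The midpoint \<open>?w\<close> of X n and X k is again in \<open>N\<close>,
        so its distance to f gives E (u + v) (u + v) >= 4 * d. By the parallelogram law this leaves
        less than 4 / (M + 1) for the difference.\<close>
      let ?u = "f - X n" and ?v = "f - X k" and ?w = "(1/2) *s (X n + X k)"
      have uv: "?u \<in> H" "?v \<in> H" using fn X by auto
      have wN: "?w \<in> N" using X N by (intro E.subspace_scale E.subspace_add)
      have half: "(1/2) *s (x + x) = x" for x :: 'a
        using E.scale_left_distrib[of "1/2" "1/2" x] by (simp add: E.scale_right_distrib)
      have "f - ?w = (1/2) *s (?u + ?v)"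
      proof -
        have "(1/2) *s (?u + ?v) = (1/2) *s ((f + f) - (X n + X k))" by (simp add: algebra_simps)
        then show ?thesis by (simp only: E.scale_right_diff_distrib half)
      qed
      then have "E (f - ?w) (f - ?w) = 1/4 * E (?u + ?v) (?u + ?v)"
        using E.quad_scale[of "?u + ?v" "1/2"] uv E.H by (simp add: E.subspace_add power2_eq_square)
      then have "4 * d \<le> E (?u + ?v) (?u + ?v)" using d[OF wN] by simp
      then have "4 * d \<le> E ?u ?u + 2 * E ?u ?v + E ?v ?v" using uv by (simp add: E.quad_add)
      moreover have "X n - X k = ?v - ?u" by simp
      then have "E (X n - X k) (X n - X k) = E ?v ?v - 2 * E ?v ?u + E ?u ?u"
        using uv E.quad_diff[of ?v ?u] by simp
      ultimately show ?thesis using X(2)[of n] X(2)[of k] le M E.sym[OF uv] by linarith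
    qed
    then show ?thesis by blast
  qed
  obtain n where n: "n \<in> H" "(\<lambda>i. E (X i - n) (X i - n)) \<longlonglongrightarrow> 0" using complete[OF XH cau] by auto
  have mn: "m n n = 0"
    using m.tendsto_quad[OF XH n(1) m_tendsto_0[OF XH n]] X LIMSEQ_const_iff[of 0 "m n n"] by (simp add: N_def)
  have "E (f - n) k = 0" if k: "k \<in> H" "m k k = 0" for k
  proof -
    have "(\<lambda>i. E (f - X i) (f - X i)) \<longlonglongrightarrow> E (f - n) (f - n)"
      using n f XH fn X E.quad_diff_commute[OF XH n(1)] E.H
      by (intro E.tendsto_quad) (auto simp: E.subspace_diff)
    moreover have "(\<lambda>i. d + 1 / real (Suc i)) \<longlonglongrightarrow> d + 0"
      using LIMSEQ_inverse_real_of_nat by (intro tendsto_intros) (simp add: inverse_eq_divide)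
    ultimately have le: "E (f - n) (f - n) \<le> d" using X(2) less_imp_le by (intro LIMSEQ_le) auto
    have nN: "n \<in> N" and kN: "k \<in> N" using n mn k by (auto simp: N_def)
    \<comment> \<open>Moving n by t * k stays inside \<open>N\<close> and cannot lower the distance.
      The value of t used afterwards is the vertex of this parabola.\<close>
    have *: "0 \<le> - 2 * t * E (f - n) k + t\<^sup>2 * E k k" for t
    proof -
      have tk: "t *s k \<in> H" "n + t *s k \<in> N" using k E.H N nN kN by (auto simp: E.subspace_scale E.subspace_add)
      have "d \<le> E (f - (n + t *s k)) (f - (n + t *s k))" using d[OF tk(2)] .
      also have "f - (n + t *s k) = (f - n) - t *s k" by simp
      also have "E \<dots> \<dots> = E (f - n) (f - n) - 2 * (t * E (f - n) k) + t\<^sup>2 * E k k"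
        using E.quad_diff[OF fn[OF nN] tk(1)] E.quad_scale[OF k(1)] E.scale_right[OF fn[OF nN] k(1)] by simp
      finally show ?thesis using le by simp
    qed
    show ?thesis
    proof (cases "E k k = 0")
      case True
      then show ?thesis using E.null_orthogonal[OF fn[OF nN] k(1)] by simp
    next
      case False
      then have "E k k > 0" using E.nonneg[OF k(1)] by simp
      then show ?thesis using *[of "E (f - n) k / E k k"]
        by (auto simp: field_simps power2_eq_square mult_le_0_iff)
    qed
  qed
  then show ?thesis using n mn by blast
qed

text \<open>A vector of \<open>eigen\<close> lies in \<open>D\<close>, since E f n = l * m f n = 0
  for every null vector n. Conversely a test vector of \<open>H\<close> splits into a null vector
  and an element of \<open>D\<close>, and both sides of the equation vanish on the former. Thus
  \<open>eigen\<close>, which tests against all of \<open>H\<close>, is the eigenspace of the form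
  restricted to \<open>D\<close>.\<close>

lemma eigen_null_complement:
  assumes D: "D = {f \<in> H. \<forall>n\<in>H. m n n = 0 \<longrightarrow> E f n = 0}"
  shows "{f \<in> D. \<forall>h\<in>D. E f h = l * m f h} = eigen l"
proof (intro subset_antisym subsetI)
  fix f assume "f \<in> eigen l"
  then show "f \<in> {f \<in> D. \<forall>h\<in>D. E f h = l * m f h}"
    using m.null_orthogonal by (auto simp: D eigen_def)
next
  fix f assume f: "f \<in> {f \<in> D. \<forall>h\<in>D. E f h = l * m f h}"
  have "E f h = l * m f h" if h: "h \<in> H" for h
  proof -
    obtain n where n: "n \<in> H" "m n n = 0" "h - n \<in> D"
      using null_projection[OF h] h E.H by (auto simp: D E.subspace_diff)
    have "E f n = 0" "m f n = 0" using f n m.null_orthogonal by (auto simp: D)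
    moreover have "E f (h - n) = l * m f (h - n)" using f n by blast
    ultimately show ?thesis using f h n by (simp add: E.diff_right m.diff_right D)
  qed
  then show "f \<in> eigen l" using f by (auto simp: eigen_def D)
qed

end

section \<open>Square-integrable functions on an interval\<close>

text \<open>Actual functions rather than classes, extended by 0: integrals over parts of [a, b]
  become integrals over the line with an indicator.\<close>

definition L2 :: "real \<Rightarrow> real \<Rightarrow> (real \<Rightarrow> real) set" where
  "L2 a b = {k \<in> borel_measurable borel. (\<forall>x. x \<notin> {a..b} \<longrightarrow> k x = 0) \<and> integrable lborel (\<lambda>x. (k x)\<^sup>2)}"

lemma L2_measurable [measurable_dest]: "k \<in> L2 a b \<Longrightarrow> k \<in> borel_measurable borel"
  and L2_outside: "k \<in> L2 a b \<Longrightarrow> x \<notin> {a..b} \<Longrightarrow> k x = 0"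
  and L2_square_integrable: "k \<in> L2 a b \<Longrightarrow> integrable lborel (\<lambda>x. (k x)\<^sup>2)"
  by (auto simp: L2_def)

lemma integrable_indicator_Icc: "integrable lborel (indicat_real {a..b::real})"
  by (simp add: integrable_indicator_iff emeasure_lborel_Icc_eq)

lemma L2_integrable:
  assumes k: "k \<in> L2 a b"
  shows "integrable lborel k"
proof (rule Bochner_Integration.integrable_bound)
  show "integrable lborel (\<lambda>x. indicator {a..b} x + (k x)\<^sup>2)"
    using integrable_indicator_Icc L2_square_integrable[OF k] by (rule Bochner_Integration.integrable_add)
  show "k \<in> borel_measurable lborel" using k by measurable
  show "AE x in lborel. norm (k x) \<le> norm (indicator {a..b} x + (k x)\<^sup>2)"
  proof (intro AE_I2)
    fix x
    have "\<bar>k x\<bar> \<le> 1 + (k x)\<^sup>2" using zero_le_power2[of "\<bar>k x\<bar> - 1"]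
      by (simp add: power2_diff)
    then show "norm (k x) \<le> norm (indicator {a..b} x + (k x)\<^sup>2)"
      using L2_outside[OF k, of x] by (auto simp: indicator_def)
  qed
qed

lemma L2_mult_integrable:
  assumes "k \<in> L2 a b" "k' \<in> L2 a' b'"
  shows "integrable lborel (\<lambda>x. k x * k' x)"
proof (rule Bochner_Integration.integrable_bound)
  show "integrable lborel (\<lambda>x. (k x)\<^sup>2 + (k' x)\<^sup>2)"
    using assms by (intro Bochner_Integration.integrable_add L2_square_integrable)
  show "(\<lambda>x. k x * k' x) \<in> borel_measurable lborel" using assms by measurable
  have "\<bar>u * v\<bar> \<le> u\<^sup>2 + v\<^sup>2" for u v :: real
  proof -
    have "2 * \<bar>u\<bar> * \<bar>v\<bar> \<le> u\<^sup>2 + v\<^sup>2" using sum_squares_bound[of "\<bar>u\<bar>" "\<bar>v\<bar>"] by simp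
    moreover have "0 \<le> \<bar>u\<bar> * \<bar>v\<bar>" by simp
    ultimately show ?thesis unfolding abs_mult by linarith
  qed
  then show "AE x in lborel. norm (k x * k' x) \<le> norm ((k x)\<^sup>2 + (k' x)\<^sup>2)" by auto
qed

lemma L2_add:
  assumes "k \<in> L2 a b" "k' \<in> L2 a b"
  shows "(\<lambda>x. k x + k' x) \<in> L2 a b"
proof -
  have "integrable lborel (\<lambda>x. (k x)\<^sup>2 + (k' x)\<^sup>2 + 2 * (k x * k' x))"
    using assms L2_mult_integrable L2_square_integrable
    by (intro Bochner_Integration.integrable_add integrable_mult_right) blast+
  then have "integrable lborel (\<lambda>x. (k x + k' x)\<^sup>2)" by (simp add: power2_sum mult.assoc)
  then show ?thesis using assms by (auto simp: L2_def)
qed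

lemma L2_scale: "k \<in> L2 a b \<Longrightarrow> (\<lambda>x. c * k x) \<in> L2 a b"
  by (auto simp: L2_def power_mult_distrib)

lemma L2_diff: "k \<in> L2 a b \<Longrightarrow> k' \<in> L2 a b \<Longrightarrow> (\<lambda>x. k x - k' x) \<in> L2 a b"
  using L2_add[of k a b "\<lambda>x. -1 * k' x"] L2_scale[of k' a b "-1"] by simp

lemma L2_indicator: "k \<in> L2 a b \<Longrightarrow> A \<in> sets borel \<Longrightarrow> (\<lambda>x. indicator A x * k x) \<in> L2 a b"
proof -
  assume k: "k \<in> L2 a b" and A: "A \<in> sets borel"
  have "integrable lborel (\<lambda>x. indicator A x *\<^sub>R (k x)\<^sup>2)"
    using A by (intro integrable_mult_indicator L2_square_integrable[OF k]) simp
  moreover have "indicator A x *\<^sub>R (k x)\<^sup>2 = (indicator A x * k x)\<^sup>2" for x by (auto simp: indicator_def)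
  ultimately show ?thesis using k A by (auto simp: L2_def)
qed

lemma L2_const_indicator: "a \<le> x \<Longrightarrow> y \<le> b \<Longrightarrow> (\<lambda>t. c * indicator {x<..y} t) \<in> L2 a b"
proof -
  assume *: "a \<le> x" "y \<le> b"
  have "integrable lborel (\<lambda>t. c\<^sup>2 * indicator {x<..y} t)"
    by (intro integrable_mult_right) (cases "x \<le> y", auto simp: integrable_indicator_iff)
  then have "integrable lborel (\<lambda>t. (c * indicator {x<..y} t)\<^sup>2)"
    by (rule Bochner_Integration.integrable_cong[THEN iffD1, rotated 2]) (auto simp: indicator_def)
  then show ?thesis using * by (auto simp: L2_def indicator_def)
qed

lemma L2_Cauchy_Schwarz_Ioc:
  assumes k: "k \<in> L2 a b" and "x \<le> y"
  shows "(\<integral>t. indicator {x<..y} t * k t \<partial>lborel)\<^sup>2 \<le> (y - x) * (\<integral>t. indicator {x<..y} t * (k t)\<^sup>2 \<partial>lborel)"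
proof (cases "x = y")
  case True
  then show ?thesis by simp
next
  case False
  then have xy: "x < y" using assms by simp
  define I where "I = (\<integral>t. indicator {x<..y} t * k t \<partial>lborel)"
  \<comment> \<open>c is the mean of k over the interval; expanding the nonnegative integral of (k -
    c)^2 over it gives the inequality.\<close>
  define c where "c = I / (y - x)"
  let ?k = "\<lambda>t. indicator {x<..y} t * k t" and ?i = "\<lambda>t. indicat_real {x<..y} t"
  have int: "integrable lborel ?k" "integrable lborel (\<lambda>t. (?k t)\<^sup>2)" "integrable lborel ?i"
    using L2_indicator[OF k, of "{x<..y}"] L2_integrable L2_square_integrable xy
    by (auto simp: integrable_indicator_iff)
  have sq: "(\<integral>t. (?k t)\<^sup>2 \<partial>lborel) = (\<integral>t. ?i t * (k t)\<^sup>2 \<partial>lborel)"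
    by (intro Bochner_Integration.integral_cong) (auto simp: indicator_def)
  have "0 \<le> (\<integral>t. (?k t - c * ?i t)\<^sup>2 \<partial>lborel)" by simp
  also have "\<dots> = (\<integral>t. (?k t)\<^sup>2 - 2 * c * ?k t + c\<^sup>2 * ?i t \<partial>lborel)"
    by (intro Bochner_Integration.integral_cong) (auto simp: power2_eq_square algebra_simps indicator_def)
  also have "\<dots> = (\<integral>t. (?k t)\<^sup>2 \<partial>lborel) - 2 * c * I + c\<^sup>2 * (y - x)"
    using int xy by (simp add: I_def)
  also have "\<dots> = (\<integral>t. ?i t * (k t)\<^sup>2 \<partial>lborel) - I\<^sup>2 / (y - x)"
  proof -
    have cI: "c * (y - x) = I" using xy by (simp add: c_def)
    have "c\<^sup>2 * (y - x) = c * I" by (simp add: power2_eq_square mult.assoc cI)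
    moreover have "c * I = I\<^sup>2 / (y - x)" by (simp add: c_def power2_eq_square)
    ultimately show ?thesis unfolding sq by simp
  qed
  finally show ?thesis using xy unfolding I_def[symmetric] by (simp add: field_simps)
qed

text \<open>Rays form an intersection-stable generator, so vanishing integrals over rays extend to
  all Borel sets, and a function with zero integral over every Borel set is zero almost
  everywhere.\<close>

lemma L2_zero_of_primitive:
  assumes k: "k \<in> L2 a b" and "\<And>x. x \<in> {a..b} \<Longrightarrow> (\<integral>t. indicator {..x} t * k t \<partial>lborel) = 0"
  shows "AE x in lborel. k x = 0"
proof -
  have int: "integrable lborel k" using L2_integrable[OF k] .
  have sint: "set_integrable lborel A k" if "A \<in> sets borel" for A
    unfolding set_integrable_def using that by (intro integrable_mult_indicator int) simp
  \<comment> \<open>Rays ending outside [a, b] belong to the generator too, and the total integral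
    is what the complement step consumes.\<close>
  have "(\<integral>t. indicator {..x} t * k t \<partial>lborel) = 0 \<and> (x \<ge> b \<longrightarrow> integral\<^sup>L lborel k = 0)" for x
  proof (cases "a \<le> b")
    case False
    then have "k = (\<lambda>_. 0)" using L2_outside[OF k] by (auto simp: fun_eq_iff)
    then show ?thesis by simp
  next
    case True
    have kb: "k = (\<lambda>t. indicator {..b} t * k t)"
      using L2_outside[OF k] by (force simp: fun_eq_iff indicator_def)
    then have kb0: "integral\<^sup>L lborel k = 0" using assms(2)[of b] True by simp
    consider "x < a" | "x \<in> {a..b}" | "x > b" by fastforce
    then have "(\<integral>t. indicator {..x} t * k t \<partial>lborel) = 0"
    proof cases
      case 1
      then have "(\<lambda>t. indicator {..x} t * k t) = (\<lambda>_. 0)"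
        using L2_outside[OF k] by (auto simp: fun_eq_iff indicator_def)
      then show ?thesis by simp
    next
      case 3
      then have "(\<lambda>t. indicator {..x} t * k t) = k"
        using L2_outside[OF k] by (auto simp: fun_eq_iff indicator_def)
      then show ?thesis using kb0 by simp
    qed (use assms(2) in auto)
    then show ?thesis using kb0 by simp
  qed
  then have 0: "(\<integral>t. indicator {..x} t * k t \<partial>lborel) = 0" "integral\<^sup>L lborel k = 0" for x
    by (blast, metis order_refl)
  have "(LINT x:A|lborel. k x) = 0" if "A \<in> sets borel" for A
  proof -
    have "Int_stable (range (atMost :: real \<Rightarrow> real set))" by (auto simp: Int_stable_def)
    moreover have "range (atMost :: real \<Rightarrow> real set) \<subseteq> Pow UNIV" by simp
    moreover have "A \<in> sigma_sets UNIV (range atMost)" using that by (simp add: borel_eq_atMost)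
    ultimately show ?thesis
    proof (induction A rule: sigma_sets_induct_disjoint)
      case (basic A)
      then show ?case using 0 by (auto simp: set_lebesgue_integral_def)
    next
      case (compl A)
      have A: "A \<in> sets borel" using compl(1) by (simp add: borel_eq_atMost)
      have "(\<integral>t. indicator (UNIV - A) t *\<^sub>R k t \<partial>lborel) = (\<integral>t. k t - indicator A t *\<^sub>R k t \<partial>lborel)"
        by (intro Bochner_Integration.integral_cong) (auto simp: indicator_def)
      also have "\<dots> = integral\<^sup>L lborel k - (\<integral>t. indicator A t *\<^sub>R k t \<partial>lborel)"
        using int sint[OF A] by (intro Bochner_Integration.integral_diff) (auto simp: set_integrable_def)
      finally show ?case using compl(2) 0 by (simp add: set_lebesgue_integral_def)
    next
      case (union A)
      have A: "A i \<in> sets borel" for i using union(2) by (auto simp: borel_eq_atMost)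
      then have "(LINT x:(\<Union>i. A i)|lborel. k x) = (\<Sum>i. (LINT x:(A i)|lborel. k x))"
        using union(1) by (intro lebesgue_integral_countable_add sint) (auto simp: disjoint_family_on_def)
      then show ?case using union(3) by simp
    qed (auto simp: set_lebesgue_integral_def)
  qed
  then show ?thesis using int by (intro sigma_finite_measure.density_zero[OF sigma_finite_lborel]) auto
qed

text \<open>Riesz-Fischer: a fast subsequence converges almost everywhere, and Fatou's lemma passes
  the Cauchy estimate to the limit.\<close>

lemma L2_complete:
  assumes X: "\<And>n. X n \<in> L2 a b"
    and cau: "\<And>e. e > 0 \<Longrightarrow> \<exists>N::nat. \<forall>m\<ge>N. \<forall>n\<ge>N. (\<integral>x. (X m x - X n x)\<^sup>2 \<partial>lborel) < e"
  shows "\<exists>k\<in>L2 a b. (\<lambda>n. \<integral>x. (X n x - k x)\<^sup>2 \<partial>lborel) \<longlonglongrightarrow> 0"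
proof -
  have "\<forall>i. \<exists>N. \<forall>m\<ge>N. \<forall>n\<ge>N. (\<integral>x. (X m x - X n x)\<^sup>2 \<partial>lborel) < (1/4)^i"
    using cau by simp
  then obtain N where N: "\<And>i m n. m \<ge> N i \<Longrightarrow> n \<ge> N i \<Longrightarrow> (\<integral>x. (X m x - X n x)\<^sup>2 \<partial>lborel) < (1/4)^i"
    by metis
  \<comment> \<open>Summing makes both r i and r (Suc i) at least N i; the added i makes r i tend to
    infinity.\<close>
  define r where "r i = (\<Sum>j\<le>i. N j) + i" for i
  have rN: "N i \<le> r i" "i \<le> r i" for i
    using member_le_sum[of i "{..i}" N] by (auto simp: r_def)
  have rS: "N i \<le> r (Suc i)" for i using rN(1)[of i] by (simp add: r_def)
  define Y where "Y i = X (r i)" for i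
  have Y: "Y i \<in> L2 a b" for i using X by (simp add: Y_def)
  define d where "d i = (\<lambda>x. Y (Suc i) x - Y i x)" for i
  have d: "d i \<in> L2 a b" for i unfolding d_def using Y by (intro L2_diff)
  have [measurable]: "\<And>i. X i \<in> borel_measurable borel" "\<And>i. Y i \<in> borel_measurable borel"
     "\<And>i. d i \<in> borel_measurable borel"
    using X Y d L2_measurable by blast+
  define c where "c = max 0 (b - a)"
  have dbound: "(\<integral>x. \<bar>d i x\<bar> \<partial>lborel) \<le> (c + 1) * (1/2)^i" for i
  proof -
    \<comment> \<open>A weighted arithmetic-geometric inequality: |d| <= 2^-i + 2^i * d^2 on [a, b].
      A square integral of at most 4^-i thus yields a summable bound for the integral of
      |d|.\<close>
    have "(\<integral>x. \<bar>d i x\<bar> \<partial>lborel) \<le> (\<integral>x. (1/2)^i * indicator {a..b} x + 2^i * (d i x)\<^sup>2 \<partial>lborel)"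
    proof (rule integral_mono)
      show "integrable lborel (\<lambda>x. \<bar>d i x\<bar>)" using L2_integrable[OF d] by simp
      show "integrable lborel (\<lambda>x. (1/2)^i * indicator {a..b} x + 2^i * (d i x)\<^sup>2)"
        using integrable_indicator_Icc L2_square_integrable[OF d]
        by (intro Bochner_Integration.integrable_add integrable_mult_right)
      fix x
      have "2 * 1 * (2^i * \<bar>d i x\<bar>) \<le> 1\<^sup>2 + (2^i * \<bar>d i x\<bar>)\<^sup>2" by (rule sum_squares_bound)
      moreover have "0 \<le> (2^i * \<bar>d i x\<bar>)" by simp
      ultimately have "2^i * \<bar>d i x\<bar> \<le> 1 + (2^i * \<bar>d i x\<bar>)\<^sup>2" unfolding one_power2 by linarith
      then have "\<bar>d i x\<bar> \<le> (1/2)^i + 2^i * (d i x)\<^sup>2"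
        by (simp add: field_simps power_divide power_mult_distrib power2_eq_square)
      then show "\<bar>d i x\<bar> \<le> (1/2)^i * indicator {a..b} x + 2^i * (d i x)\<^sup>2"
        using L2_outside[OF d, of x] by (auto simp: indicator_def)
    qed
    also have "\<dots> = (1/2)^i * c + 2^i * (\<integral>x. (d i x)\<^sup>2 \<partial>lborel)"
      using integrable_indicator_Icc L2_square_integrable[OF d]
      by (subst Bochner_Integration.integral_add) (auto simp: c_def max_def)
    also have "(\<integral>x. (d i x)\<^sup>2 \<partial>lborel) \<le> (1/4)^i"
      using N[of i "r (Suc i)" "r i"] rN rS by (simp add: d_def Y_def less_imp_le)
    also have "2^i * (1/4)^i = (1/2 :: real)^i" by (simp add: power_mult_distrib[symmetric])
    finally show ?thesis by (simp add: algebra_simps)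
  qed
  have "(\<integral>\<^sup>+x. (\<Sum>i. ennreal \<bar>d i x\<bar>) \<partial>lborel) = (\<Sum>i. \<integral>\<^sup>+x. ennreal \<bar>d i x\<bar> \<partial>lborel)"
    by (intro nn_integral_suminf) measurable
  also have "\<dots> = (\<Sum>i. ennreal (\<integral>x. \<bar>d i x\<bar> \<partial>lborel))"
    using L2_integrable[OF d] by (intro suminf_cong nn_integral_eq_integral) auto
  also have "\<dots> \<le> (\<Sum>i. ennreal ((c + 1) * (1/2)^i))"
    using dbound by (intro suminf_le ennreal_leI) auto
  also have "\<dots> < \<infinity>"
  proof -
    have "summable (\<lambda>i. (c + 1) * (1/2::real)^i)" by (intro summable_mult summable_geometric) simp
    then have "(\<Sum>i. ennreal ((c + 1) * (1/2)^i)) \<noteq> top"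
      by (intro ennreal_suminf_neq_top) (auto simp: c_def)
    then show ?thesis by (simp add: less_top)
  qed
  finally have "AE x in lborel. (\<Sum>i. ennreal \<bar>d i x\<bar>) \<noteq> \<infinity>"
    by (intro nn_integral_noteq_infinite) auto
  then have conv: "AE x in lborel. (\<lambda>i. Y i x) \<longlonglongrightarrow> lim (\<lambda>i. Y i x)"
  proof eventually_elim
    case (elim x)
    then have "summable (\<lambda>i. \<bar>d i x\<bar>)" by (intro summable_suminf_not_top) auto
    then have "summable (\<lambda>i. d i x)" by (rule summable_rabs_cancel)
    then have "convergent (\<lambda>n. \<Sum>i<n. d i x)" by (simp add: summable_iff_convergent)
    moreover have "(\<Sum>i<n. d i x) = Y n x - Y 0 x" for n by (induction n) (auto simp: d_def)
    ultimately have "convergent (\<lambda>n. (Y n x - Y 0 x) + Y 0 x)"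
      by (intro convergent_add convergent_const) auto
    then show ?case by (simp add: convergent_LIMSEQ_iff)
  qed
  define k where "k x = indicator {a..b} x * lim (\<lambda>i. Y i x)" for x
  have [measurable]: "k \<in> borel_measurable borel"
    unfolding k_def by (intro borel_measurable_times borel_measurable_lim_metric) auto
  have Yk: "AE x in lborel. (\<lambda>i. Y i x) \<longlonglongrightarrow> k x"
    using conv
  proof eventually_elim
    case (elim x)
    then show ?case using L2_outside[OF Y, of x] by (auto simp: k_def indicator_def)
  qed
  have key: "(\<integral>\<^sup>+x. ennreal ((X n x - k x)\<^sup>2) \<partial>lborel) \<le> ennreal ((1/4)^i)" if n: "n \<ge> N i" for n i
  proof -
    have "(\<integral>\<^sup>+x. ennreal ((X n x - k x)\<^sup>2) \<partial>lborel) = (\<integral>\<^sup>+x. liminf (\<lambda>j. ennreal ((X n x - Y j x)\<^sup>2)) \<partial>lborel)"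
    proof (rule nn_integral_cong_AE)
      show "AE x in lborel. ennreal ((X n x - k x)\<^sup>2) = liminf (\<lambda>j. ennreal ((X n x - Y j x)\<^sup>2))"
        using Yk
      proof eventually_elim
        case (elim x)
        then have "(\<lambda>j. ennreal ((X n x - Y j x)\<^sup>2)) \<longlonglongrightarrow> ennreal ((X n x - k x)\<^sup>2)"
          by (intro tendsto_intros)
        from lim_imp_Liminf[OF sequentially_bot this] show ?case by (rule HOL.sym)
      qed
    qed
    also have "\<dots> \<le> liminf (\<lambda>j. \<integral>\<^sup>+x. ennreal ((X n x - Y j x)\<^sup>2) \<partial>lborel)"
      by (intro nn_integral_liminf) measurable
    also have "\<dots> \<le> ennreal ((1/4)^i)"
    proof (rule Liminf_le)
      show "\<forall>\<^sub>F j in sequentially. (\<integral>\<^sup>+x. ennreal ((X n x - Y j x)\<^sup>2) \<partial>lborel) \<le> ennreal ((1/4)^i)"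
        using eventually_ge_at_top[of "N i"]
      proof eventually_elim
        case (elim j)
        have "(\<integral>\<^sup>+x. ennreal ((X n x - Y j x)\<^sup>2) \<partial>lborel) = ennreal (\<integral>x. (X n x - Y j x)\<^sup>2 \<partial>lborel)"
          using L2_square_integrable[OF L2_diff[OF X Y]] by (intro nn_integral_eq_integral) auto
        also have "\<dots> \<le> ennreal ((1/4)^i)"
          using N[OF n, of "r j"] elim rN(2)[of j] by (intro ennreal_leI) (auto simp: Y_def)
        finally show ?case .
      qed
    qed simp
    finally show ?thesis .
  qed
  have int: "integrable lborel (\<lambda>x. (X n x - k x)\<^sup>2)" if "n \<ge> N i" for n i
    using key[OF that] by (intro integrableI_bounded) (auto simp: order_le_less_trans)
  have diff: "(\<lambda>x. X (N 0) x - k x) \<in> L2 a b"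
    using int[of 0 "N 0"] L2_outside[OF X] by (auto simp: L2_def k_def)
  then have k: "k \<in> L2 a b" using L2_diff[OF X[of "N 0"] diff] by simp
  have "(\<lambda>n. \<integral>x. (X n x - k x)\<^sup>2 \<partial>lborel) \<longlonglongrightarrow> 0"
  proof (rule LIMSEQ_I)
    fix e :: real assume e: "e > 0"
    obtain i where i: "(1/4::real)^i < e" using real_arch_pow_inv[OF e, of "1/4"] by auto
    have "norm ((\<integral>x. (X n x - k x)\<^sup>2 \<partial>lborel) - 0) < e" if "n \<ge> N i" for n
    proof -
      have "ennreal (\<integral>x. (X n x - k x)\<^sup>2 \<partial>lborel) \<le> ennreal ((1/4)^i)"
        using key[OF that] int[OF that] by (subst nn_integral_eq_integral[symmetric]) auto
      then show ?thesis using i by (simp add: ennreal_le_iff)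
    qed
    then show "\<exists>no. \<forall>n\<ge>no. norm ((\<integral>x. (X n x - k x)\<^sup>2 \<partial>lborel) - 0) < e" by blast
  qed
  then show ?thesis using k by blast
qed

section \<open>The energy form on the Sobolev space\<close>

text \<open>A normalized form of \<open>is_weak_gradient\<close>: as k vanishes outside [a, b], the
  integral over \<open>{..x}\<close> is the one over [a, x], and k is determined up to a null set of
  the whole line.\<close>

definition has_grad :: "real \<Rightarrow> real \<Rightarrow> (real \<Rightarrow> real) \<Rightarrow> (real \<Rightarrow> real) \<Rightarrow> bool" where
  "has_grad a b f k \<longleftrightarrow> k \<in> L2 a b \<and> (\<forall>x\<in>{a..b}. f x = (\<integral>t. indicator {..x} t * k t \<partial>lborel))"

lemma is_weak_gradient_iff:
  "is_weak_gradient a b f h \<longleftrightarrow> has_grad a b f (\<lambda>x. indicator {a..b} x * h x)"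
proof -
  have *: "indicator {a..b} x *\<^sub>R (h x)\<^sup>2 = (indicator {a..b} x * h x)\<^sup>2" for x by (auto simp: indicator_def)
  have **: "(LINT t:{a..x}|lborel. h t) = (\<integral>t. indicator {..x} t * (indicator {a..b} t * h t) \<partial>lborel)" if "x \<in> {a..b}" for x
    unfolding set_lebesgue_integral_def using that
    by (intro Bochner_Integration.integral_cong) (auto simp: indicator_def)
  show ?thesis
    unfolding is_weak_gradient_def has_grad_def L2_def set_borel_measurable_def set_integrable_def *
    by (auto simp: **)
qed

lemma has_grad_is_weak_gradient:
  assumes "has_grad a b f k"
  shows "is_weak_gradient a b f k"
proof -
  have "(\<lambda>x. indicator {a..b} x * k x) = k"
    using assms L2_outside[of k a b] by (auto simp: has_grad_def indicator_def fun_eq_iff)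
  then show ?thesis using assms by (simp add: is_weak_gradient_iff)
qed

lemma H10_iff:
  "f \<in> H10 a b \<longleftrightarrow> (\<exists>k. has_grad a b f k) \<and> f a = 0 \<and> f b = 0 \<and> (\<forall>x. x \<notin> {a..b} \<longrightarrow> f x = 0)"
  unfolding H10_def using is_weak_gradient_iff has_grad_is_weak_gradient by blast

lemma has_grad_L2: "has_grad a b f k \<Longrightarrow> k \<in> L2 a b"
  by (simp add: has_grad_def)

lemma has_grad_increment:
  assumes f: "has_grad a b f k" and "a \<le> x" "x \<le> y" "y \<le> b"
  shows "f y - f x = (\<integral>t. indicator {x<..y} t * k t \<partial>lborel)"
proof -
  have "integrable lborel (\<lambda>t. indicator {..z} t *\<^sub>R k t)" for z
    using L2_integrable[OF has_grad_L2[OF f]] by (intro integrable_mult_indicator) auto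
  then have int: "integrable lborel (\<lambda>t. indicator {..z} t * k t)" for z by simp
  have "f y - f x = (\<integral>t. indicator {..y} t * k t - indicator {..x} t * k t \<partial>lborel)"
    using assms int by (subst Bochner_Integration.integral_diff) (auto simp: has_grad_def)
  also have "\<dots> = (\<integral>t. indicator {x<..y} t * k t \<partial>lborel)"
    using assms by (intro Bochner_Integration.integral_cong) (auto simp: indicator_def)
  finally show ?thesis .
qed

lemma has_grad_at_left_end:
  assumes "has_grad a b f k" "a \<le> b"
  shows "f a = 0"
proof -
  have "f a = (\<integral>t. indicator {..a} t * k t \<partial>lborel)" using assms by (auto simp: has_grad_def)
  also have "\<dots> = (\<integral>t. 0 \<partial>(lborel :: real measure))"
  proof (rule integral_cong_AE)
    show "(\<lambda>t. indicator {..a} t * k t) \<in> borel_measurable lborel"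
      using L2_measurable[OF has_grad_L2[OF assms(1)]] by measurable
    show "AE t in lborel. indicator {..a} t * k t = 0"
      using AE_lborel_singleton[of a]
    proof eventually_elim
      case (elim t)
      then show ?case using L2_outside[OF has_grad_L2[OF assms(1)], of t] by (auto simp: indicator_def)
    qed
  qed simp
  finally show ?thesis by simp
qed

text \<open>Cauchy-Schwarz for the increment: Hoelder continuity of exponent 1/2, controlled by the
  energy. Continuity, the sup bound and the compactness estimate all come from here.\<close>

lemma has_grad_square_increment_le:
  assumes f: "has_grad a b f k" and "x \<in> {a..b}" "y \<in> {a..b}"
  shows "(f y - f x)\<^sup>2 \<le> \<bar>y - x\<bar> * (\<integral>t. (k t)\<^sup>2 \<partial>lborel)"
proof -
  have *: "(f y - f x)\<^sup>2 \<le> (y - x) * (\<integral>t. (k t)\<^sup>2 \<partial>lborel)" if "a \<le> x" "x \<le> y" "y \<le> b" for x y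
  proof -
    note k = has_grad_L2[OF f]
    have "integrable lborel (\<lambda>t. indicator {x<..y} t *\<^sub>R (k t)\<^sup>2)"
      by (intro integrable_mult_indicator L2_square_integrable[OF k]) simp
    then have "(\<integral>t. indicator {x<..y} t * (k t)\<^sup>2 \<partial>lborel) \<le> (\<integral>t. (k t)\<^sup>2 \<partial>lborel)"
      using L2_square_integrable[OF k] by (intro integral_mono) (auto simp: indicator_def)
    then have "(y - x) * (\<integral>t. indicator {x<..y} t * (k t)\<^sup>2 \<partial>lborel) \<le> (y - x) * (\<integral>t. (k t)\<^sup>2 \<partial>lborel)"
      using that by (intro mult_left_mono) auto
    then show ?thesis
      using L2_Cauchy_Schwarz_Ioc[OF k that(2)] has_grad_increment[OF f that] by simp
  qed
  show ?thesis
    using *[of x y] *[of y x] assms by (cases "x \<le> y") (auto simp: power2_commute)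
qed

lemma has_grad_continuous_on:
  assumes f: "has_grad a b f k"
  shows "continuous_on {a..b} f"
proof -
  define S where "S = (\<integral>t. (k t)\<^sup>2 \<partial>lborel)"
  have "(f \<longlongrightarrow> f x) (at x within {a..b})" if x: "x \<in> {a..b}" for x
  proof -
    have "((\<lambda>y. \<bar>y - x\<bar> * S) \<longlongrightarrow> \<bar>x - x\<bar> * S) (at x within {a..b})"
      by (intro tendsto_intros)
    then have "((\<lambda>y. \<bar>y - x\<bar> * S) \<longlongrightarrow> 0) (at x within {a..b})" by simp
    then have "((\<lambda>y. (f y - f x)\<^sup>2) \<longlongrightarrow> 0) (at x within {a..b})"
    proof (rule tendsto_0_le[where K=1])
      show "\<forall>\<^sub>F y in at x within {a..b}. norm ((f y - f x)\<^sup>2) \<le> norm (\<bar>y - x\<bar> * S) * 1"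
        unfolding eventually_at_topological
        using has_grad_square_increment_le[OF f x] by (intro exI[of _ UNIV]) (force simp: S_def)
    qed
    then have "((\<lambda>y. f y - f x) \<longlongrightarrow> 0) (at x within {a..b})"
      using tendsto_real_sqrt tendsto_rabs_zero_iff by fastforce
    then show ?thesis by (simp add: LIM_zero_iff)
  qed
  then show ?thesis by (simp add: continuous_on_def)
qed

section \<open>Linearity of the gradient; the energy as a definite, complete form\<close>

lemma has_grad_add:
  assumes "has_grad a b f k" "has_grad a b h k'"
  shows "has_grad a b (f + h) (\<lambda>x. k x + k' x)"
proof -
  have int: "integrable lborel (\<lambda>t. indicator {..x} t * k t)" if "k \<in> L2 a b" for x k
    using integrable_mult_indicator[OF _ L2_integrable[OF that], of "{..x}"] by simp
  show ?thesis using assms int[of k] int[of k'] L2_add[of k a b k']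
    by (auto simp: has_grad_def distrib_left)
qed

lemma has_grad_scale:
  assumes "has_grad a b f k"
  shows "has_grad a b (fun_scale c f) (\<lambda>x. c * k x)"
  using assms L2_scale[of k a b c] by (auto simp: has_grad_def fun_scale_def mult.left_commute)

lemma has_grad_diff:
  assumes "has_grad a b f k" "has_grad a b h k'"
  shows "has_grad a b (f - h) (\<lambda>x. k x - k' x)"
proof -
  have eq: "f - h = f + fun_scale (-1) h" by (auto simp: fun_scale_def fun_eq_iff)
  show ?thesis unfolding eq using has_grad_add[OF assms(1) has_grad_scale[OF assms(2), of "-1"]] by simp
qed

lemma has_grad_unique:
  assumes "has_grad a b f k" "has_grad a b f k'"
  shows "AE x in lborel. k x = k' x"
proof -
  have "has_grad a b (f - f) (\<lambda>x. k x - k' x)" using has_grad_diff[OF assms] .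
  then have "AE x in lborel. k x - k' x = 0"
    by (intro L2_zero_of_primitive[of _ a b]) (auto simp: has_grad_def)
  then show ?thesis by simp
qed

text \<open>The gradients selected by \<open>SOME\<close> agree almost everywhere with any given
  ones, and the end points left out by the open interval are a null set.\<close>

lemma energy_eq:
  assumes f: "has_grad a b f k" and h: "has_grad a b h k'"
  shows "energy a b f h = (\<integral>x. k x * k' x \<partial>lborel)"
proof -
  let ?f = "weak_gradient a b f" and ?h = "weak_gradient a b h"
  have "has_grad a b f (\<lambda>x. indicator {a..b} x * ?f x)" "has_grad a b h (\<lambda>x. indicator {a..b} x * ?h x)"
    using has_grad_is_weak_gradient[OF f] has_grad_is_weak_gradient[OF h] someI[of "is_weak_gradient a b _"]
    unfolding is_weak_gradient_iff[symmetric] weak_gradient_def by blast+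
  note fh = this
  have [measurable]: "(\<lambda>x. indicator {a..b} x * ?f x) \<in> borel_measurable borel"
     "(\<lambda>x. indicator {a..b} x * ?h x) \<in> borel_measurable borel"
     "k \<in> borel_measurable borel" "k' \<in> borel_measurable borel"
    using fh f h has_grad_L2 L2_measurable by blast+
  have eq: "indicator {a<..<b} x *\<^sub>R (?f x * ?h x) =
      indicator {a<..<b} x * ((indicator {a..b} x * ?f x) * (indicator {a..b} x * ?h x))" for x
    by (auto simp: indicator_def)
  show ?thesis
    unfolding energy_def set_lebesgue_integral_def eq
  proof (rule integral_cong_AE)
    show "AE x in lborel. indicator {a<..<b} x * ((indicator {a..b} x * ?f x) * (indicator {a..b} x * ?h x)) = k x * k' x"
      using has_grad_unique[OF fh(1) f] has_grad_unique[OF fh(2) h] AE_lborel_singleton[of a] AE_lborel_singleton[of b]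
    proof eventually_elim
      case (elim x)
      then show ?case using L2_outside[OF has_grad_L2[OF f], of x] by (auto simp: indicator_def less_le)
    qed
  qed measurable
qed

lemma subspace_H10:
  assumes "a \<le> b"
  shows "module.subspace fun_scale (H10 a b)"
proof -
  interpret vector_space fun_scale by (rule vector_space_fun_scale)
  have "has_grad a b 0 (\<lambda>_. 0)" by (auto simp: has_grad_def L2_def)
  then have "0 \<in> H10 a b" by (auto simp: H10_iff)
  moreover have "f + h \<in> H10 a b" if "f \<in> H10 a b" "h \<in> H10 a b" for f h
    using that by (auto simp: H10_iff intro: has_grad_add)
  moreover have "fun_scale c f \<in> H10 a b" if "f \<in> H10 a b" for c f
    using that has_grad_scale[of a b f _ c] by (auto simp: H10_iff) (auto simp: fun_scale_def)
  ultimately show ?thesis by (simp add: subspace_def)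
qed

lemma psd_form_energy:
  assumes ab: "a \<le> b"
  shows "psd_form fun_scale (H10 a b) (energy a b)"
proof -
  interpret vector_space fun_scale by (rule vector_space_fun_scale)
  show ?thesis
  proof
    show "subspace (H10 a b)" using subspace_H10[OF ab] .
  next
    fix x y z assume "x \<in> H10 a b" "y \<in> H10 a b" "z \<in> H10 a b"
    then obtain k l j where *: "has_grad a b x k" "has_grad a b y l" "has_grad a b z j"
      by (auto simp: H10_iff)
    have "energy a b (x + y) z = (\<integral>t. (k t + l t) * j t \<partial>lborel)"
      using * by (intro energy_eq has_grad_add)
    also have "\<dots> = (\<integral>t. k t * j t + l t * j t \<partial>lborel)" by (simp add: distrib_right)
    also have "\<dots> = energy a b x z + energy a b y z"
      using energy_eq[OF *(1,3)] energy_eq[OF *(2,3)]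
        L2_mult_integrable[OF has_grad_L2[OF *(1)] has_grad_L2[OF *(3)]]
        L2_mult_integrable[OF has_grad_L2[OF *(2)] has_grad_L2[OF *(3)]]
      by (subst Bochner_Integration.integral_add) auto
    finally show "energy a b (x + y) z = energy a b x z + energy a b y z" .
  next
    fix c x y assume "x \<in> H10 a b" "y \<in> H10 a b"
    then obtain k l where *: "has_grad a b x k" "has_grad a b y l"
      by (auto simp: H10_iff)
    show "energy a b (fun_scale c x) y = c * energy a b x y"
      using energy_eq[OF has_grad_scale[OF *(1)] *(2)] energy_eq[OF *] by (simp add: mult.assoc)
    show "energy a b x y = energy a b y x" by (simp add: energy_def mult.commute)
    show "0 \<le> energy a b x x" using energy_eq[OF *(1,1)] by simp
  qed
qed

lemma square_increment_le_energy:
  assumes "f \<in> H10 a b" "x \<in> {a..b}" "y \<in> {a..b}"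
  shows "(f y - f x)\<^sup>2 \<le> \<bar>y - x\<bar> * energy a b f f"
proof -
  obtain k where "has_grad a b f k" using assms by (auto simp: H10_iff)
  then show ?thesis
    using has_grad_square_increment_le[of a b f k x y] energy_eq[of a b f k f k] assms by (simp add: power2_eq_square)
qed

lemma square_le_energy:
  assumes "f \<in> H10 a b" "a \<le> b"
  shows "(f x)\<^sup>2 \<le> (b - a) * energy a b f f"
proof -
  have 0: "0 \<le> energy a b f f" using psd_form.nonneg[OF psd_form_energy] assms by blast
  show ?thesis
  proof (cases "x \<in> {a..b}")
    case True
    have "(f x)\<^sup>2 \<le> (x - a) * energy a b f f"
      using square_increment_le_energy[OF assms(1), of a x] True assms by (simp add: H10_iff)
    also have "\<dots> \<le> (b - a) * energy a b f f" using True 0 by (intro mult_right_mono) auto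
    finally show ?thesis .
  next
    case False
    then have "f x = 0" using assms by (auto simp: H10_iff)
    then show ?thesis using 0 assms by simp
  qed
qed

lemma H10_continuous_on: "f \<in> H10 a b \<Longrightarrow> continuous_on {a..b} f"
  using has_grad_continuous_on by (auto simp: H10_iff)

text \<open>The limit is the primitive of the limit of the gradients. It vanishes at b because the
  increment over [a, b] is controlled by the norm of the gradient.\<close>

lemma energy_complete:
  assumes ab: "a \<le> b" and X: "\<And>n. X n \<in> H10 a b"
    and cau: "\<And>e. e > 0 \<Longrightarrow> \<exists>N::nat. \<forall>n\<ge>N. \<forall>k\<ge>N. energy a b (X n - X k) (X n - X k) < e"
  shows "\<exists>x\<in>H10 a b. (\<lambda>n. energy a b (X n - x) (X n - x)) \<longlonglongrightarrow> 0"
proof -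
  have "\<forall>n. \<exists>k. has_grad a b (X n) k" using X by (auto simp: H10_iff)
  then obtain K where K: "\<And>n. has_grad a b (X n) (K n)" by metis
  have "energy a b (X n - X k) (X n - X k) = (\<integral>t. (K n t - K k t)\<^sup>2 \<partial>lborel)" for n k
    using energy_eq[OF has_grad_diff[OF K K] has_grad_diff[OF K K], of n k n k] by (simp add: power2_eq_square)
  with cau obtain k where k: "k \<in> L2 a b" "(\<lambda>n. \<integral>x. (K n x - k x)\<^sup>2 \<partial>lborel) \<longlonglongrightarrow> 0"
    using L2_complete[of K a b] has_grad_L2[OF K] by auto
  define f where "f x = (if x \<in> {a..b} then \<integral>t. indicator {..x} t * k t \<partial>lborel else 0)" for x
  have f: "has_grad a b f k" using k by (auto simp: has_grad_def f_def)
  have Xf: "has_grad a b (X n - f) (\<lambda>x. K n x - k x)" for n using has_grad_diff[OF K f] .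
  have fa: "f a = 0" using has_grad_at_left_end[OF f ab] .
  have "f b = 0"
  proof -
    have "(f b)\<^sup>2 \<le> (b - a) * (\<integral>t. (K n t - k t)\<^sup>2 \<partial>lborel)" for n
      using has_grad_square_increment_le[OF Xf, of a b n] X[of n] ab fa by (auto simp: H10_iff)
    moreover have "(\<lambda>n. (b - a) * (\<integral>t. (K n t - k t)\<^sup>2 \<partial>lborel)) \<longlonglongrightarrow> (b - a) * 0"
      by (intro tendsto_intros k)
    ultimately have "(f b)\<^sup>2 \<le> (b - a) * 0"
      by (intro LIMSEQ_le_const) auto
    then show ?thesis by simp
  qed
  then have "f \<in> H10 a b" using f fa by (auto simp: H10_iff f_def)
  moreover have "energy a b (X n - f) (X n - f) = (\<integral>t. (K n t - k t)\<^sup>2 \<partial>lborel)" for n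
    using energy_eq[OF Xf Xf] by (simp add: power2_eq_square)
  ultimately show ?thesis using k by (intro bexI[of _ f]) simp_all
qed

section \<open>The mass form and its compactness relative to the energy\<close>

definition mass :: "real measure \<Rightarrow> (real \<Rightarrow> real) \<Rightarrow> (real \<Rightarrow> real) \<Rightarrow> real" where
  "mass \<mu> f h = (\<integral>x. f x * h x \<partial>\<mu>)"

lemma space_finite_borel_measure_on: "finite_borel_measure_on a b \<mu> \<Longrightarrow> space \<mu> = {a<..<b}"
  using sets_eq_imp_space_eq[of \<mu> "restrict_space borel {a<..<b}"]
  by (auto simp: finite_borel_measure_on_def space_restrict_space)

lemma measurable_finite_borel_measure_on:
  assumes \<mu>: "finite_borel_measure_on a b \<mu>" and f: "continuous_on {a..b} f"
  shows "f \<in> borel_measurable \<mu>"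
proof -
  have "sets \<mu> = sets (restrict_space borel {a<..<b})" using \<mu> by (simp add: finite_borel_measure_on_def)
  moreover have "f \<in> borel_measurable (restrict_space borel {a<..<b})"
    by (intro borel_measurable_continuous_on_restrict continuous_on_subset[OF f]) auto
  ultimately show ?thesis by (simp cong: measurable_cong_sets)
qed

lemma integrable_finite_borel_measure_on:
  assumes \<mu>: "finite_borel_measure_on a b \<mu>" and f: "continuous_on {a..b} (f :: real \<Rightarrow> real)"
  shows "integrable \<mu> f"
proof -
  interpret finite_measure \<mu> using \<mu> by (simp add: finite_borel_measure_on_def)
  have "bounded (f ` {a..b})" by (intro compact_imp_bounded compact_continuous_image f compact_Icc)
  then obtain B where "\<forall>x\<in>{a..b}. norm (f x) \<le> B" by (auto simp: bounded_iff)
  then show ?thesis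
    using measurable_finite_borel_measure_on[OF \<mu> f] space_finite_borel_measure_on[OF \<mu>]
    by (intro integrable_const_bound[where B=B] AE_I2) auto
qed

lemma mass_integrable:
  assumes "finite_borel_measure_on a b \<mu>" "f \<in> H10 a b" "h \<in> H10 a b"
  shows "integrable \<mu> (\<lambda>x. f x * h x)"
  using assms by (intro integrable_finite_borel_measure_on continuous_on_mult H10_continuous_on)

lemma psd_form_mass:
  assumes ab: "a \<le> b" and \<mu>: "finite_borel_measure_on a b \<mu>"
  shows "psd_form fun_scale (H10 a b) (mass \<mu>)"
proof -
  interpret vector_space fun_scale by (rule vector_space_fun_scale)
  show ?thesis
  proof
    show "subspace (H10 a b)" using subspace_H10[OF ab] .
    fix x y z assume "x \<in> H10 a b" "y \<in> H10 a b" "z \<in> H10 a b"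
    then show "mass \<mu> (x + y) z = mass \<mu> x z + mass \<mu> y z"
      using mass_integrable[OF \<mu>] by (simp add: mass_def distrib_right)
  next
    fix c x y assume "x \<in> H10 a b" "y \<in> H10 a b"
    show "mass \<mu> (fun_scale c x) y = c * mass \<mu> x y" by (simp add: mass_def fun_scale_def mult.assoc)
    show "mass \<mu> x y = mass \<mu> y x" by (simp add: mass_def mult.commute)
    show "0 \<le> mass \<mu> x x" by (simp add: mass_def)
  qed
qed

text \<open>Each point lies within one mesh width of a grid point to its left, where f differs by at
  most the square root of mesh times energy. So finitely many point values control the mass up to a
  small multiple of the energy, as \<open>form_pair\<close> demands.\<close>

lemma mass_le_grid:
  assumes ab: "a < b" and \<mu>: "finite_borel_measure_on a b \<mu>" and p: "p > 0" and f: "f \<in> H10 a b"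
  shows "mass \<mu> f f \<le> 2 * measure \<mu> (space \<mu>) * (\<Sum>j<p. (f (a + real j * (b - a) / real p))\<^sup>2)
           + 2 * measure \<mu> (space \<mu>) * ((b - a) / real p) * energy a b f f"
proof -
  interpret finite_measure \<mu> using \<mu> by (simp add: finite_borel_measure_on_def)
  define \<delta> where "\<delta> = (b - a) / real p"
  have \<delta>: "\<delta> > 0" "real p * \<delta> = b - a" using ab p by (auto simp: \<delta>_def)
  define B where "B = 2 * (\<Sum>j<p. (f (a + real j * \<delta>))\<^sup>2) + 2 * \<delta> * energy a b f f"
  have E0: "0 \<le> energy a b f f" using psd_form.nonneg[OF psd_form_energy] ab f by force
  have le: "f x * f x \<le> B" if x: "x \<in> space \<mu>" for x
  proof -
    have x: "a < x" "x < b" using x space_finite_borel_measure_on[OF \<mu>] by auto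
    \<comment> \<open>The index of the grid cell containing x; x < b keeps it below p.\<close>
    define j where "j = nat \<lfloor>(x - a) / \<delta>\<rfloor>"
    have j: "real j \<le> (x - a) / \<delta>" "(x - a) / \<delta> < real j + 1" using x \<delta> by (auto simp: j_def)
    then have j': "real j * \<delta> \<le> x - a" "x - a < (real j + 1) * \<delta>" using \<delta> by (auto simp: field_simps)
    have "real j * \<delta> < real p * \<delta>" using j'(1) \<delta> x by linarith
    then have jp: "j < p" using \<delta>(1) by simp
    let ?y = "a + real j * \<delta>"
    have y: "?y \<in> {a..b}" "\<bar>x - ?y\<bar> \<le> \<delta>" using j' x \<delta> by (auto simp: algebra_simps)
    have "(f x - f ?y)\<^sup>2 \<le> \<bar>x - ?y\<bar> * energy a b f f"
      using square_increment_le_energy[OF f y(1)] x by auto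
    also have "\<dots> \<le> \<delta> * energy a b f f" using y E0 by (intro mult_right_mono)
    finally have 1: "(f x - f ?y)\<^sup>2 \<le> \<delta> * energy a b f f" .
    have 2: "(f ?y)\<^sup>2 \<le> (\<Sum>j<p. (f (a + real j * \<delta>))\<^sup>2)"
      using member_le_sum[of j "{..<p}" "\<lambda>j. (f (a + real j * \<delta>))\<^sup>2"] jp by auto
    have "(f x)\<^sup>2 \<le> 2 * (f x - f ?y)\<^sup>2 + 2 * (f ?y)\<^sup>2"
      using zero_le_power2[of "f x - 2 * f ?y"] by (simp add: power2_eq_square algebra_simps)
    then show ?thesis using 1 2 by (simp add: B_def power2_eq_square)
  qed
  have "mass \<mu> f f \<le> (\<integral>x. B \<partial>\<mu>)"
    unfolding mass_def using le mass_integrable[OF \<mu> f f] by (intro integral_mono) auto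
  also have "\<dots> = measure \<mu> (space \<mu>) * B" by simp
  finally show ?thesis by (simp add: B_def \<delta>_def algebra_simps)
qed

lemma form_pair_energy_mass:
  assumes ab: "a < b" and \<mu>: "finite_borel_measure_on a b \<mu>"
  shows "form_pair fun_scale (H10 a b) (energy a b) (mass \<mu>)"
proof -
  have ab': "a \<le> b" using ab by simp
  interpret E: psd_form fun_scale "H10 a b" "energy a b" by (rule psd_form_energy[OF ab'])
  interpret m: psd_form fun_scale "H10 a b" "mass \<mu>" by (rule psd_form_mass[OF ab' \<mu>])
  define M where "M = measure \<mu> (space \<mu>)"
  have M: "M \<ge> 0" by (simp add: M_def)
  show ?thesis
  proof
    fix f assume f: "f \<in> H10 a b" "energy a b f f = 0"
    then have "f x = 0" for x using square_le_energy[OF f(1) ab', of x] by simp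
    then show "f = 0" by (auto simp: fun_eq_iff)
  next
    fix X assume "\<And>n. X n \<in> H10 a b"
      "\<And>e. e > 0 \<Longrightarrow> \<exists>N::nat. \<forall>n\<ge>N. \<forall>k\<ge>N. energy a b (X n - X k) (X n - X k) < e"
    then show "\<exists>x\<in>H10 a b. (\<lambda>n. energy a b (X n - x) (X n - x)) \<longlonglongrightarrow> 0"
      by (rule energy_complete[OF ab'])
  next
    fix e :: real assume e: "e > 0"
    \<comment> \<open>Makes the coefficient 2 * M * (b - a) / p of the energy at most e. The factor
      sqrt (2 * M) in \<open>?\<phi>\<close> takes up the coefficient of the point values.\<close>
    obtain p :: nat where p: "2 * M * (b - a) / e < real p" using reals_Archimedean2 by blast
    have p0: "0 < real p"
      using p M e ab by (intro le_less_trans[OF _ p]) auto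
    then have pe: "2 * M * ((b - a) / real p) \<le> e" using p e by (simp add: field_simps)
    let ?\<phi> = "\<lambda>j f. sqrt (2 * M) * f (a + real j * (b - a) / real p)"
    show "\<exists>p (\<phi> :: nat \<Rightarrow> (real \<Rightarrow> real) \<Rightarrow> real) B.
      (\<forall>j<p. \<forall>x\<in>H10 a b. \<forall>y\<in>H10 a b. \<phi> j (x + y) = \<phi> j x + \<phi> j y) \<and>
      (\<forall>j<p. \<forall>x\<in>H10 a b. \<forall>c. \<phi> j (fun_scale c x) = c * \<phi> j x) \<and>
      (\<forall>j<p. \<forall>x\<in>H10 a b. (\<phi> j x)\<^sup>2 \<le> B * energy a b x x) \<and>
      (\<forall>x\<in>H10 a b. mass \<mu> x x \<le> e * energy a b x x + (\<Sum>j<p. (\<phi> j x)\<^sup>2))"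
    proof (intro exI[of _ p] exI[of _ ?\<phi>] exI[of _ "2 * M * (b - a)"] conjI ballI allI impI)
      fix j f assume f: "f \<in> H10 a b"
      show "(?\<phi> j f)\<^sup>2 \<le> 2 * M * (b - a) * energy a b f f"
        using mult_left_mono[OF square_le_energy[OF f ab', of "a + real j * (b - a) / real p"], of "2 * M"] M
        by (simp add: power_mult_distrib mult.assoc)
    next
      fix f assume f: "f \<in> H10 a b"
      have "(2 * M * ((b - a) / real p)) * energy a b f f \<le> e * energy a b f f"
        using pe E.nonneg[OF f] by (rule mult_right_mono)
      moreover have "(\<Sum>j<p. (?\<phi> j f)\<^sup>2) = 2 * M * (\<Sum>j<p. (f (a + real j * (b - a) / real p))\<^sup>2)"
        using M by (simp add: power_mult_distrib sum_distrib_left)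
      ultimately show "mass \<mu> f f \<le> e * energy a b f f + (\<Sum>j<p. (?\<phi> j f)\<^sup>2)"
        using mass_le_grid[OF ab \<mu> _ f, of p] p0 by (simp add: M_def)
    qed (auto simp: fun_scale_def algebra_simps)
  qed
qed

section \<open>The support of the measure and the domain of the form\<close>

lemma sets_Int_finite_borel_measure_on:
  "finite_borel_measure_on a b \<mu> \<Longrightarrow> U \<in> sets borel \<Longrightarrow> U \<inter> {a<..<b} \<in> sets \<mu>"
  by (auto simp: finite_borel_measure_on_def sets_restrict_space)

text \<open>The points outside the support are covered by open null sets, and countably many of
  these suffice by Lindelof.\<close>

lemma AE_in_meas_support:
  assumes \<mu>: "finite_borel_measure_on a b \<mu>"
  shows "AE x in \<mu>. x \<in> meas_support a b \<mu>"
proof -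
  define \<U> where "\<U> = {U. open U \<and> emeasure \<mu> (U \<inter> {a<..<b}) = 0}"
  obtain \<V> where \<V>: "\<V> \<subseteq> \<U>" "countable \<V>" "\<Union>\<V> = \<Union>\<U>"
    using Lindelof[of \<U>] by (auto simp: \<U>_def)
  have "(\<Union>U\<in>\<V>. U \<inter> {a<..<b}) \<in> null_sets \<mu>"
    using \<V>(1,2) sets_Int_finite_borel_measure_on[OF \<mu>]
    by (intro null_sets_UN') (auto simp: null_sets_def \<U>_def)
  then show ?thesis
  proof (rule AE_I')
    show "{x \<in> space \<mu>. \<not> x \<in> meas_support a b \<mu>} \<subseteq> (\<Union>U\<in>\<V>. U \<inter> {a<..<b})"
    proof
      fix x assume "x \<in> {x \<in> space \<mu>. \<not> x \<in> meas_support a b \<mu>}"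
      then have x: "x \<in> {a<..<b}" "x \<notin> meas_support a b \<mu>"
        using space_finite_borel_measure_on[OF \<mu>] by auto
      then have "x \<in> \<Union>\<U>" by (auto simp: meas_support_def \<U>_def)
      then show "x \<in> (\<Union>U\<in>\<V>. U \<inter> {a<..<b})" using x \<V>(3) by auto
    qed
  qed
qed

text \<open>Identifies the null space of the mass form. An end point can belong to the support
  without lying in the space of the measure; there the boundary condition gives f = 0.\<close>

lemma mass_zero_iff:
  assumes \<mu>: "finite_borel_measure_on a b \<mu>" and f: "f \<in> H10 a b"
  shows "mass \<mu> f f = 0 \<longleftrightarrow> (\<forall>x\<in>meas_support a b \<mu>. f x = 0)"
proof
  assume 0: "mass \<mu> f f = 0"
  then have "AE x in \<mu>. f x * f x = 0"
    unfolding mass_def using mass_integrable[OF \<mu> f f]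
    by (subst (asm) integral_nonneg_eq_0_iff_AE) auto
  then have AE: "AE x in \<mu>. f x = 0" by simp
  show "\<forall>x\<in>meas_support a b \<mu>. f x = 0"
  proof (rule ccontr)
    assume "\<not> (\<forall>x\<in>meas_support a b \<mu>. f x = 0)"
    then obtain x where x: "x \<in> meas_support a b \<mu>" "f x \<noteq> 0" by auto
    define U where "U = {x \<in> {a<..<b}. f x \<noteq> 0}"
    have "open U"
    proof -
      have "continuous_on {a<..<b} f"
        using H10_continuous_on[OF f] by (rule continuous_on_subset) auto
      then have "open (f -` (- {0}) \<inter> {a<..<b})"
        using continuous_open_preimage[of "{a<..<b}" f "- {0}"] by (simp add: Int_commute open_Compl)
      moreover have "U = f -` (- {0}) \<inter> {a<..<b}" by (auto simp: U_def)
      ultimately show ?thesis by simp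
    qed
    moreover have "x \<in> U"
    proof -
      have "x \<in> {a..b}" using x(1) by (auto simp: meas_support_def)
      moreover have "x \<noteq> a" "x \<noteq> b" using x(2) f by (auto simp: H10_iff)
      ultimately show ?thesis using x(2) by (auto simp: U_def)
    qed
    ultimately have "0 < emeasure \<mu> (U \<inter> {a<..<b})" using x(1) by (auto simp: meas_support_def)
    moreover have "emeasure \<mu> (U \<inter> {a<..<b}) = 0"
    proof -
      have eq: "{x \<in> space \<mu>. \<not> f x = 0} = U \<inter> {a<..<b}"
        unfolding space_finite_borel_measure_on[OF \<mu>] U_def by blast
      have meas: "U \<inter> {a<..<b} \<in> sets \<mu>" using sets_Int_finite_borel_measure_on[OF \<mu>] \<open>open U\<close> by auto
      show ?thesis using AE AE_iff_measurable[OF meas eq] by (rule iffD1[rotated])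
    qed
    ultimately show False by simp
  qed
next
  assume "\<forall>x\<in>meas_support a b \<mu>. f x = 0"
  then have "AE x in \<mu>. f x * f x = 0" using AE_in_meas_support[OF \<mu>] by auto
  then show "mass \<mu> f f = 0" unfolding mass_def by (rule integral_eq_zero_AE)
qed

lemma affine_of_collinear:
  fixes f :: "real \<Rightarrow> real"
  assumes col: "\<And>x y z. x \<in> C \<Longrightarrow> y \<in> C \<Longrightarrow> x < y \<Longrightarrow> x \<le> z \<Longrightarrow> z \<le> y \<Longrightarrow>
     (f z - f x) * (y - x) = (f y - f x) * (z - x)"
  shows "\<exists>p q. \<forall>x\<in>C. f x = p * x + q"
proof (cases "\<exists>x\<in>C. \<exists>y\<in>C. x < y")
  case False
  then have "x = y" if "x \<in> C" "y \<in> C" for x y using that by (meson linorder_neqE)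
  then have "\<exists>q. \<forall>x\<in>C. f x = 0 * x + q" by (metis add_0 mult_zero_left)
  then show ?thesis by blast
next
  case True
  then obtain x y where xy: "x \<in> C" "y \<in> C" "x < y" by auto
  have *: "(f z - f x) * (y - x) = (f y - f x) * (z - x)" if z: "z \<in> C" for z
  proof -
    consider "z < x" | "x \<le> z" "z \<le> y" | "y < z" by fastforce
    then show ?thesis
    proof cases
      case 1
      then show ?thesis using col[OF z xy(2), of x] xy by (simp add: algebra_simps)
    next
      case 2
      then show ?thesis using col[OF xy, of z] by simp
    next
      case 3
      then show ?thesis using col[OF xy(1) z, of y] xy by (simp add: algebra_simps)
    qed
  qed
  define p where "p = (f y - f x) / (y - x)"
  have "f z = p * z + (f x - p * x)" if "z \<in> C" for z
  proof -
    have "f z - f x = p * (z - x)" using *[OF that] xy by (simp add: p_def field_simps)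
    then show ?thesis by (simp add: algebra_simps)
  qed
  then show ?thesis by blast
qed

text \<open>The test function n is f minus its chord over [x, y], extended by 0. It vanishes on the
  support, so f is orthogonal to it. Its gradient \<kappa> is k - s on (x, y] and has integral 0, so
  its energy is the integral of (k - s) * \<kappa>, which is 0; hence f is its chord.\<close>

lemma affine_of_orthogonal:
  assumes ab: "a < b" and \<mu>: "finite_borel_measure_on a b \<mu>" and f: "f \<in> H10 a b"
    and orth: "\<And>n. n \<in> H10 a b \<Longrightarrow> mass \<mu> n n = 0 \<Longrightarrow> energy a b f n = 0"
    and xy: "x < y" "{x..y} \<subseteq> {a..b} - meas_support a b \<mu>" and z: "x \<le> z" "z \<le> y"
  shows "(f z - f x) * (y - x) = (f y - f x) * (z - x)"
proof -
  obtain k where k: "has_grad a b f k" using f by (auto simp: H10_iff)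
  note kL = has_grad_L2[OF k]
  have axy: "a \<le> x" "y \<le> b" using xy(1) subsetD[OF xy(2), of x] subsetD[OF xy(2), of y] by auto
  define s where "s = (f y - f x) / (y - x)"
  have s: "s * (y - x) = f y - f x" using xy by (simp add: s_def)
  define \<kappa> where "\<kappa> t = indicator {x<..y} t * k t - s * indicator {x<..y} t" for t
  have \<kappa>: "\<kappa> \<in> L2 a b"
    unfolding \<kappa>_def using axy by (intro L2_diff L2_indicator kL L2_const_indicator) auto
  define n where "n t = (if t \<in> {x..y} then f t - f x - s * (t - x) else 0)" for t
  have prim: "(\<integral>t. indicator {x<..u} t * k t - s * indicator {x<..u} t \<partial>lborel) = f u - f x - s * (u - x)"
    if "x \<le> u" "u \<le> y" for u
  proof -
    have "integrable lborel (\<lambda>t. indicator {x<..u} t * k t)" "integrable lborel (\<lambda>t. s * indicator {x<..u} t)"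
      using axy that L2_integrable[OF L2_indicator[OF kL]] L2_integrable[OF L2_const_indicator[of a x u b s]] by auto
    then show ?thesis using has_grad_increment[OF k axy(1) that(1)] that axy
      by (subst Bochner_Integration.integral_diff) auto
  qed
  have n: "has_grad a b n \<kappa>"
    unfolding has_grad_def
  proof (intro conjI ballI \<kappa>)
    fix u assume u: "u \<in> {a..b}"
    consider "u < x" | "x \<le> u" "u \<le> y" | "y < u" by fastforce
    then show "n u = (\<integral>t. indicator {..u} t * \<kappa> t \<partial>lborel)"
    proof cases
      case 1
      then have "(\<lambda>t. indicator {..u} t * \<kappa> t) = (\<lambda>_. 0)" by (auto simp: fun_eq_iff \<kappa>_def indicator_def)
      then show ?thesis using 1 by (simp add: n_def)
    next
      case 2
      then have "(\<lambda>t. indicator {..u} t * \<kappa> t) = (\<lambda>t. indicator {x<..u} t * k t - s * indicator {x<..u} t)"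
        by (auto simp: fun_eq_iff \<kappa>_def indicator_def)
      then show ?thesis using 2 prim[of u] by (simp add: n_def)
    next
      case 3
      then have "(\<lambda>t. indicator {..u} t * \<kappa> t) = (\<lambda>t. indicator {x<..y} t * k t - s * indicator {x<..y} t)"
        by (auto simp: fun_eq_iff \<kappa>_def indicator_def)
      then show ?thesis using 3 prim[of y] xy s by (simp add: n_def)
    qed
  qed
  have nz: "n u = 0" if "u \<notin> {x..y}" for u using that unfolding n_def by (rule if_not_P)
  have na: "n a = 0" using has_grad_at_left_end[OF n] ab by simp
  have nb: "n b = 0" using axy s xy by (auto simp: n_def)
  have nH: "n \<in> H10 a b" using n na nb nz axy by (auto simp: H10_iff)
  have "mass \<mu> n n = 0" unfolding mass_zero_iff[OF \<mu> nH] using xy(2) by (intro ballI nz) auto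
  then have E0: "(\<integral>t. k t * \<kappa> t \<partial>lborel) = 0" using orth[OF nH] energy_eq[OF k n] by simp
  have "(\<integral>t. \<kappa> t \<partial>lborel) = 0" using prim[of y] xy s by (simp add: \<kappa>_def)
  then have "(\<integral>t. k t * \<kappa> t - s * \<kappa> t \<partial>lborel) = 0"
    using E0 L2_mult_integrable[OF kL \<kappa>] L2_integrable[OF \<kappa>] by simp
  moreover have "k t * \<kappa> t - s * \<kappa> t = \<kappa> t * \<kappa> t" for t by (auto simp: \<kappa>_def indicator_def algebra_simps)
  ultimately have "energy a b n n = 0" using energy_eq[OF n n] by simp
  then have "n z = 0" using square_le_energy[OF nH, of z] ab by simp
  then have "f z - f x = s * (z - x)" using z by (simp add: n_def)
  then have "(f z - f x) * (y - x) = (s * (y - x)) * (z - x)" by simp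
  then show ?thesis by (simp only: s)
qed

text \<open>Around a point with f x \<noteq> 0, the largest interval without zeros of f misses the
  support, so f is affine on it; f vanishes at both ends and therefore inside.\<close>

lemma energy_dom_null:
  assumes ab: "a < b" and \<mu>: "finite_borel_measure_on a b \<mu>"
    and f: "f \<in> energy_dom a b \<mu>" and 0: "\<forall>x\<in>meas_support a b \<mu>. f x = 0"
  shows "f x = 0"
proof (rule ccontr)
  assume fx: "f x \<noteq> 0"
  have fH: "f \<in> H10 a b" and fC: "f \<in> C_meas a b \<mu>" using f by (auto simp: energy_dom_def)
  have x: "x \<in> {a..b}" using fx fH by (auto simp: H10_iff)
  define Z where "Z = {t \<in> {a..b}. f t = 0}"
  have Z: "closed Z" unfolding Z_def using H10_continuous_on[OF fH]
    by (intro continuous_closed_preimage_constant) auto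
  have aZ: "a \<in> Z" "b \<in> Z" using ab fH by (auto simp: Z_def H10_iff)
  define c where "c = Sup (Z \<inter> {..x})"
  define d where "d = Inf (Z \<inter> {x..})"
  have bdd: "bdd_above (Z \<inter> {..x})" "bdd_below (Z \<inter> {x..})" by auto
  have cZ: "c \<in> Z \<inter> {..x}" unfolding c_def
    using aZ x Z bdd by (intro closed_contains_Sup closed_Int) auto
  have dZ: "d \<in> Z \<inter> {x..}" unfolding d_def
    using aZ x Z bdd by (intro closed_contains_Inf closed_Int) auto
  have cx: "c < x" "x < d" using cZ dZ fx by (auto simp: Z_def less_le)
  have nz: "f t \<noteq> 0" if "t \<in> {c<..<d}" for t
  proof
    assume "f t = 0"
    then have tZ: "t \<in> Z" using that cZ dZ by (auto simp: Z_def)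
    show False
    proof (cases "t \<le> x")
      case True
      then have "t \<le> c" unfolding c_def using tZ bdd by (intro cSup_upper) auto
      then show False using that by simp
    next
      case False
      then have "d \<le> t" unfolding d_def using tZ bdd by (intro cInf_lower) auto
      then show False using that by simp
    qed
  qed
  have sub: "{c<..<d} \<subseteq> {a..b} - meas_support a b \<mu>" using nz 0 cZ dZ by (force simp: Z_def)
  moreover have "{a..b} - meas_support a b \<mu> \<noteq> {}" using sub cx by auto
  ultimately obtain C where C: "C \<in> components ({a..b} - meas_support a b \<mu>)" "{c<..<d} \<subseteq> C"
    using exists_component_superset[OF sub] connected_Ioo by metis
  have "\<exists>p q. \<forall>t\<in>C. f t = p * t + q" using fC C(1) by (simp add: C_meas_def)
  then obtain p q where "\<forall>t\<in>C. f t = p * t + q" by (elim exE)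
  then have pq: "f t = p * t + q" if "t \<in> {c<..<d}" for t using that C(2) by auto
  have cl: "closure {c<..<d} = {c..d}" using cx by simp
  have "continuous_on {c..d} (\<lambda>t. f t - (p * t + q))"
    using cZ dZ by (intro continuous_intros continuous_on_subset[OF H10_continuous_on[OF fH]]) (auto simp: Z_def)
  then have "f t - (p * t + q) = 0" if "t \<in> {c..d}" for t
    using continuous_constant_on_closure[of "{c<..<d}" "\<lambda>t. f t - (p * t + q)" 0 t] that pq unfolding cl by simp
  from this[of c] this[of d] have "p * c + q = 0" "p * d + q = 0" using cx cZ dZ by (auto simp: Z_def)
  moreover have "p * (d - c) = (p * d + q) - (p * c + q)" by (simp add: algebra_simps)
  ultimately have "p * (d - c) = 0" by simp
  then have "p = 0" using cx by simp
  then show False using pq[of x] cx fx \<open>p * c + q = 0\<close> by simp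
qed

text \<open>The support can have infinitely many gaps, and the proof avoids summing energies over
  them. For f in the domain let n be its projection onto the null space. Then f - n is in the
  complement, hence affine on the gaps by the first inclusion, and so is n = f - (f - n). As n also
  vanishes on the support, \<open>energy_dom_null\<close> gives n = 0.\<close>

lemma energy_dom_eq:
  assumes ab: "a < b" and \<mu>: "finite_borel_measure_on a b \<mu>"
  shows "energy_dom a b \<mu> = {f \<in> H10 a b. \<forall>n\<in>H10 a b. mass \<mu> n n = 0 \<longrightarrow> energy a b f n = 0}"
    (is "_ = ?D")
proof -
  interpret form_pair fun_scale "H10 a b" "energy a b" "mass \<mu>"
    by (rule form_pair_energy_mass[OF ab \<mu>])
  have sub: "?D \<subseteq> energy_dom a b \<mu>"
  proof
    fix f assume f: "f \<in> ?D"
    then have fH: "f \<in> H10 a b" by simp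
    have "\<exists>p q. \<forall>x\<in>C. f x = p * x + q" if C: "C \<in> components ({a..b} - meas_support a b \<mu>)" for C
    proof (rule affine_of_collinear)
      fix x y z assume xy: "x \<in> C" "y \<in> C" "x < y" "x \<le> z" "z \<le> y"
      have "{x..y} \<subseteq> C" using in_components_connected[OF C] xy by (intro connected_contains_Icc) auto
      then have "{x..y} \<subseteq> {a..b} - meas_support a b \<mu>" using in_components_subset[OF C] by blast
      then show "(f z - f x) * (y - x) = (f y - f x) * (z - x)"
        using f xy by (intro affine_of_orthogonal[OF ab \<mu> fH]) auto
    qed
    then show "f \<in> energy_dom a b \<mu>"
      using fH H10_continuous_on[OF fH] by (auto simp: energy_dom_def C_meas_def H10_iff)
  qed
  moreover have "f \<in> ?D" if f: "f \<in> energy_dom a b \<mu>" for f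
  proof -
    have fH: "f \<in> H10 a b" using f by (simp add: energy_dom_def)
    obtain n where n: "n \<in> H10 a b" "mass \<mu> n n = 0" "\<And>k. k \<in> H10 a b \<Longrightarrow> mass \<mu> k k = 0 \<Longrightarrow> energy a b (f - n) k = 0"
      using null_projection[OF fH] by auto
    have fn: "f - n \<in> ?D" using n fH E.H by (auto simp: E.subspace_diff)
    then have "f - n \<in> energy_dom a b \<mu>" using sub by blast
    have "n \<in> C_meas a b \<mu>"
      unfolding C_meas_def
    proof (intro CollectI conjI ballI allI impI)
      show "continuous_on {a..b} n" using H10_continuous_on n by blast
      show "n x = 0" if "x \<notin> {a..b}" for x using n that by (auto simp: H10_iff)
      fix C assume C: "C \<in> components ({a..b} - meas_support a b \<mu>)"
      have "\<exists>p q. \<forall>x\<in>C. f x = p * x + q" "\<exists>p q. \<forall>x\<in>C. (f - n) x = p * x + q"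
        using f \<open>f - n \<in> energy_dom a b \<mu>\<close> C by (simp_all add: energy_dom_def C_meas_def)
      then obtain p q p' q' where 1: "\<forall>x\<in>C. f x = p * x + q" and 2: "\<forall>x\<in>C. (f - n) x = p' * x + q'"
        by (elim exE)
      have "n x = (p - p') * x + (q - q')" if "x \<in> C" for x
        using 1[rule_format, OF that] 2[rule_format, OF that] by (simp add: algebra_simps)
      then show "\<exists>p q. \<forall>x\<in>C. n x = p * x + q" by (intro exI ballI)
    qed
    then have nD: "n \<in> energy_dom a b \<mu>" using n by (simp add: energy_dom_def)
    have "\<forall>x\<in>meas_support a b \<mu>. n x = 0" using n(2) mass_zero_iff[OF \<mu> n(1)] by (rule iffD1[rotated])
    note nx = energy_dom_null[OF ab \<mu> nD this]
    have "n = 0" by (simp add: fun_eq_iff nx)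
    then show ?thesis using fn by simp
  qed
  ultimately show ?thesis by blast
qed

section \<open>Eigenvalue counts as dimensions of trial spaces\<close>

lemma at_least_eigenvalues_upto_iff:
  assumes ab: "a < b" and \<mu>: "finite_borel_measure_on a b \<mu>"
  shows "at_least_eigenvalues_upto a b \<mu> i l \<longleftrightarrow>
    (\<exists>S\<subseteq>H10 a b. finite S \<and> \<not> module.dependent fun_scale S \<and> card S = i \<and>
       (\<forall>f\<in>module.span fun_scale S. energy a b f f \<le> l * mass \<mu> f f))"
proof -
  interpret form_pair fun_scale "H10 a b" "energy a b" "mass \<mu>"
    by (rule form_pair_energy_mass[OF ab \<mu>])
  have eig: "eigenspace a b \<mu> k = eigen k" for k
    using eigen_null_complement[OF energy_dom_eq[OF ab \<mu>], of k]
    by (simp add: eigenspace_def mass_def)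
  have mult: "multiplicity_of a b \<mu> k = E.dim (eigen k)" for k
    by (simp add: multiplicity_of_def eig)
  have ev: "is_eigenvalue a b \<mu> k \<longleftrightarrow> eigen k \<noteq> {0}" for k
    using E.subspace_0[OF subspace_eigen[of k]] by (auto simp: is_eigenvalue_def eig zero_fun_def)
  show ?thesis
  proof
    assume "at_least_eigenvalues_upto a b \<mu> i l"
    then obtain F where F: "finite F" "F \<subseteq> {k. is_eigenvalue a b \<mu> k \<and> k \<le> l}"
      "i \<le> (\<Sum>k\<in>F. E.dim (eigen k))" by (auto simp: at_least_eigenvalues_upto_def mult)
    have "\<exists>S\<subseteq>H10 a b. finite S \<and> E.independent S \<and> card S = (\<Sum>k\<in>F. E.dim (eigen k)) \<and>
        (\<forall>x\<in>E.span S. energy a b x x \<le> l * mass \<mu> x x)"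
      using F(2) by (intro span_bound_of_eigenvalues F(1)) auto
    then obtain S where S: "S \<subseteq> H10 a b" "finite S" "E.independent S" "card S = (\<Sum>k\<in>F. E.dim (eigen k))"
      "\<forall>x\<in>E.span S. energy a b x x \<le> l * mass \<mu> x x"
      by (elim exE conjE)
    \<comment> \<open>The eigenspaces may supply more than i vectors; any i of them span a trial
      space.\<close>
    obtain T where T: "T \<subseteq> S" "card T = i" "finite T"
      using obtain_subset_with_card_n[of i S] S F by auto
    have "E.span T \<subseteq> E.span S" using E.span_mono[OF T(1)] .
    then show "\<exists>S\<subseteq>H10 a b. finite S \<and> E.independent S \<and> card S = i \<and>
       (\<forall>f\<in>E.span S. energy a b f f \<le> l * mass \<mu> f f)"
      using T S E.independent_mono[OF S(3) T(1)] by (intro exI[of _ T]) auto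
  next
    assume "\<exists>S\<subseteq>H10 a b. finite S \<and> E.independent S \<and> card S = i \<and>
       (\<forall>f\<in>E.span S. energy a b f f \<le> l * mass \<mu> f f)"
    then obtain S where S: "S \<subseteq> H10 a b" "finite S" "E.independent S" "card S = i"
      "\<forall>f\<in>E.span S. energy a b f f \<le> l * mass \<mu> f f" by (elim exE conjE)
    have "\<exists>F. finite F \<and> (\<forall>k\<in>F. k \<le> l \<and> eigen k \<noteq> {0}) \<and> card S \<le> (\<Sum>k\<in>F. E.dim (eigen k))"
      using S(5) by (intro eigenvalues_of_span_bound S) auto
    then obtain F where "finite F" "\<forall>k\<in>F. k \<le> l \<and> eigen k \<noteq> {0}" "i \<le> (\<Sum>k\<in>F. E.dim (eigen k))"
      unfolding S(4) by (elim exE conjE)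
    then show "at_least_eigenvalues_upto a b \<mu> i l"
      unfolding at_least_eigenvalues_upto_def mult ev by (intro exI[of _ F]) auto
  qed
qed

text \<open>A bound l can be lowered to the largest eigenvalue counted, \<open>Max F\<close>,
  without losing any of the count; i >= 1 makes \<open>F\<close> nonempty. For i = 0 the empty
  \<open>F\<close> would admit every real l.\<close>

lemma ith_eigenvalue_eq_Inf:
  assumes i: "i \<ge> 1"
  shows "ith_eigenvalue a b \<mu> i = Inf {ereal l | l. at_least_eigenvalues_upto a b \<mu> i l}"
proof (rule antisym)
  show "Inf {ereal l | l. at_least_eigenvalues_upto a b \<mu> i l} \<le> ith_eigenvalue a b \<mu> i"
    unfolding ith_eigenvalue_def by (intro Inf_superset_mono) auto
  show "ith_eigenvalue a b \<mu> i \<le> Inf {ereal l | l. at_least_eigenvalues_upto a b \<mu> i l}"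
    unfolding ith_eigenvalue_def
  proof (intro Inf_mono)
    fix x assume "x \<in> {ereal l | l. at_least_eigenvalues_upto a b \<mu> i l}"
    then obtain l F where l: "x = ereal l" "finite F" "F \<subseteq> {k. is_eigenvalue a b \<mu> k \<and> k \<le> l}"
      "i \<le> (\<Sum>k\<in>F. multiplicity_of a b \<mu> k)"
      by (auto simp: at_least_eigenvalues_upto_def)
    then have ne: "F \<noteq> {}" using i by auto
    have "Max F \<in> F" "\<And>k. k \<in> F \<Longrightarrow> k \<le> Max F" using l(2) ne by auto
    then have "is_eigenvalue a b \<mu> (Max F)" "Max F \<le> l" "at_least_eigenvalues_upto a b \<mu> i (Max F)"
      using l unfolding at_least_eigenvalues_upto_def by blast+
    then show "\<exists>y\<in>{ereal l | l. is_eigenvalue a b \<mu> l \<and> at_least_eigenvalues_upto a b \<mu> i l}. y \<le> x"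
      using l(1) by auto
  qed
qed

section \<open>Bi-Lipschitz substitution\<close>

text \<open>Serves to write a multiple of Lebesgue measure as a sum of two measures, which shows
  that it dominates each of them.\<close>

lemma emeasure_add_measure:
  assumes "sets M = sets N" "A \<in> sets M"
  shows "emeasure (measure_of (space M) (sets M) (\<lambda>A. emeasure M A + emeasure N A)) A = emeasure M A + emeasure N A"
proof (rule emeasure_measure_of_sigma)
  show "countably_additive (sets M) (\<lambda>A. emeasure M A + emeasure N A)"
  proof (rule countably_additiveI)
    fix A :: "nat \<Rightarrow> 'a set" assume A: "range A \<subseteq> sets M" "disjoint_family A"
    then show "(\<Sum>i. emeasure M (A i) + emeasure N (A i)) = emeasure M (\<Union> (range A)) + emeasure N (\<Union> (range A))"
      using assms(1) by (subst suminf_add[symmetric]) (auto simp: suminf_emeasure)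
  qed
  show "sigma_algebra (space M) (sets M)" ..
qed (use assms in \<open>auto simp: positive_def\<close>)

text \<open>On the set where u < \<rho> the positive function \<rho> - u has integral 0, so the set
  is null. The finite integral of u makes the subtraction legitimate.\<close>

lemma density_le_AE:
  assumes \<rho>: "\<rho> \<in> borel_measurable M" and u: "u \<in> borel_measurable M" "(\<integral>\<^sup>+x. u x \<partial>M) < \<infinity>"
    and le: "\<And>A. A \<in> sets M \<Longrightarrow> emeasure (density M \<rho>) A \<le> emeasure (density M u) A"
  shows "AE x in M. \<rho> x \<le> u x"
proof -
  define A where "A = {x \<in> space M. u x < \<rho> x}"
  have A: "A \<in> sets M" unfolding A_def using \<rho> u by measurable
  let ?i = "\<lambda>f x. (f x :: ennreal) * indicator A x"
  have fin: "(\<integral>\<^sup>+x. ?i u x \<partial>M) \<noteq> \<infinity>"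
  proof -
    have "(\<integral>\<^sup>+x. ?i u x \<partial>M) \<le> (\<integral>\<^sup>+x. u x \<partial>M)" by (intro nn_integral_mono) (auto simp: indicator_def)
    then have "(\<integral>\<^sup>+x. ?i u x \<partial>M) < \<infinity>" using u(2) by (rule order_le_less_trans)
    then show ?thesis by simp
  qed
  have "(\<integral>\<^sup>+x. ?i \<rho> x - ?i u x \<partial>M) = (\<integral>\<^sup>+x. ?i \<rho> x \<partial>M) - (\<integral>\<^sup>+x. ?i u x \<partial>M)"
  proof (rule nn_integral_diff[OF _ _ fin])
    show "AE x in M. ?i u x \<le> ?i \<rho> x" by (auto simp: A_def indicator_def)
  qed (use \<rho> u A in auto)
  also have "\<dots> = 0"
    using le[OF A] \<rho> u(1) A fin order_le_less_trans[of _ "\<integral>\<^sup>+x. ?i u x \<partial>M" top]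
    by (simp add: emeasure_density diff_eq_0_iff_ennreal less_top)
  finally have "AE x in M. ?i \<rho> x - ?i u x = 0"
    using \<rho> u A by (subst (asm) nn_integral_0_iff_AE) auto
  moreover have "AE x in M. x \<in> space M" by auto
  ultimately show ?thesis
  proof eventually_elim
    case (elim x)
    show ?case
    proof (rule ccontr)
      assume "\<not> \<rho> x \<le> u x"
      then have "x \<in> A" "u x < \<rho> x" using elim by (auto simp: A_def)
      then show False using elim by (auto simp: diff_eq_0_iff_ennreal dest: leD)
    qed
  qed
qed

text \<open>Change of variables without differentiating \<open>\<phi>\<close>: the image of Lebesgue measure under
  \<open>\<psi>\<close> is dominated by \<open>L\<close> times Lebesgue measure, and its Radon--Nikodym density \<open>r\<close>
  plays the role of \<open>\<phi>'\<close>.\<close>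

lemma lipschitz_inverse_image_density:
  fixes \<phi> \<psi> :: "real \<Rightarrow> real"
  assumes ab: "a < b" and cd: "c < d" and L: "L \<ge> 0"
    and \<phi>: "\<And>x. x \<in> {a..b} \<Longrightarrow> \<phi> x \<in> {c..d}" and \<psi>: "\<And>x. x \<in> {c..d} \<Longrightarrow> \<psi> x \<in> {a..b}"
    and \<phi>\<psi>: "\<And>x. x \<in> {c..d} \<Longrightarrow> \<phi> (\<psi> x) = x" and \<psi>\<phi>: "\<And>x. x \<in> {a..b} \<Longrightarrow> \<psi> (\<phi> x) = x"
    and lip: "\<And>x y. x \<in> {a..b} \<Longrightarrow> y \<in> {a..b} \<Longrightarrow> x \<le> y \<Longrightarrow> \<phi> x \<le> \<phi> y \<and> \<phi> y - \<phi> x \<le> L * (y - x)"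
    and \<psi>_meas: "\<psi>' \<in> borel_measurable borel" "\<And>x. x \<in> {c..d} \<Longrightarrow> \<psi>' x = \<psi> x"
  shows "\<exists>r \<in> borel_measurable borel. (\<forall>t. 0 \<le> r t \<and> r t \<le> L) \<and> (\<forall>t. t \<notin> {a..b} \<longrightarrow> r t = 0) \<and>
     density lborel (\<lambda>t. ennreal (r t)) = distr (density lborel (indicator {c..d})) borel \<psi>'"
proof -
  \<comment> \<open>Clamping to [a, b] makes \<phi> (cl y) continuous and monotone on the whole
    line, as a Stieltjes construction requires.\<close>
  define cl where "cl x = max a (min b x)" for x
  have cl: "cl x \<in> {a..b}" "x \<le> y \<Longrightarrow> cl x \<le> cl y" for x y using ab by (auto simp: cl_def)
  have cl_cont: "continuous_on UNIV cl" unfolding cl_def by (intro continuous_intros)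
  have mono: "\<psi> x \<le> \<psi> y \<longleftrightarrow> x \<le> y" if "x \<in> {c..d}" "y \<in> {c..d}" for x y
    using lip[OF \<psi>[OF that(1)] \<psi>[OF that(2)]] lip[OF \<psi>[OF that(2)] \<psi>[OF that(1)]] \<phi>\<psi> that
    by (smt (verit))
  have \<phi>c: "\<phi> a = c" "\<phi> b = d"
  proof -
    have "\<psi> c = a" using mono[of c "\<phi> a"] \<phi>[of a] \<psi>\<phi>[of a] \<psi>[of c] ab cd by auto
    then show "\<phi> a = c" using \<phi>\<psi>[of c] cd by auto
    have "\<psi> d = b" using mono[of "\<phi> b" d] \<phi>[of b] \<psi>\<phi>[of b] \<psi>[of d] ab cd by auto
    then show "\<phi> b = d" using \<phi>\<psi>[of d] cd by auto
  qed
  define \<kappa> where "\<kappa> = distr (density lborel (indicator {c..d})) borel \<psi>'"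
  have \<kappa>_ray: "emeasure \<kappa> {y<..} = ennreal (d - \<phi> (cl y))" for y
  proof -
    have "emeasure \<kappa> {y<..} = emeasure lborel (\<psi>' -` {y<..} \<inter> {c..d})"
      unfolding \<kappa>_def using \<psi>_meas
      by (subst emeasure_distr) (auto simp: emeasure_density indicator_inter_arith[symmetric] Int_commute
            measurable_sets_borel[OF \<psi>_meas(1)] intro!: sets.Int)
    also have "\<psi>' -` {y<..} \<inter> {c..d} = (if y < a then {c..d} else {\<phi> (cl y)<..d})"
    proof (cases "y < a")
      case True
      then show ?thesis using \<psi> \<psi>_meas(2) by fastforce
    next
      case False
      have "y < \<psi> x \<longleftrightarrow> \<phi> (cl y) < x" if x: "x \<in> {c..d}" for x
      proof (cases "y \<le> b")
        case True
        then have "cl y = y" "y \<in> {a..b}" using False by (auto simp: cl_def)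
        then show ?thesis using mono[OF x \<phi>[of y]] \<psi>\<phi>[of y] by (simp add: not_le[symmetric])
      next
        case False
        then have "cl y = b" using ab by (simp add: cl_def)
        then show ?thesis using False \<psi>[OF x] x \<phi>c by auto
      qed
      then show ?thesis using False \<psi>_meas(2) \<phi>[OF cl(1), of y] by auto
    qed
    also have "emeasure lborel \<dots> = ennreal (d - \<phi> (cl y))"
    proof (cases "y < a")
      case True
      then have "cl y = a" using ab by (simp add: cl_def)
      then show ?thesis using True \<phi>c cd by simp
    next
      case False
      then show ?thesis using \<phi>[OF cl(1), of y] by simp
    qed
    finally show ?thesis .
  qed
  have \<kappa>_sets: "sets \<kappa> = sets borel" "space \<kappa> = UNIV" by (auto simp: \<kappa>_def)
  \<comment> \<open>What \<phi> lacks to slope L: nondecreasing because of the Lipschitz bound. Its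
    Stieltjes measure \<gamma> fills \<kappa> up to L times Lebesgue measure on [a, b], as
    comparison on rays shows, so \<kappa> is dominated by the latter.\<close>
  define G where "G y = L * cl y - \<phi> (cl y)" for y
  have G_mono: "G x \<le> G y" if "x \<le> y" for x y
    using lip[OF cl(1) cl(1) cl(2)[OF that]] by (simp add: G_def algebra_simps)
  have "continuous_on {a..b} \<phi>"
  proof (rule continuous_on_subset[OF lipschitz_on_continuous_on[of L]])
    show "L-lipschitz_on {a..b} \<phi>"
    proof (rule lipschitz_onI)
      fix x y assume "x \<in> {a..b}" "y \<in> {a..b}"
      then show "dist (\<phi> x) (\<phi> y) \<le> L * dist x y"
        using lip[of x y] lip[of y x] by (cases "x \<le> y") (auto simp: dist_real_def)
    qed (use L in auto)
  qed simp
  then have "continuous_on UNIV (\<lambda>y. \<phi> (cl y))"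
    by (rule continuous_on_compose2[OF _ cl_cont]) (use cl in auto)
  then have G_cont: "continuous_on UNIV G"
    unfolding G_def by (intro continuous_on_diff continuous_on_mult_left cl_cont)
  define \<gamma> where "\<gamma> = interval_measure G"
  have \<gamma>_Ioc: "emeasure \<gamma> {x<..y} = ennreal (G y - G x)" if "x \<le> y" for x y
    unfolding \<gamma>_def using that G_mono G_cont
    by (intro emeasure_interval_measure_Ioc)
       (auto simp: continuous_on_eq_continuous_within intro: continuous_within_subset)
  have \<gamma>_b: "emeasure \<gamma> {y<..} = 0" if "b \<le> y" for y
  proof -
    have "{y<..} = (\<Union>n. {y<..y + real n})"
    proof (intro subset_antisym subsetI)
      fix x assume x: "x \<in> {y<..}"
      obtain n where "x - y \<le> real n" using real_arch_simple by blast
      then show "x \<in> (\<Union>n. {y<..y + real n})" using x by (auto intro!: exI[of _ n])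
    qed auto
    moreover have "emeasure \<gamma> (\<Union>n. {y<..y + real n}) = 0"
    proof (rule emeasure_UN_eq_0)
      fix n
      have "G (y + real n) = G y" using that by (simp add: G_def cl_def)
      then show "emeasure \<gamma> {y<..y + real n} = 0" by (subst \<gamma>_Ioc) auto
    qed (auto simp: \<gamma>_def)
    ultimately show ?thesis by simp
  qed
  have \<gamma>_ray: "emeasure \<gamma> {y<..} = ennreal (G b - G y)" for y
  proof (cases "y \<le> b")
    case True
    have "{y<..b} \<union> {b<..} = {y<..}" using True by auto
    moreover have "emeasure \<gamma> {y<..b} + emeasure \<gamma> {b<..} = emeasure \<gamma> ({y<..b} \<union> {b<..})"
      by (rule plus_emeasure) (auto simp: \<gamma>_def)
    ultimately have "emeasure \<gamma> {y<..} = emeasure \<gamma> {y<..b} + emeasure \<gamma> {b<..}" by metis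
    then show ?thesis using \<gamma>_Ioc[OF True] \<gamma>_b[of b] by simp
  next
    case False
    then have "G b = G y" by (simp add: G_def cl_def)
    then show ?thesis using \<gamma>_b[of y] False by simp
  qed
  have cl_b: "cl b = b" using ab by (simp add: cl_def)
  define u where "u x = ennreal L * indicator {a..b} x" for x :: real
  have u_meas: "u \<in> borel_measurable borel" unfolding u_def by measurable
  define \<sigma> where "\<sigma> = measure_of (space \<kappa>) (sets \<kappa>) (\<lambda>A. emeasure \<kappa> A + emeasure \<gamma> A)"
  have \<sigma>: "emeasure \<sigma> A = emeasure \<kappa> A + emeasure \<gamma> A" if "A \<in> sets borel" for A
    unfolding \<sigma>_def using that by (intro emeasure_add_measure) (auto simp: \<kappa>_sets \<gamma>_def)
  have "density lborel u = \<sigma>"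
  proof (rule measure_eqI_lessThan)
    fix y
    have "emeasure (density lborel u) {y<..} = (\<integral>\<^sup>+x. ennreal L * indicator ({a..b} \<inter> {y<..}) x \<partial>lborel)"
      by (subst emeasure_density) (auto simp: u_meas, auto simp: u_def indicator_inter_arith mult.assoc intro!: nn_integral_cong)
    also have "\<dots> = ennreal L * emeasure lborel ({a..b} \<inter> {y<..})" by (simp add: nn_integral_cmult_indicator)
    also have "{a..b} \<inter> {y<..} = (if y < a then {a..b} else {cl y<..b})"
      by (auto simp: cl_def)
    also have "emeasure lborel \<dots> = ennreal (b - cl y)" using ab by (auto simp: cl_def)
    also have "ennreal L * ennreal (b - cl y) = ennreal (L * (b - cl y))"
      using L cl(1)[of y] by (simp add: ennreal_mult)
    finally have 1: "emeasure (density lborel u) {y<..} = ennreal (L * (b - cl y))" .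
    then show "emeasure (density lborel u) {y<..} < \<infinity>" by simp
    have "emeasure \<sigma> {y<..} = ennreal (d - \<phi> (cl y)) + ennreal (G b - G y)"
      by (simp add: \<sigma> \<kappa>_ray \<gamma>_ray)
    also have "\<dots> = ennreal ((d - \<phi> (cl y)) + (G b - G y))"
    proof (rule ennreal_plus[symmetric])
      show "0 \<le> d - \<phi> (cl y)" using \<phi>[OF cl(1), of y] by simp
      have "G y \<le> G b" using G_mono[of y b] by (cases "y \<le> b") (auto simp: G_def cl_def)
      then show "0 \<le> G b - G y" by simp
    qed
    also have "(d - \<phi> (cl y)) + (G b - G y) = L * (b - cl y)"
      by (simp add: G_def cl_b \<phi>c algebra_simps)
    finally show "emeasure (density lborel u) {y<..} = emeasure \<sigma> {y<..}" using 1 by simp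
  qed (auto simp: \<sigma>_def \<kappa>_sets sets.sigma_sets_eq[of borel, unfolded space_borel])
  then have \<kappa>_le: "emeasure \<kappa> A \<le> emeasure (density lborel u) A" if "A \<in> sets borel" for A
    using \<sigma>[OF that] by simp
  have "absolutely_continuous lborel \<kappa>"
    unfolding absolutely_continuous_def
  proof
    fix A :: "real set" assume A: "A \<in> null_sets lborel"
    then have "A \<in> null_sets (density lborel u)"
      using u_meas absolutely_continuousI_density[of u lborel] by (auto simp: absolutely_continuous_def)
    then show "A \<in> null_sets \<kappa>" using \<kappa>_le[of A] A by (auto simp: null_sets_def \<kappa>_sets)
  qed
  then obtain \<rho> where \<rho>: "\<rho> \<in> borel_measurable borel" "density lborel \<rho> = \<kappa>"
    using sigma_finite_measure.Radon_Nikodym[OF sigma_finite_lborel, of \<kappa>] \<kappa>_sets by auto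
  have "AE x in lborel. \<rho> x \<le> u x"
  proof (rule density_le_AE)
    show "(\<integral>\<^sup>+x. u x \<partial>lborel) < \<infinity>"
      unfolding u_def using ab by (simp add: nn_integral_cmult_indicator ennreal_mult_less_top)
  qed (use \<rho> u_meas \<kappa>_le in auto)
  \<comment> \<open>A version of the density that obeys the bounds everywhere and not just almost
    everywhere.\<close>
  define r where "r t = indicator {a..b} t * min L (enn2real (\<rho> t))" for t
  have r_meas: "r \<in> borel_measurable borel" unfolding r_def using \<rho>(1) by measurable
  have "AE t in lborel. \<rho> t = ennreal (r t)"
    using \<open>AE x in lborel. \<rho> x \<le> u x\<close>
  proof eventually_elim
    case (elim t)
    show ?case
    proof (cases "t \<in> {a..b}")
      case True
      then have le: "\<rho> t \<le> ennreal L" using elim by (simp add: u_def)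
      then have "\<rho> t \<noteq> top" by (auto simp: top_unique)
      moreover have "enn2real (\<rho> t) \<le> L" using enn2real_mono[OF le] L by simp
      ultimately show ?thesis using True by (simp add: r_def min_absorb2 less_top)
    next
      case False
      then show ?thesis using elim by (simp add: u_def r_def)
    qed
  qed
  then have "density lborel (\<lambda>t. ennreal (r t)) = \<kappa>"
    using \<rho> r_meas density_cong[of \<rho> lborel "\<lambda>t. ennreal (r t)"] by simp
  moreover have "0 \<le> r t \<and> r t \<le> L" "t \<notin> {a..b} \<Longrightarrow> r t = 0" for t
    using L by (auto simp: r_def indicator_def)
  ultimately show ?thesis using r_meas unfolding \<kappa>_def by blast
qed

text \<open>The gradient of the composition is r * (k o \<phi>), with r in the role of the
  derivative of \<phi>. In its square one factor r is bounded by L and the other is consumed by the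
  change of variables, so the bound carries L and not L^2.\<close>

lemma has_grad_compose_increasing:
  fixes \<phi> \<psi> :: "real \<Rightarrow> real"
  assumes ab: "a < b" and cd: "c < d" and L: "L \<ge> 0"
    and \<phi>: "\<And>x. x \<in> {a..b} \<Longrightarrow> \<phi> x \<in> {c..d}" and \<psi>: "\<And>x. x \<in> {c..d} \<Longrightarrow> \<psi> x \<in> {a..b}"
    and \<phi>\<psi>: "\<And>x. x \<in> {c..d} \<Longrightarrow> \<phi> (\<psi> x) = x" and \<psi>\<phi>: "\<And>x. x \<in> {a..b} \<Longrightarrow> \<psi> (\<phi> x) = x"
    and lip: "\<And>x y. x \<in> {a..b} \<Longrightarrow> y \<in> {a..b} \<Longrightarrow> x \<le> y \<Longrightarrow> \<phi> x \<le> \<phi> y \<and> \<phi> y - \<phi> x \<le> L * (y - x)"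
    and \<psi>_cont: "continuous_on {c..d} \<psi>"
    and f: "has_grad c d f k"
  shows "\<exists>k'. has_grad a b (\<lambda>x. f (\<phi> x)) k' \<and> (\<integral>t. (k' t)\<^sup>2 \<partial>lborel) \<le> L * (\<integral>t. (k t)\<^sup>2 \<partial>lborel)"
proof -
  have clm: "max l (min u x) \<in> {l..u}" if "l < u" for l u x :: real using that by auto
  define \<psi>' where "\<psi>' x = \<psi> (max c (min d x))" for x
  define \<phi>' where "\<phi>' x = \<phi> (max a (min b x))" for x
  have "continuous_on UNIV \<psi>'"
    unfolding \<psi>'_def using clm[OF cd]
    by (intro continuous_on_compose2[OF \<psi>_cont] continuous_intros) auto
  then have \<psi>'_meas [measurable]: "\<psi>' \<in> borel_measurable borel" by (rule borel_measurable_continuous_onI)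
  have \<phi>'_mono: "mono \<phi>'"
  proof (rule monoI)
    fix x y :: real assume "x \<le> y"
    then have "max a (min b x) \<le> max a (min b y)" by auto
    then show "\<phi>' x \<le> \<phi>' y" unfolding \<phi>'_def using lip[OF clm[OF ab] clm[OF ab]] by blast
  qed
  have \<phi>'_meas [measurable]: "\<phi>' \<in> borel_measurable borel" by (rule borel_measurable_mono[OF \<phi>'_mono])
  have \<psi>'_eq: "\<psi>' x = \<psi> x" if "x \<in> {c..d}" for x using that by (simp add: \<psi>'_def)
  obtain r where r [measurable]: "r \<in> borel_measurable borel" and r0: "\<And>t. 0 \<le> r t" "\<And>t. r t \<le> L"
    "\<And>t. t \<notin> {a..b} \<Longrightarrow> r t = 0"
    and dens: "density lborel (\<lambda>t. ennreal (r t)) = distr (density lborel (indicator {c..d})) borel \<psi>'"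
    using lipschitz_inverse_image_density[OF ab cd L \<phi> \<psi> \<phi>\<psi> \<psi>\<phi> lip \<psi>'_meas \<psi>'_eq] by blast
  have dens': "density lborel (\<lambda>t. ennreal (r t)) = distr (density lborel (\<lambda>x. ennreal (indicator {c..d} x))) borel \<psi>'"
    unfolding dens by (simp add: ennreal_indicator)
  have change: "(\<integral>t. r t * F t \<partial>lborel) = (\<integral>x. indicator {c..d} x * F (\<psi>' x) \<partial>lborel)"
    "integrable lborel (\<lambda>t. r t * F t) \<longleftrightarrow> integrable lborel (\<lambda>x. indicator {c..d} x * F (\<psi>' x))"
    if [measurable]: "F \<in> borel_measurable borel" for F :: "real \<Rightarrow> real"
  proof -
    have "(\<integral>t. r t * F t \<partial>lborel) = (\<integral>t. F t \<partial>density lborel (\<lambda>t. ennreal (r t)))"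
      using r0 by (subst integral_density) auto
    also have "\<dots> = (\<integral>x. F (\<psi>' x) \<partial>density lborel (\<lambda>x. ennreal (indicator {c..d} x)))"
      unfolding dens' by (subst integral_distr) auto
    also have "\<dots> = (\<integral>x. indicator {c..d} x * F (\<psi>' x) \<partial>lborel)"
      by (subst integral_density) auto
    finally show "(\<integral>t. r t * F t \<partial>lborel) = (\<integral>x. indicator {c..d} x * F (\<psi>' x) \<partial>lborel)" .
    have "integrable lborel (\<lambda>t. r t * F t) \<longleftrightarrow> integrable (density lborel (\<lambda>t. ennreal (r t))) F"
      using r0 by (subst integrable_density) auto
    also have "\<dots> \<longleftrightarrow> integrable (density lborel (\<lambda>x. ennreal (indicator {c..d} x))) (\<lambda>x. F (\<psi>' x))"
      unfolding dens' by (subst integrable_distr_eq) auto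
    also have "\<dots> \<longleftrightarrow> integrable lborel (\<lambda>x. indicator {c..d} x * F (\<psi>' x))"
      by (subst integrable_density) auto
    finally show "integrable lborel (\<lambda>t. r t * F t) \<longleftrightarrow> integrable lborel (\<lambda>x. indicator {c..d} x * F (\<psi>' x))" .
  qed
  have kL: "k \<in> L2 c d" using has_grad_L2[OF f] .
  have k_meas [measurable]: "k \<in> borel_measurable borel" using L2_measurable[OF kL] .
  have \<phi>\<psi>': "\<phi>' (\<psi>' x) = x" if "x \<in> {c..d}" for x
    using \<psi>[OF that] \<phi>\<psi>[OF that] \<psi>'_eq[OF that] by (simp add: \<phi>'_def)
  define k' where "k' t = r t * k (\<phi>' t)" for t
  have sq: "(\<lambda>x. indicator {c..d} x * (k (\<phi>' (\<psi>' x)))\<^sup>2) = (\<lambda>x. (k x)\<^sup>2)"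
    using \<phi>\<psi>' L2_outside[OF kL] by (auto simp: fun_eq_iff indicator_def)
  have int: "integrable lborel (\<lambda>t. r t * (k (\<phi>' t))\<^sup>2)"
    "(\<integral>t. r t * (k (\<phi>' t))\<^sup>2 \<partial>lborel) = (\<integral>x. (k x)\<^sup>2 \<partial>lborel)"
    using change[of "\<lambda>t. (k (\<phi>' t))\<^sup>2"] L2_square_integrable[OF kL] by (simp_all add: sq)
  have le: "(k' t)\<^sup>2 \<le> L * (r t * (k (\<phi>' t))\<^sup>2)" for t
  proof -
    have "(r t * r t) * (k (\<phi>' t))\<^sup>2 \<le> (L * r t) * (k (\<phi>' t))\<^sup>2"
      using r0 by (intro mult_right_mono) auto
    then show ?thesis by (simp add: k'_def power2_eq_square algebra_simps)
  qed
  have k'_meas [measurable]: "k' \<in> borel_measurable borel" unfolding k'_def by measurable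
  have int': "integrable lborel (\<lambda>t. (k' t)\<^sup>2)"
  proof (rule Bochner_Integration.integrable_bound)
    show "integrable lborel (\<lambda>t. L * (r t * (k (\<phi>' t))\<^sup>2))" using int by simp
    show "AE t in lborel. norm ((k' t)\<^sup>2) \<le> norm (L * (r t * (k (\<phi>' t))\<^sup>2))"
      using le r0 L by (auto simp: abs_mult)
  qed measurable
  have k'L: "k' \<in> L2 a b" using int' r0 k'_meas by (auto simp: L2_def k'_def)
  have "(\<integral>t. (k' t)\<^sup>2 \<partial>lborel) \<le> (\<integral>t. L * (r t * (k (\<phi>' t))\<^sup>2) \<partial>lborel)"
    using int' int le by (intro integral_mono) auto
  then have E: "(\<integral>t. (k' t)\<^sup>2 \<partial>lborel) \<le> L * (\<integral>t. (k t)\<^sup>2 \<partial>lborel)" using int by simp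
  have "f (\<phi> y) = (\<integral>t. indicator {..y} t * k' t \<partial>lborel)" if y: "y \<in> {a..b}" for y
  proof -
    have mono: "\<psi> x \<le> y \<longleftrightarrow> x \<le> \<phi> y" if x: "x \<in> {c..d}" for x
      using lip[OF y \<psi>[OF x]] lip[OF \<psi>[OF x] y] \<phi>\<psi>[OF x] \<psi>\<phi>[OF y] by (smt (verit))
    have "(\<integral>t. indicator {..y} t * k' t \<partial>lborel) = (\<integral>t. r t * (indicator {..y} t * k (\<phi>' t)) \<partial>lborel)"
      by (simp add: k'_def mult.left_commute)
    also have "\<dots> = (\<integral>x. indicator {c..d} x * (indicator {..y} (\<psi>' x) * k (\<phi>' (\<psi>' x))) \<partial>lborel)"
      by (rule change) measurable
    also have "\<dots> = (\<integral>x. indicator {..\<phi> y} x * k x \<partial>lborel)"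
    proof (rule Bochner_Integration.integral_cong)
      fix x
      show "indicator {c..d} x * (indicator {..y} (\<psi>' x) * k (\<phi>' (\<psi>' x))) = indicator {..\<phi> y} x * k x"
        using mono[of x] \<psi>'_eq[of x] \<phi>\<psi>'[of x] L2_outside[OF kL, of x] by (cases "x \<in> {c..d}") (auto simp: indicator_def)
    qed simp
    also have "\<dots> = f (\<phi> y)" using f \<phi>[OF y] by (simp add: has_grad_def)
    finally show ?thesis by simp
  qed
  then have "has_grad a b (\<lambda>x. f (\<phi> x)) k'" using k'L by (auto simp: has_grad_def)
  then show ?thesis using E by blast
qed

text \<open>Reflection turns a primitive starting at c into one starting at d; these differ by the
  total integral of k, which is 0 because f d = 0.\<close>

lemma has_grad_reflect:
  assumes f: "has_grad c d f k" and fd: "f d = 0" and cd: "c \<le> d"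
  shows "has_grad c d (\<lambda>x. f (c + d - x)) (\<lambda>t. - k (c + d - t))"
proof -
  note kL = has_grad_L2[OF f]
  have k_meas [measurable]: "k \<in> borel_measurable borel" using L2_measurable[OF kL] .
  have "integrable lborel (\<lambda>t. (k (c + d + (-1) * t))\<^sup>2)"
    using lborel_integrable_real_affine[OF L2_square_integrable[OF kL], of "-1" "c + d"] by simp
  then have L: "(\<lambda>t. - k (c + d - t)) \<in> L2 c d"
    using L2_outside[OF kL] by (auto simp: L2_def)
  have tot: "(\<integral>t. k t \<partial>lborel) = 0"
  proof -
    have "f d = (\<integral>t. indicator {..d} t * k t \<partial>lborel)" using f cd by (auto simp: has_grad_def)
    also have "\<dots> = (\<integral>t. k t \<partial>lborel)"
      using L2_outside[OF kL] by (intro Bochner_Integration.integral_cong) (auto simp: indicator_def)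
    finally show ?thesis using fd by simp
  qed
  have "f (c + d - x) = (\<integral>t. indicator {..x} t * - k (c + d - t) \<partial>lborel)" if x: "x \<in> {c..d}" for x
  proof -
    let ?y = "c + d - x"
    have ik: "integrable lborel k" using L2_integrable[OF kL] .
    then have ik': "integrable lborel (\<lambda>t. indicator {..?y} t * k t)"
      using integrable_mult_indicator[OF _ ik, of "{..?y}"] by simp
    have "(\<integral>t. indicator {?y..} t * - k t \<partial>lborel) = (\<integral>t. indicator {..?y} t * k t - k t \<partial>lborel)"
    proof (rule integral_cong_AE)
      show "AE t in lborel. indicator {?y..} t * - k t = indicator {..?y} t * k t - k t"
        using AE_lborel_singleton[of ?y] by eventually_elim (auto simp: indicator_def)
    qed measurable
    also have "\<dots> = f ?y" using ik ik' f x tot by (simp add: has_grad_def)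
    finally have 1: "(\<integral>t. indicator {?y..} t * - k t \<partial>lborel) = f ?y" .
    have "(\<integral>t. indicator {?y..} t * - k t \<partial>lborel) =
        (\<integral>t. indicator {?y..} (c + d + (-1) * t) * - k (c + d + (-1) * t) \<partial>lborel)"
      using lborel_integral_real_affine[of "-1" "\<lambda>t. indicator {?y..} t * - k t" "c + d"] by simp
    also have "\<dots> = (\<integral>t. indicator {..x} t * - k (c + d - t) \<partial>lborel)"
      by (intro Bochner_Integration.integral_cong) (auto simp: indicator_def)
    finally show ?thesis using 1 by simp
  qed
  then show ?thesis using L by (auto simp: has_grad_def)
qed

lemma energy_compose:
  fixes \<phi> \<psi> :: "real \<Rightarrow> real"
  assumes ab: "a < b" and cd: "c < d" and L: "L \<ge> 0"
    and \<phi>: "\<And>x. x \<in> {a..b} \<Longrightarrow> \<phi> x \<in> {c..d}" and \<psi>: "\<And>x. x \<in> {c..d} \<Longrightarrow> \<psi> x \<in> {a..b}"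
    and \<phi>\<psi>: "\<And>x. x \<in> {c..d} \<Longrightarrow> \<phi> (\<psi> x) = x" and \<psi>\<phi>: "\<And>x. x \<in> {a..b} \<Longrightarrow> \<psi> (\<phi> x) = x"
    and lip: "\<And>x y. x \<in> {a..b} \<Longrightarrow> y \<in> {a..b} \<Longrightarrow> \<bar>\<phi> x - \<phi> y\<bar> \<le> L * \<bar>x - y\<bar>"
    and \<psi>_cont: "continuous_on {c..d} \<psi>"
    and mono: "mono_on {a..b} \<phi> \<or> antimono_on {a..b} \<phi>"
    and f: "f \<in> H10 c d"
  shows "(\<lambda>x. if x \<in> {a..b} then f (\<phi> x) else 0) \<in> H10 a b \<and>
    energy a b (\<lambda>x. if x \<in> {a..b} then f (\<phi> x) else 0) (\<lambda>x. if x \<in> {a..b} then f (\<phi> x) else 0) \<le> L * energy c d f f"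
proof -
  let ?T = "\<lambda>x. if x \<in> {a..b} then f (\<phi> x) else 0"
  obtain k where k: "has_grad c d f k" and f0: "f c = 0" "f d = 0" using f by (auto simp: H10_iff)
  have "\<exists>k'. has_grad a b (\<lambda>x. f (\<phi> x)) k' \<and> (\<integral>t. (k' t)\<^sup>2 \<partial>lborel) \<le> L * (\<integral>t. (k t)\<^sup>2 \<partial>lborel)
     \<and> \<phi> a \<in> {c, d} \<and> \<phi> b \<in> {c, d}"
    using mono
  proof
    assume mono: "mono_on {a..b} \<phi>"
    have l: "\<phi> x \<le> \<phi> y \<and> \<phi> y - \<phi> x \<le> L * (y - x)" if "x \<in> {a..b}" "y \<in> {a..b}" "x \<le> y" for x y
      using lip[OF that(1,2)] monotone_onD[OF mono that] that(3) by auto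
    have "\<phi> a \<le> \<phi> (\<psi> c)" "\<phi> (\<psi> d) \<le> \<phi> b" using l[of a "\<psi> c"] l[of "\<psi> d" b] \<psi>[of c] \<psi>[of d] ab cd by auto
    then have "\<phi> a = c" "\<phi> b = d" using \<phi>\<psi>[of c] \<phi>\<psi>[of d] \<phi>[of a] \<phi>[of b] ab cd by auto
    then show ?thesis using has_grad_compose_increasing[OF ab cd L \<phi> \<psi> \<phi>\<psi> \<psi>\<phi> l \<psi>_cont k] by auto
  next
    assume anti: "antimono_on {a..b} \<phi>"
    \<comment> \<open>A decreasing \<phi> followed by the reflection of [c, d] is increasing; f is
      reflected as well, so that the composition is still f o \<phi>.\<close>
    let ?\<phi> = "\<lambda>x. c + d - \<phi> x" and ?\<psi> = "\<lambda>x. \<psi> (c + d - x)"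
    have l: "?\<phi> x \<le> ?\<phi> y \<and> ?\<phi> y - ?\<phi> x \<le> L * (y - x)" if "x \<in> {a..b}" "y \<in> {a..b}" "x \<le> y" for x y
      using lip[OF that(1,2)] monotone_onD[OF anti that] that(3) by auto
    have "\<phi> (\<psi> d) \<le> \<phi> a" "\<phi> b \<le> \<phi> (\<psi> c)" using l[of a "\<psi> d"] l[of "\<psi> c" b] \<psi>[of c] \<psi>[of d] ab cd by auto
    then have ends: "\<phi> a = d" "\<phi> b = c" using \<phi>\<psi>[of c] \<phi>\<psi>[of d] \<phi>[of a] \<phi>[of b] ab cd by auto
    have "\<exists>k'. has_grad a b (\<lambda>x. f (c + d - ?\<phi> x)) k' \<and>
        (\<integral>t. (k' t)\<^sup>2 \<partial>lborel) \<le> L * (\<integral>t. (- k (c + d - t))\<^sup>2 \<partial>lborel)"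
    proof (rule has_grad_compose_increasing[OF ab cd L _ _ _ _ l])
      show "has_grad c d (\<lambda>x. f (c + d - x)) (\<lambda>t. - k (c + d - t))"
        using cd by (intro has_grad_reflect[OF k f0(2)]) auto
      show "continuous_on {c..d} ?\<psi>"
        by (intro continuous_on_compose2[OF \<psi>_cont] continuous_intros) auto
      show "?\<phi> x \<in> {c..d}" if "x \<in> {a..b}" for x using \<phi>[OF that] by auto
      show "?\<psi> x \<in> {a..b}" if "x \<in> {c..d}" for x using \<psi>[of "c + d - x"] that by auto
      show "?\<phi> (?\<psi> x) = x" if "x \<in> {c..d}" for x using \<phi>\<psi>[of "c + d - x"] that by auto
      show "?\<psi> (?\<phi> x) = x" if "x \<in> {a..b}" for x using \<psi>\<phi>[OF that] by simp
    qed
    moreover have "(\<integral>t. (- k (c + d - t))\<^sup>2 \<partial>lborel) = (\<integral>t. (k t)\<^sup>2 \<partial>lborel)"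
      using lborel_integral_real_affine[of "-1" "\<lambda>t. (k t)\<^sup>2" "c + d"] by simp
    ultimately show ?thesis using ends by simp
  qed
  then obtain k' where k': "has_grad a b (\<lambda>x. f (\<phi> x)) k'" "(\<integral>t. (k' t)\<^sup>2 \<partial>lborel) \<le> L * (\<integral>t. (k t)\<^sup>2 \<partial>lborel)"
    and ends: "\<phi> a \<in> {c, d}" "\<phi> b \<in> {c, d}" by blast
  have T: "has_grad a b ?T k'" using k'(1) by (simp add: has_grad_def)
  then have "?T \<in> H10 a b" using ends f0 by (auto simp: H10_iff)
  moreover have "energy a b ?T ?T \<le> L * energy c d f f"
    using energy_eq[OF T T] energy_eq[OF k k] k'(2) by (simp add: power2_eq_square)
  ultimately show ?thesis by blast
qed

section \<open>Moving trial spaces between the two intervals\<close>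

lemma at_least_eigenvalues_upto_transfer:
  assumes ab: "a < b" "finite_borel_measure_on a b \<mu>" and cd: "c < d" "finite_borel_measure_on c d \<nu>"
    and T: "Vector_Spaces.linear fun_scale fun_scale T"
    and inj: "inj_on T (H10 a b)" and H: "\<And>f. f \<in> H10 a b \<Longrightarrow> T f \<in> H10 c d"
    and E: "\<And>f. f \<in> H10 a b \<Longrightarrow> energy c d (T f) (T f) \<le> L * energy a b f f"
    and m: "\<And>f. f \<in> H10 a b \<Longrightarrow> mass \<nu> (T f) (T f) = mass \<mu> f f"
    and L: "0 \<le> L" and al: "at_least_eigenvalues_upto a b \<mu> i l"
  shows "at_least_eigenvalues_upto c d \<nu> i (L * l)"
proof -
  interpret T: Vector_Spaces.linear fun_scale fun_scale T by (rule T)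
  obtain S where S: "S \<subseteq> H10 a b" "finite S" "T.vs1.independent S" "card S = i"
    "\<forall>f\<in>T.vs1.span S. energy a b f f \<le> l * mass \<mu> f f"
    using al unfolding at_least_eigenvalues_upto_iff[OF ab] by (elim exE conjE)
  have span: "T.vs1.span S \<subseteq> H10 a b"
    using S(1) subspace_H10[of a b] ab by (intro T.vs1.span_minimal) auto
  have le: "energy c d (T f) (T f) \<le> (L * l) * mass \<nu> (T f) (T f)" if f: "f \<in> T.vs1.span S" for f
  proof -
    have fH: "f \<in> H10 a b" using f span by blast
    have "energy c d (T f) (T f) \<le> L * energy a b f f" by (rule E[OF fH])
    also have "\<dots> \<le> L * (l * mass \<mu> f f)" using S(5) f L by (intro mult_left_mono) auto
    finally show ?thesis by (simp add: m[OF fH] mult.assoc)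
  qed
  have "T.vs1.independent (T ` S)"
    using S(3) inj span by (intro T.independent_injective_image) (auto intro: inj_on_subset)
  moreover have "card (T ` S) = i" using S(1,4) inj inj_on_subset card_image by blast
  moreover have "T ` S \<subseteq> H10 c d" using S(1) H by auto
  moreover have "\<forall>h\<in>T.vs1.span (T ` S). energy c d h h \<le> (L * l) * mass \<nu> h h"
    using le by (auto simp: T.span_image)
  ultimately show ?thesis
    unfolding at_least_eigenvalues_upto_iff[OF cd] using S(2) by (intro exI[of _ "T ` S"]) auto
qed

lemma ith_eigenvalue_le:
  assumes i: "i \<ge> 1" and L: "0 < L"
    and "\<And>l. at_least_eigenvalues_upto a b \<mu> i l \<Longrightarrow> at_least_eigenvalues_upto c d \<nu> i (L * l)"
  shows "ith_eigenvalue c d \<nu> i \<le> ereal L * ith_eigenvalue a b \<mu> i"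
proof -
  have "ith_eigenvalue c d \<nu> i / ereal L \<le> ith_eigenvalue a b \<mu> i"
    unfolding ith_eigenvalue_eq_Inf[OF i, of a]
  proof (rule Inf_greatest)
    fix x assume "x \<in> {ereal l | l. at_least_eigenvalues_upto a b \<mu> i l}"
    then obtain l where l: "x = ereal l" "at_least_eigenvalues_upto a b \<mu> i l" by auto
    have "ith_eigenvalue c d \<nu> i \<le> ereal (L * l)"
      unfolding ith_eigenvalue_eq_Inf[OF i] using assms(3)[OF l(2)] by (intro Inf_lower) auto
    then show "ith_eigenvalue c d \<nu> i / ereal L \<le> x"
      using L by (simp add: l(1) ereal_divide_le_pos)
  qed
  then show ?thesis using L by (simp add: ereal_divide_le_pos)
qed

text \<open>Pulling functions back along \<phi> moves trial spaces from [c, d] to [a, b], against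
  the direction of \<phi>, and the price is the Lipschitz constant of \<phi>.\<close>

lemma at_least_eigenvalues_upto_compose:
  fixes \<phi> \<psi> :: "real \<Rightarrow> real"
  assumes ab: "a < b" "finite_borel_measure_on a b \<mu>" and cd: "c < d" "finite_borel_measure_on c d \<nu>"
    and L: "L \<ge> 0"
    and \<phi>: "\<And>x. x \<in> {a..b} \<Longrightarrow> \<phi> x \<in> {c..d}" and \<psi>: "\<And>x. x \<in> {c..d} \<Longrightarrow> \<psi> x \<in> {a..b}"
    and \<phi>\<psi>: "\<And>x. x \<in> {c..d} \<Longrightarrow> \<phi> (\<psi> x) = x" and \<psi>\<phi>: "\<And>x. x \<in> {a..b} \<Longrightarrow> \<psi> (\<phi> x) = x"
    and lip: "\<And>x y. x \<in> {a..b} \<Longrightarrow> y \<in> {a..b} \<Longrightarrow> \<bar>\<phi> x - \<phi> y\<bar> \<le> L * \<bar>x - y\<bar>"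
    and \<psi>_cont: "continuous_on {c..d} \<psi>"
    and mono: "mono_on {a..b} \<phi> \<or> antimono_on {a..b} \<phi>"
    and m: "\<And>f. f \<in> H10 c d \<Longrightarrow> (\<integral>x. (f (\<phi> x))\<^sup>2 \<partial>\<mu>) = (\<integral>x. (f x)\<^sup>2 \<partial>\<nu>)"
    and al: "at_least_eigenvalues_upto c d \<nu> i l"
  shows "at_least_eigenvalues_upto a b \<mu> i (L * l)"
proof (rule at_least_eigenvalues_upto_transfer[OF cd ab _ _ _ _ _ L al])
  \<comment> \<open>Cut off outside [a, b], where members of \<open>H10\<close> have to vanish and
    nothing is known about \<phi>.\<close>
  let ?T = "\<lambda>f x. if x \<in> {a..b} then f (\<phi> x) else (0::real)"
  have compose: "?T f \<in> H10 a b \<and> energy a b (?T f) (?T f) \<le> L * energy c d f f" if "f \<in> H10 c d" for f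
    by (rule energy_compose[OF ab(1) cd(1) L \<phi> \<psi> \<phi>\<psi> \<psi>\<phi> lip \<psi>_cont mono that])
  interpret vector_space fun_scale by (rule vector_space_fun_scale)
  show "Vector_Spaces.linear fun_scale fun_scale ?T"
    by unfold_locales (auto simp: fun_scale_def fun_eq_iff)
  show "inj_on ?T (H10 c d)"
  proof (rule inj_onI)
    fix f h assume fh: "f \<in> H10 c d" "h \<in> H10 c d" "?T f = ?T h"
    have "f x = h x" for x
    proof (cases "x \<in> {c..d}")
      case True
      then show ?thesis using fun_cong[OF fh(3), of "\<psi> x"] \<psi>[OF True] \<phi>\<psi>[OF True] by simp
    next
      case False
      then show ?thesis using fh(1,2) by (auto simp: H10_iff)
    qed
    then show "f = h" by auto
  qed
  show "?T f \<in> H10 a b" "energy a b (?T f) (?T f) \<le> L * energy c d f f" if "f \<in> H10 c d" for f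
    using compose[OF that] by blast+
  show "mass \<mu> (?T f) (?T f) = mass \<nu> f f" if "f \<in> H10 c d" for f
  proof -
    have "mass \<mu> (?T f) (?T f) = (\<integral>x. (f (\<phi> x))\<^sup>2 \<partial>\<mu>)"
      unfolding mass_def using space_finite_borel_measure_on[OF ab(2)]
      by (intro Bochner_Integration.integral_cong) (auto simp: power2_eq_square)
    then show ?thesis using m[OF that] by (simp add: mass_def power2_eq_square)
  qed
qed

theorem proposition1p13:
  fixes a b :: real and \<nu> :: "real measure" and g :: "real \<Rightarrow> real"
  assumes "finite_borel_measure_on 0 1 \<nu>"
    and "g ` {0..1} = {a..b}"
    and "bi_lipschitz_on {0..1} g"
  shows "\<exists>c::real. c \<ge> 1 \<and> (\<forall>i::nat. i \<ge> 1 \<longrightarrow>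
           ereal (1 / c) * ith_eigenvalue 0 1 \<nu> i \<le> ith_eigenvalue a b (image_measure a b g \<nu>) i \<and>
           ith_eigenvalue a b (image_measure a b g \<nu>) i \<le> ereal c * ith_eigenvalue 0 1 \<nu> i)"
proof -
  obtain c1 c2 where c: "c1 > 0" "c2 > 0"
    and lip: "\<And>x y. x \<in> {0..1} \<Longrightarrow> y \<in> {0..1} \<Longrightarrow> c1 * \<bar>x - y\<bar> \<le> \<bar>g x - g y\<bar> \<and> \<bar>g x - g y\<bar> \<le> c2 * \<bar>x - y\<bar>"
    using assms(3) unfolding bi_lipschitz_on_def by blast
  \<comment> \<open>1 / c1 is a Lipschitz constant of the inverse and c2 one of g; the 1 secures the
    required c >= 1.\<close>
  define c where "c = max 1 (max (1 / c1) c2)"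
  have c1: "1 \<le> c" "1 / c1 \<le> c" "c2 \<le> c" by (auto simp: c_def)
  have inj: "inj_on g {0..1}"
  proof (rule inj_onI)
    fix x y assume xy: "x \<in> {0..1}" "y \<in> {0..1}" "g x = g y"
    then have "c1 * \<bar>x - y\<bar> \<le> 0" using lip[OF xy(1,2)] by simp
    then show "x = y" using c(1) by (simp add: mult_le_0_iff)
  qed
  have lip_g: "\<bar>g x - g y\<bar> \<le> c * \<bar>x - y\<bar>" if "x \<in> {0..1}" "y \<in> {0..1}" for x y
  proof -
    have "c2 * \<bar>x - y\<bar> \<le> c * \<bar>x - y\<bar>" using c1 by (intro mult_right_mono) auto
    then show ?thesis using lip[OF that] by linarith
  qed
  define \<psi> where "\<psi> = inv_into {0..1} g"
  have gI: "g x \<in> {a..b}" if "x \<in> {0..1}" for x using assms(2) that by blast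
  have \<psi>I: "\<psi> y \<in> {0..1}" if "y \<in> {a..b}" for y unfolding \<psi>_def using assms(2) that by (intro inv_into_into) auto
  have g\<psi>: "g (\<psi> y) = y" if "y \<in> {a..b}" for y unfolding \<psi>_def using assms(2) that by (intro f_inv_into_f) auto
  have \<psi>g: "\<psi> (g x) = x" if "x \<in> {0..1}" for x unfolding \<psi>_def using inj that by (rule inv_into_f_f)
  have lip_\<psi>: "\<bar>\<psi> x - \<psi> y\<bar> \<le> c * \<bar>x - y\<bar>" if "x \<in> {a..b}" "y \<in> {a..b}" for x y
  proof -
    have "c1 * \<bar>\<psi> x - \<psi> y\<bar> \<le> \<bar>x - y\<bar>" using lip[OF \<psi>I[OF that(1)] \<psi>I[OF that(2)]] g\<psi> that by simp
    then have "\<bar>\<psi> x - \<psi> y\<bar> \<le> 1 / c1 * \<bar>x - y\<bar>" using c(1) by (simp add: field_simps)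
    also have "\<dots> \<le> c * \<bar>x - y\<bar>" using c1 by (intro mult_right_mono) auto
    finally show ?thesis .
  qed
  have cont: "continuous_on {l..u} h" if "\<And>x y. x \<in> {l..u} \<Longrightarrow> y \<in> {l..u} \<Longrightarrow> \<bar>h x - h y\<bar> \<le> c * \<bar>x - y\<bar>"
    for l u :: real and h :: "real \<Rightarrow> real"
    using that c1 by (intro lipschitz_on_continuous_on[of c] lipschitz_onI) (auto simp: dist_real_def)
  have g_cont: "continuous_on {0..1} g" by (rule cont[OF lip_g])
  have \<psi>_cont: "continuous_on {a..b} \<psi>" by (rule cont[OF lip_\<psi>])
  \<comment> \<open>Forced by injectivity: the image contains two distinct points.\<close>
  have ab: "a < b"
  proof -
    have "g 0 \<noteq> g 1" using inj by (auto dest: inj_onD)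
    then show ?thesis using gI[of 0] gI[of 1] by auto
  qed
  have strict: "strict_mono_on {0..1} g \<or> strict_antimono_on {0..1} g"
    using injective_eq_monotone_map[of "{0..1}" g] g_cont inj by (auto simp: is_interval_cc)
  then have g_mono: "mono_on {0..1} g \<or> antimono_on {0..1} g"
    by (auto simp: monotone_on_def le_less)
  have \<psi>_mono: "mono_on {a..b} \<psi> \<or> antimono_on {a..b} \<psi>"
    using strict
  proof
    assume "strict_mono_on {0..1} g"
    then have "\<psi> x \<le> \<psi> y" if "x \<in> {a..b}" "y \<in> {a..b}" "x \<le> y" for x y
      using monotone_onD[of "{0..1}" "(<)" "(<)" g "\<psi> y" "\<psi> x"] \<psi>I that g\<psi> by (fastforce simp: not_le[symmetric])
    then show ?thesis by (auto simp: monotone_on_def)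
  next
    assume "strict_antimono_on {0..1} g"
    then have "\<psi> y \<le> \<psi> x" if "x \<in> {a..b}" "y \<in> {a..b}" "x \<le> y" for x y
      using monotone_onD[of "{0..1}" "(<)" "(>)" g "\<psi> x" "\<psi> y"] \<psi>I that g\<psi> by (fastforce simp: not_le[symmetric])
    then show ?thesis by (auto simp: monotone_on_def)
  qed
  \<comment> \<open>The image measure lives on the open interval, so interior points must go to
    interior points; strict monotonicity keeps them off the end points.\<close>
  have g_open: "g x \<in> {a<..<b}" if x: "x \<in> {0<..<1}" for x
    using strict
  proof
    assume "strict_mono_on {0..1} g"
    then have "g 0 < g x" "g x < g 1" using x by (auto simp: monotone_on_def)
    then show ?thesis using gI[of 0] gI[of 1] by auto
  next
    assume "strict_antimono_on {0..1} g"
    then have "g x < g 0" "g 1 < g x" using x by (auto simp: monotone_on_def)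
    then show ?thesis using gI[of 0] gI[of 1] by auto
  qed
  define \<mu> where "\<mu> = image_measure a b g \<nu>"
  have sp: "space \<nu> = {0<..<1}" by (rule space_finite_borel_measure_on[OF assms(1)])
  have g_meas: "g \<in> measurable \<nu> (restrict_space borel {a<..<b})"
    using measurable_finite_borel_measure_on[OF assms(1) g_cont] g_open sp
    by (intro measurable_restrict_space2) auto
  have \<mu>: "finite_borel_measure_on a b \<mu>"
    using assms(1) g_meas finite_measure.finite_measure_distr
    by (auto simp: finite_borel_measure_on_def \<mu>_def image_measure_def)
  have int_\<mu>: "(\<integral>y. h y \<partial>\<mu>) = (\<integral>x. h (g x) \<partial>\<nu>)" if h: "continuous_on {a..b} h" for h :: "real \<Rightarrow> real"
    unfolding \<mu>_def image_measure_def
    using g_meas by (rule integral_distr)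
      (intro borel_measurable_continuous_on_restrict continuous_on_subset[OF h], auto)
  have "ith_eigenvalue a b \<mu> i \<le> ereal c * ith_eigenvalue 0 1 \<nu> i" if i: "i \<ge> 1" for i
  proof (rule ith_eigenvalue_le[OF i])
    fix l assume al: "at_least_eigenvalues_upto 0 1 \<nu> i l"
    show "at_least_eigenvalues_upto a b \<mu> i (c * l)"
    \<comment> \<open>The substitution here is \<psi> from [a, b] to [0, 1], so trial spaces move
      from [0, 1] to [a, b]. The other inequality uses g in the same way.\<close>
    proof (rule at_least_eigenvalues_upto_compose[OF ab \<mu> zero_less_one assms(1) _ \<psi>I gI \<psi>g g\<psi> lip_\<psi> g_cont \<psi>_mono])
      fix f assume f: "f \<in> H10 0 1"
      have "continuous_on {a..b} (\<lambda>y. (f (\<psi> y))\<^sup>2)"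
        using \<psi>I by (intro continuous_on_power continuous_on_compose2[OF H10_continuous_on[OF f] \<psi>_cont]) auto
      then have "(\<integral>y. (f (\<psi> y))\<^sup>2 \<partial>\<mu>) = (\<integral>x. (f (\<psi> (g x)))\<^sup>2 \<partial>\<nu>)" by (rule int_\<mu>)
      also have "\<dots> = (\<integral>x. (f x)\<^sup>2 \<partial>\<nu>)"
        using \<psi>g sp by (intro Bochner_Integration.integral_cong) auto
      finally show "(\<integral>y. (f (\<psi> y))\<^sup>2 \<partial>\<mu>) = (\<integral>x. (f x)\<^sup>2 \<partial>\<nu>)" .
    qed (use c1 al in auto)
  qed (use c1 in auto)
  moreover have "ith_eigenvalue 0 1 \<nu> i \<le> ereal c * ith_eigenvalue a b \<mu> i" if i: "i \<ge> 1" for i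
  proof (rule ith_eigenvalue_le[OF i])
    fix l assume al: "at_least_eigenvalues_upto a b \<mu> i l"
    show "at_least_eigenvalues_upto 0 1 \<nu> i (c * l)"
    proof (rule at_least_eigenvalues_upto_compose[OF zero_less_one assms(1) ab \<mu> _ gI \<psi>I g\<psi> \<psi>g lip_g \<psi>_cont g_mono])
      fix f assume f: "f \<in> H10 a b"
      show "(\<integral>x. (f (g x))\<^sup>2 \<partial>\<nu>) = (\<integral>y. (f y)\<^sup>2 \<partial>\<mu>)"
        using int_\<mu>[OF continuous_on_power[OF H10_continuous_on[OF f]]] by (rule HOL.sym)
    qed (use c1 al in auto)
  qed (use c1 in auto)
  \<comment> \<open>Turns the second bound into the lower one; the case distinction includes
    infinite eigenvalues.\<close>
  moreover have "ereal (1 / c) * x \<le> y" if "x \<le> ereal c * y" for x y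
    using that c1 by (cases x; cases y) (auto simp: field_simps)
  ultimately show ?thesis unfolding \<mu>_def using c1 by blast
qed

end
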